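(* Let $\Gamma$ be a non-trivial countable torsion-free nilpotent group which is not rank-one Abelian. Then the space of orderings $\mathcal{O}(\Gamma)$ is homeomorphic to the Cantor set. Consequently, for each left-invariant total order $\preceq$ on $\Gamma$, the semigroup formed by the elements $g \in \Gamma$ satisfying $g \succ id$ is not finitely generated.
   Context: An ordering on a group $\Gamma$ is a total order relation $\preceq$ on $\Gamma$ that is left-invariant ($g \preceq h$ implies $fg \preceq fh$ for all $f,g,h \in \Gamma$). $\mathcal{O}(\Gamma)$ denotes the set of all orderings on $\Gamma$, endowed with the topology having as sub-basis the sets $U_{f,g} = \{\preceq \,:\, f \prec g\}$, $f,g \in \Gamma$, $f\neq g$. The rank of a torsion-free Abelian group is the minimal dimension of a vector space over $\mathbb{Q}$ in which the group embeds. *)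

theory Defs
  imports
    "HOL-Analysis.Analysis"
    "HOL-Algebra.Generated_Groups"
    "HOL-Library.Function_Algebras"
    "HOL-Library.Extended_Nat"
begin

definition torsion_free :: "('a, 'b) monoid_scheme \<Rightarrow> bool" where
  "torsion_free G \<longleftrightarrow>
     (\<forall>x \<in> carrier G. x \<noteq> \<one>\<^bsub>G\<^esub> \<longrightarrow> (\<forall>n::nat. 0 < n \<longrightarrow> x [^]\<^bsub>G\<^esub> n \<noteq> \<one>\<^bsub>G\<^esub>))"

primrec lower_central :: "('a, 'b) monoid_scheme \<Rightarrow> nat \<Rightarrow> 'a set" where
  "lower_central G 0 = carrier G"
| "lower_central G (Suc n) =
     generate G {x \<otimes>\<^bsub>G\<^esub> y \<otimes>\<^bsub>G\<^esub> inv\<^bsub>G\<^esub> x \<otimes>\<^bsub>G\<^esub> inv\<^bsub>G\<^esub> y | x y. x \<in> lower_central G n \<and> y \<in> carrier G}"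

definition nilpotent :: "('a, 'b) monoid_scheme \<Rightarrow> bool" where
  "nilpotent G \<longleftrightarrow> (\<exists>n. lower_central G n = {\<one>\<^bsub>G\<^esub>})"

definition rat_scale :: "rat \<Rightarrow> (nat \<Rightarrow> rat) \<Rightarrow> (nat \<Rightarrow> rat)" where
  "rat_scale q v = (\<lambda>i. q * v i)"

interpretation rat_fun: vector_space rat_scale
  by standard (simp_all add: rat_scale_def fun_eq_iff algebra_simps)

text \<open>
  The rational vector space of all sequences \<^typ>\<open>nat \<Rightarrow> rat\<close> is infinite-dimensional, so every
  finite-dimensional rational vector space is isomorphic to one of its subspaces, and it is
  enough to let \<open>V\<close> range over these. The rank is infinite (an infimum over the empty set)
  when there is no embedding into a finite-dimensional space.
\<close>

definition embeds_in_dim :: "('a, 'b) monoid_scheme \<Rightarrow> nat \<Rightarrow> bool" where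
  "embeds_in_dim G n \<longleftrightarrow>
     (\<exists>V B. finite B \<and> card B = n \<and> rat_fun.independent B \<and> rat_fun.span B = V \<and>
        (\<exists>h. h \<in> mon G \<lparr>carrier = V, monoid.mult = (+), one = 0\<rparr>))"

definition abelian_rank :: "('a, 'b) monoid_scheme \<Rightarrow> enat" where
  "abelian_rank G = (INF n \<in> {n. embeds_in_dim G n}. enat n)"

text \<open>
  An ordering is the set of pairs \<open>(x, y)\<close> with \<open>x \<preceq> y\<close>. By \<^const>\<open>linear_order_on\<close> it is contained
  in \<open>carrier G \<times> carrier G\<close>, so distinct sets of pairs are distinct orderings.
\<close>

definition orderings :: "('a, 'b) monoid_scheme \<Rightarrow> ('a \<times> 'a) set set" where
  "orderings G =
     {r. linear_order_on (carrier G) r \<and>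
         (\<forall>f \<in> carrier G. \<forall>g \<in> carrier G. \<forall>h \<in> carrier G.
            (g, h) \<in> r \<longrightarrow> (f \<otimes>\<^bsub>G\<^esub> g, f \<otimes>\<^bsub>G\<^esub> h) \<in> r)}"

definition order_subbasic :: "('a, 'b) monoid_scheme \<Rightarrow> 'a \<Rightarrow> 'a \<Rightarrow> ('a \<times> 'a) set set" where
  "order_subbasic G f g = {r \<in> orderings G. (f, g) \<in> r \<and> f \<noteq> g}"

text \<open>
  The underlying set of \<^const>\<open>topology_generated_by\<close> is the union of the given family. Adding the
  whole space (the empty intersection of subbasic sets) makes it \<^term>\<open>orderings G\<close> in all cases.
\<close>

definition ordering_space :: "('a, 'b) monoid_scheme \<Rightarrow> ('a \<times> 'a) set topology" where
  "ordering_space G =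
     topology_generated_by
       (insert (orderings G)
          {order_subbasic G f g | f g. f \<in> carrier G \<and> g \<in> carrier G \<and> f \<noteq> g})"

lemma topspace_ordering_space: "topspace (ordering_space G) = orderings G"
  unfolding ordering_space_def topology_generated_by_topspace
  by (auto simp: order_subbasic_def)

primrec cantor_stage :: "nat \<Rightarrow> real set" where
  "cantor_stage 0 = {0..1}"
| "cantor_stage (Suc n) =
     (\<lambda>x. x / 3) ` cantor_stage n \<union> (\<lambda>x. (x + 2) / 3) ` cantor_stage n"

definition cantor_set :: "real set" where
  "cantor_set = (\<Inter>n. cantor_stage n)"

definition positive_cone :: "('a, 'b) monoid_scheme \<Rightarrow> ('a \<times> 'a) set \<Rightarrow> 'a set" where
  "positive_cone G r = {g \<in> carrier G. (\<one>\<^bsub>G\<^esub>, g) \<in> r \<and> g \<noteq> \<one>\<^bsub>G\<^esub>}"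

inductive_set semigroup_generated :: "('a, 'b) monoid_scheme \<Rightarrow> 'a set \<Rightarrow> 'a set"
  for G and S where
  incl: "x \<in> S \<Longrightarrow> x \<in> semigroup_generated G S"
| mult: "x \<in> semigroup_generated G S \<Longrightarrow> y \<in> semigroup_generated G S \<Longrightarrow>
           x \<otimes>\<^bsub>G\<^esub> y \<in> semigroup_generated G S"

definition finitely_generated_semigroup :: "('a, 'b) monoid_scheme \<Rightarrow> 'a set \<Rightarrow> bool" where
  "finitely_generated_semigroup G P \<longleftrightarrow>
     (\<exists>S. finite S \<and> S \<subseteq> P \<and> semigroup_generated G S = P)"

end

theory Submission
  imports Defs
begin

text \<open>
  A left order is determined by its positive cone. A finite set \<open>F\<close> lies in a positive cone if and
  only if the semigroup generated by \<open>F\<close> avoids the identity; call \<open>F\<close> good in that case. Everything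
  rests on one fact about a finitely generated nilpotent group \<open>H\<close>: a submonoid that does not contain
  a power of every element is contained in a proper submonoid \<open>M\<close> that contains all commutators and,
  for every \<open>x\<close>, one of \<open>x\<close> and \<open>x\<^sup>-\<^sup>1\<close>. Indeed, by descending the lower central series one finds
  that already the image in the abelianization misses all powers of some element, and there Zorn's
  lemma applies.

  If \<open>F\<close> is good and \<open>g \<noteq> 1\<close>, then induction on \<open>|F|\<close> along the units of such an \<open>M\<close> shows that
  one of \<open>F \<union> {g}\<close> and \<open>F \<union> {g\<^sup>-\<^sup>1}\<close> is good. This gives orders, and compactness through the
  Alexander subbase theorem. If \<open>F\<close> isolates an order, then \<open>F \<union> {x\<^sup>-\<^sup>1}\<close> is not good for any
  positive \<open>x\<close>, and the same kind of induction shows that any two nontrivial elements have a common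
  nontrivial power. With unique roots this makes the group abelian of rank one. So no order is
  isolated, and the space of orders is a nonempty compact space without isolated points whose points
  are separated by countably many clopen sets. A finite generating set of a positive cone would
  isolate the order.
\<close>

text \<open>A left order need not be invariant under conjugation, so its cone gives no quotient to
  work with. The submonoid \<open>M\<close> repairs this: as it contains all commutators, its units
  form a normal subgroup with abelian quotient, and \<open>M\<close> induces a total order on that
  quotient. Moreover, a product in \<open>M\<close> is a unit only if every factor is one. Hence a
  product of elements of \<open>M\<close> that equals the identity involves only units, and a
  question about relations among generators can be restricted to the units among them. Since
  \<open>M\<close> is proper, not all generators are units, and this is why the inductions go down.

  Such an \<open>M\<close> is constructed only inside finitely generated subgroups: the descent
  along the lower central series controls the errors of all generating commutators by a single
  element, which works for finitely many of them. The group itself need not be finitely generated.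
  For the extension of good sets, Zorn's lemma and the finiteness of each relation lead back to it;
  for isolated orders, every element has a power in the subgroup generated by
  \<open>F\<close>.\<close>

subsection \<open>Nilpotent groups\<close>

context group
begin

abbreviation comm :: "'a \<Rightarrow> 'a \<Rightarrow> 'a" where
  "comm x y \<equiv> x \<otimes> y \<otimes> inv x \<otimes> inv y"

lemma inv_mult_cancel:
  assumes "x \<in> carrier G" "y \<in> carrier G"
  shows "inv x \<otimes> (x \<otimes> y) = y" "x \<otimes> (inv x \<otimes> y) = y"
  using assms by (simp_all flip: m_assoc)

lemmas group_word_simps = m_assoc inv_mult_group inv_mult_cancel

section \<open>The lower central series and its behaviour in subgroups\<close>

lemma lower_central_normal: "lower_central G n \<lhd> G"
proof (induction n)
  case 0
  show ?case
    by (simp add: normal_inv_iff subgroup_self)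
next
  case (Suc n)
  then interpret N: normal "lower_central G n" G .
  show ?case unfolding lower_central.simps
  proof (rule normal_generateI)
    show "{comm x y |x y. x \<in> lower_central G n \<and> y \<in> carrier G} \<subseteq> carrier G"
      using N.subset by auto
    fix h g assume "h \<in> {comm x y |x y. x \<in> lower_central G n \<and> y \<in> carrier G}" and g: "g \<in> carrier G"
    then obtain x y where xy: "h = comm x y" "x \<in> lower_central G n" "y \<in> carrier G" by auto
    have x: "x \<in> carrier G" using xy N.subset by auto
    have "g \<otimes> h \<otimes> inv g = comm (g \<otimes> x \<otimes> inv g) (g \<otimes> y \<otimes> inv g)"
      unfolding xy(1) using x xy(3) g by (simp add: group_word_simps)
    moreover have "g \<otimes> x \<otimes> inv g \<in> lower_central G n"
      using N.inv_op_closed2[OF g xy(2)] .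
    moreover have "g \<otimes> y \<otimes> inv g \<in> carrier G" using g xy by auto
    ultimately show "g \<otimes> h \<otimes> inv g \<in> {comm x y |x y. x \<in> lower_central G n \<and> y \<in> carrier G}"
      by blast
  qed
qed

lemma lower_central_subgroup: "subgroup (lower_central G n) G"
  using lower_central_normal normal_imp_subgroup by blast

lemma lower_central_carrier: "x \<in> lower_central G n \<Longrightarrow> x \<in> carrier G"
  using lower_central_subgroup subgroup.subset by blast

lemma comm_in_lower_central:
  assumes "x \<in> lower_central G n" "y \<in> carrier G"
  shows "comm x y \<in> lower_central G (Suc n)"
  using assms by (auto intro!: generate.incl)

lemma comm_swap:
  assumes "x \<in> carrier G" "y \<in> carrier G"
  shows "comm y x = inv (comm x y)"
  using assms by (simp add: group_word_simps)

lemma comm_in_lower_central':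
  assumes "x \<in> lower_central G n" "y \<in> carrier G"
  shows "comm y x \<in> lower_central G (Suc n)"
  using comm_swap[of x y] comm_in_lower_central[OF assms] lower_central_carrier[OF assms(1)] assms(2)
    lower_central_subgroup[of "Suc n"] subgroup.m_inv_closed by fastforce

lemma lower_central_Suc_subset: "lower_central G (Suc n) \<subseteq> lower_central G n"
  unfolding lower_central.simps
proof (rule generate_subgroup_incl[OF _ lower_central_subgroup], safe)
  fix x y assume x: "x \<in> lower_central G n" and y: "y \<in> carrier G"
  interpret N: normal "lower_central G n" G by (rule lower_central_normal)
  have "y \<otimes> inv x \<otimes> inv y \<in> lower_central G n"
    using N.inv_op_closed2[OF y] x N.m_inv_closed by auto
  then have "x \<otimes> (y \<otimes> inv x \<otimes> inv y) \<in> lower_central G n" using x by auto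
  then show "comm x y \<in> lower_central G n"
    using x y N.subset by (auto simp: m_assoc)
qed

lemma lower_central_antimono: "m \<le> n \<Longrightarrow> lower_central G n \<subseteq> lower_central G m"
  by (rule lift_Suc_antimono_le) (use lower_central_Suc_subset in auto)

lemma lower_central_of_subgroup:
  assumes "subgroup H G"
  shows "lower_central (G\<lparr>carrier := H\<rparr>) n \<subseteq> lower_central G n"
proof (induction n)
  case 0
  then show ?case using assms subgroup.subset by auto
next
  case (Suc n)
  interpret H: group "G\<lparr>carrier := H\<rparr>" using assms subgroup_imp_group by blast
  have sub: "{x \<otimes>\<^bsub>G\<lparr>carrier := H\<rparr>\<^esub> y \<otimes>\<^bsub>G\<lparr>carrier := H\<rparr>\<^esub> inv\<^bsub>G\<lparr>carrier := H\<rparr>\<^esub> x \<otimes>\<^bsub>G\<lparr>carrier := H\<rparr>\<^esub> inv\<^bsub>G\<lparr>carrier := H\<rparr>\<^esub> y | x y.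
       x \<in> lower_central (G\<lparr>carrier := H\<rparr>) n \<and> y \<in> carrier (G\<lparr>carrier := H\<rparr>)} =
       {comm x y | x y. x \<in> lower_central (G\<lparr>carrier := H\<rparr>) n \<and> y \<in> H}" (is "?A = ?B")
  proof -
    have "x \<otimes>\<^bsub>G\<lparr>carrier := H\<rparr>\<^esub> y \<otimes>\<^bsub>G\<lparr>carrier := H\<rparr>\<^esub> inv\<^bsub>G\<lparr>carrier := H\<rparr>\<^esub> x \<otimes>\<^bsub>G\<lparr>carrier := H\<rparr>\<^esub> inv\<^bsub>G\<lparr>carrier := H\<rparr>\<^esub> y = comm x y"
      if "x \<in> lower_central (G\<lparr>carrier := H\<rparr>) n" "y \<in> H" for x y
      using H.lower_central_carrier[OF that(1)] that(2) m_inv_consistent[OF assms] by simp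
    then show ?thesis by (intro Collect_cong iff_exI) auto
  qed
  have "?B \<subseteq> H"
  proof safe
    fix x y assume x: "x \<in> lower_central (G\<lparr>carrier := H\<rparr>) n" and y: "y \<in> H"
    have "x \<in> H" using H.lower_central_carrier[OF x] by simp
    then show "comm x y \<in> H" using y assms by (simp add: subgroup.m_closed subgroup.m_inv_closed)
  qed
  then have "generate (G\<lparr>carrier := H\<rparr>) ?A = generate G ?B"
    unfolding sub by (rule generate_consistent[OF _ assms])
  moreover have "generate G ?B \<subseteq> lower_central G (Suc n)"
    unfolding lower_central.simps
    using Suc subgroup.subset[OF assms] by (intro mono_generate) auto
  ultimately show ?case by simp
qed

lemma nilpotent_subgroup:
  assumes "nilpotent G" "subgroup H G"
  shows "nilpotent (G\<lparr>carrier := H\<rparr>)"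
proof -
  obtain n where n: "lower_central G n = {\<one>}" using assms(1) unfolding nilpotent_def by auto
  interpret H: group "G\<lparr>carrier := H\<rparr>" using assms subgroup_imp_group by blast
  have "lower_central (G\<lparr>carrier := H\<rparr>) n \<subseteq> {\<one>}" using lower_central_of_subgroup[OF assms(2), of n] n by simp
  moreover have "\<one> \<in> lower_central (G\<lparr>carrier := H\<rparr>) n"
    using H.lower_central_subgroup[of n] subgroup.one_closed by fastforce
  ultimately show ?thesis unfolding nilpotent_def by auto
qed

section \<open>Commutation and roots in torsion-free nilpotent groups\<close>

text \<open>The iterated commutators of \<open>x\<close> with \<open>y\<close> commute with \<open>x\<^sup>m\<close>, so the last nontrivial one would
  be torsion.\<close>

lemma commute_if_power_commute:
  assumes tf: "torsion_free G" and np: "nilpotent G"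
    and x: "x \<in> carrier G" and y: "y \<in> carrier G" and m: "0 < (m::nat)"
    and com: "x [^] m \<otimes> y = y \<otimes> x [^] m"
  shows "x \<otimes> y = y \<otimes> x"
proof -
  define Y where "Y = rec_nat y (\<lambda>_ u. comm x u)"
  have Y0: "Y 0 = y" and YS: "Y (Suc k) = comm x (Y k)" for k by (simp_all add: Y_def)
  have Yin: "Y k \<in> lower_central G k" for k
    by (induction k) (use y x comm_in_lower_central' in \<open>auto simp: Y0 YS\<close>)
  have Yc: "Y k \<in> carrier G" for k using Yin lower_central_carrier by blast
  have Ycom: "x [^] m \<otimes> Y k = Y k \<otimes> x [^] m" for k
  proof (induction k)
    case (Suc k)
    have 1: "x [^] m \<otimes> x = x \<otimes> x [^] m" using x nat_pow_comm[of x m 1] by simp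
    have 2: "x [^] m \<otimes> inv z = inv z \<otimes> x [^] m" if "x [^] m \<otimes> z = z \<otimes> x [^] m" "z \<in> carrier G" for z
    proof -
      have "x [^] m \<otimes> inv z = inv z \<otimes> (z \<otimes> x [^] m) \<otimes> inv z" using that(2) x by (simp add: group_word_simps)
      also have "\<dots> = inv z \<otimes> (x [^] m \<otimes> z) \<otimes> inv z" using that(1) by simp
      also have "\<dots> = inv z \<otimes> x [^] m" using that(2) x by (simp add: group_word_simps)
      finally show ?thesis .
    qed
    have 3: "x [^] m \<otimes> (a \<otimes> b) = (a \<otimes> b) \<otimes> x [^] m"
      if "x [^] m \<otimes> a = a \<otimes> x [^] m" "x [^] m \<otimes> b = b \<otimes> x [^] m" "a \<in> carrier G" "b \<in> carrier G" for a b
    proof -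
      have "x [^] m \<otimes> (a \<otimes> b) = (x [^] m \<otimes> a) \<otimes> b" using that(3,4) x by (simp add: m_assoc)
      also have "\<dots> = a \<otimes> (x [^] m \<otimes> b)" unfolding that(1) using that(3,4) x by (simp add: m_assoc)
      also have "\<dots> = (a \<otimes> b) \<otimes> x [^] m" unfolding that(2) using that(3,4) x by (simp add: m_assoc)
      finally show ?thesis .
    qed
    show ?case unfolding YS
      by (intro 3 2 1 Suc m_closed inv_closed x Yc)
  qed (simp add: Y0 com)
  have step: "Y (Suc k) = \<one>" if "Y (Suc (Suc k)) = \<one>" for k
  proof -
    let ?c = "Y (Suc k)" and ?y = "Y k"
    have "x \<otimes> ?c = ?c \<otimes> x"
    proof -
      have "comm x ?c \<otimes> ?c \<otimes> x = ?c \<otimes> x" using that x Yc by (simp add: YS[of "Suc k"])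
      moreover have "comm x ?c \<otimes> ?c \<otimes> x = x \<otimes> ?c" using x Yc by (simp add: group_word_simps)
      ultimately show ?thesis by simp
    qed
    note xc = this
    have xy: "x \<otimes> ?y = ?c \<otimes> ?y \<otimes> x" unfolding YS using x Yc by (simp add: group_word_simps)
    \<comment> \<open>Since \<open>?c\<close> commutes with \<open>x\<close>, each \<open>x\<close>
      that passes \<open>?y\<close> leaves one \<open>?c\<close> behind. At \<open>j = m\<close> the
      power passes freely, so \<open>?c [^] m\<close> is trivial.\<close>
    have "x [^] (j::nat) \<otimes> ?y = ?c [^] j \<otimes> ?y \<otimes> x [^] j" for j
    proof (induction j)
      case (Suc j)
      have "x [^] Suc j \<otimes> ?y = x [^] j \<otimes> (x \<otimes> ?y)" using x Yc by (simp add: m_assoc)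
      also have "\<dots> = (x [^] j \<otimes> ?c) \<otimes> (?y \<otimes> x)" unfolding xy using x Yc by (simp add: m_assoc)
      also have "x [^] j \<otimes> ?c = ?c \<otimes> x [^] j" using group_commutes_pow[OF xc x Yc] .
      also have "?c \<otimes> x [^] j \<otimes> (?y \<otimes> x) = ?c \<otimes> (x [^] j \<otimes> ?y) \<otimes> x" using x Yc by (simp add: m_assoc)
      also have "\<dots> = ?c \<otimes> (?c [^] j) \<otimes> ?y \<otimes> (x [^] j \<otimes> x)" unfolding Suc using x Yc by (simp add: m_assoc)
      also have "?c \<otimes> ?c [^] j = ?c [^] Suc j" using nat_pow_Suc2[OF Yc] by simp
      finally show ?case using x by simp
    qed (simp add: x Yc)
    from this[of m] Ycom[of k] have "?y \<otimes> x [^] m = ?c [^] m \<otimes> (?y \<otimes> x [^] m)" using x Yc by (simp add: m_assoc)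
    then have "?c [^] m = \<one>" using x Yc by (simp del: nat_pow_Suc)
    then show ?thesis using tf m Yc unfolding torsion_free_def by blast
  qed
  obtain n where "lower_central G n = {\<one>}" using np unfolding nilpotent_def by auto
  then have "Y (Suc n) = \<one>" using Yin[of n] by (simp add: YS x)
  then have "Y 1 = \<one>" by (induction n) (use step in auto)
  then have "comm x y \<otimes> y \<otimes> x = y \<otimes> x" using x y by (simp add: YS Y0)
  moreover have "comm x y \<otimes> y \<otimes> x = x \<otimes> y" using x y by (simp add: group_word_simps)
  ultimately show ?thesis by simp
qed


section \<open>Submonoids containing a power of every element\<close>

lemma submonoid_pow: "submonoid S G \<Longrightarrow> s \<in> S \<Longrightarrow> s [^] (n::nat) \<in> S"
  by (induction n) (auto intro: submonoid.one_closed submonoid.m_closed)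

text \<open>A central commutator can be moved freely, so moving \<open>i\<close> copies of
  \<open>a\<close> past \<open>j\<close> copies of \<open>b\<close> leaves one copy of it for each
  pair. This quadratic growth beats the linear errors in
  \<open>powers_reach_submonoid_central\<close>.\<close>

lemma comm_pow:
  assumes a: "a \<in> carrier G" and b: "b \<in> carrier G"
    and cen: "\<And>x. x \<in> carrier G \<Longrightarrow> comm a b \<otimes> x = x \<otimes> comm a b"
  shows "comm (a [^] (i::nat)) (b [^] (j::nat)) = comm a b [^] (i * j)"
proof -
  define c where c_def: "c = comm a b"
  note cen = cen[folded c_def]
  have c: "c \<in> carrier G" using a b by (simp add: c_def)
  have cp: "c [^] (k::nat) \<otimes> x = x \<otimes> c [^] k" if "x \<in> carrier G" for k x
    using group_commutes_pow[OF cen[OF that] c that] .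
  have ab: "a \<otimes> b = c \<otimes> b \<otimes> a" using a b by (simp add: c_def group_word_simps)
  have 1: "a \<otimes> b [^] j = c [^] j \<otimes> b [^] j \<otimes> a" for j :: nat
  proof (induction j)
    case (Suc j)
    have "a \<otimes> b [^] Suc j = (a \<otimes> b [^] j) \<otimes> b" using a b by (simp add: m_assoc)
    also have "\<dots> = c [^] j \<otimes> b [^] j \<otimes> (a \<otimes> b)" unfolding Suc using a b c by (simp add: m_assoc)
    also have "\<dots> = c [^] j \<otimes> (b [^] j \<otimes> c) \<otimes> b \<otimes> a" unfolding ab using a b c by (simp add: m_assoc)
    also have "b [^] j \<otimes> c = c \<otimes> b [^] j" using cen[of "b [^] j"] b by simp
    also have "c [^] j \<otimes> (c \<otimes> b [^] j) \<otimes> b \<otimes> a = (c [^] j \<otimes> c) \<otimes> (b [^] j \<otimes> b) \<otimes> a"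
      using nat_pow_closed[OF c, of j] nat_pow_closed[OF b, of j] c a b m_closed m_assoc by presburger
    finally show ?case by simp
  qed (use a in simp)
  have 2: "a [^] i \<otimes> b [^] j = c [^] (i * j) \<otimes> b [^] j \<otimes> a [^] i" for i
  proof (induction i)
    case (Suc i)
    have "a [^] Suc i \<otimes> b [^] j = a [^] i \<otimes> (a \<otimes> b [^] j)" using a b by (simp add: m_assoc)
    also have "\<dots> = (a [^] i \<otimes> c [^] j) \<otimes> (b [^] j \<otimes> a)" unfolding 1
      using nat_pow_closed[OF c, of j] nat_pow_closed[OF b, of j] nat_pow_closed[OF a, of i] c a b m_closed m_assoc by presburger
    also have "a [^] i \<otimes> c [^] j = c [^] j \<otimes> a [^] i" using cp a by simp
    also have "c [^] j \<otimes> a [^] i \<otimes> (b [^] j \<otimes> a) = c [^] j \<otimes> (a [^] i \<otimes> b [^] j) \<otimes> a"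
      using nat_pow_closed[OF c, of j] nat_pow_closed[OF b, of j] nat_pow_closed[OF a, of i] c a b m_closed m_assoc by presburger
    also have "\<dots> = (c [^] j \<otimes> c [^] (i * j)) \<otimes> b [^] j \<otimes> (a [^] i \<otimes> a)" unfolding Suc
      using nat_pow_closed[OF c, of j] nat_pow_closed[OF c, of "i * j"] nat_pow_closed[OF b, of j] nat_pow_closed[OF a, of i] c a b m_closed m_assoc by presburger
    finally show ?case using nat_pow_mult[OF c, of j "i * j"] by simp
  qed (use b in simp)
  have "comm (a [^] i) (b [^] j) = c [^] (i * j) \<otimes> b [^] j \<otimes> a [^] i \<otimes> inv (a [^] i) \<otimes> inv (b [^] j)"
    unfolding 2 ..
  also have "\<dots> = c [^] (i * j)"
    using nat_pow_closed[OF c, of "i * j"] nat_pow_closed[OF b, of j] nat_pow_closed[OF a, of i] 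
    by (simp add: m_assoc inv_mult_cancel del: nat_pow_closed)
  finally show ?thesis unfolding c_def .
qed

text \<open>If powers modulo the central subgroup \<open>C\<close> reach \<open>S\<close>, then for large \<open>k\<close> the commutators of
  \<open>k\<close>-th powers contribute \<open>c\<^sup>N\<^sup>k\<^sup>k\<close> against an error of only \<open>w\<^sup>k\<close>, so up to an arbitrarily small
  error \<open>w\<close> both signs of every generating commutator lie in \<open>S\<close>. Since \<open>w\<close> is itself generated by
  the commutators, the error can be cancelled.\<close>

lemma powers_reach_submonoid_central:
  assumes C: "subgroup C G" and cen: "\<And>c x. c \<in> C \<Longrightarrow> x \<in> carrier G \<Longrightarrow> c \<otimes> x = x \<otimes> c"
    and Y: "finite Y" "C = generate G Y"
    and Ycomm: "\<And>c. c \<in> Y \<Longrightarrow> \<exists>a\<in>carrier G. \<exists>b\<in>carrier G. c = comm a b"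
    and S: "submonoid S G"
    and big: "\<And>h. h \<in> carrier G \<Longrightarrow> \<exists>n>0::nat. \<exists>s\<in>S. \<exists>c\<in>C. h [^] n = s \<otimes> c"
    and h: "h \<in> carrier G"
  shows "\<exists>n>0::nat. h [^] n \<in> S"
proof -
  interpret C: subgroup C G by fact
  interpret S: submonoid S G by fact
  have CG: "c \<in> carrier G" if "c \<in> C" for c using that by simp
  have SG: "c \<in> carrier G" if "c \<in> S" for c using that by simp
  have Cpow: "c [^] (n::nat) \<in> C" if "c \<in> C" for c n using that by (induction n) auto
  have Spow: "c [^] (n::nat) \<in> S" if "c \<in> S" for c n using that by (rule submonoid_pow[OF S])
  have lcomm: "c \<otimes> (x \<otimes> y) = x \<otimes> (c \<otimes> y)" if "c \<in> C" "x \<in> carrier G" "y \<in> carrier G" for c x y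
    using that cen[of c x] by (simp flip: m_assoc)
  have dist: "(x \<otimes> c) [^] (n::nat) = x [^] n \<otimes> c [^] n" if "c \<in> C" "x \<in> carrier G" for c x n
    using that cen[of c x] by (simp add: pow_mult_distrib)
  have pw: "(w [^] i \<otimes> c [^] j) [^] k = w [^] (i * k) \<otimes> c [^] (j * k)"
    if "w \<in> C" "c \<in> C" for w c and i j k :: nat
    using that by (simp add: dist Cpow nat_pow_pow)
  \<comment> \<open>In additive notation with rational coefficients: \<open>w + t c\<close> and
    \<open>w - t c\<close> lie in the cone spanned by \<open>S\<close> for every \<open>t\<close>,
    so both signs of \<open>c\<close> lie in it up to the error \<open>w / t\<close>. The exponent
    \<open>p\<close> clears denominators.\<close>
  define V where "V w = {c \<in> C. \<forall>t>0::nat. \<exists>p>0::nat. w [^] p \<otimes> c [^] (t * p) \<in> S \<and>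
    w [^] p \<otimes> inv c [^] (t * p) \<in> S}" for w
  have Vsub: "subgroup (V w) G" if w: "w \<in> S" "w \<in> C" for w
  proof
    show "V w \<subseteq> carrier G" unfolding V_def by auto
    show "\<one> \<in> V w" unfolding V_def using w by (auto intro!: exI[of _ "1::nat"])
    show "inv x \<in> V w" if "x \<in> V w" for x
      using that unfolding V_def by (auto simp: conj_commute)
    fix c d assume c: "c \<in> V w" and d: "d \<in> V w"
    have cC: "c \<in> C" and dC: "d \<in> C" using c d by (auto simp: V_def)
    have "\<exists>p>0::nat. w [^] p \<otimes> (c \<otimes> d) [^] (t * p) \<in> S \<and> w [^] p \<otimes> inv (c \<otimes> d) [^] (t * p) \<in> S"
      if t: "t > 0" for t :: nat
    proof -
      \<comment> \<open>Multiplying two approximations doubles the error \<open>w\<close>; asking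
        each factor for \<open>2 * t\<close> leaves \<open>t\<close> for the product.\<close>
      have "2 * t > 0" using t by simp
      then obtain p where p: "p > 0" "w [^] p \<otimes> c [^] (2 * t * p) \<in> S" "w [^] p \<otimes> inv c [^] (2 * t * p) \<in> S"
        using c unfolding V_def by blast
      obtain q where q: "q > 0" "w [^] q \<otimes> d [^] (2 * t * q) \<in> S" "w [^] q \<otimes> inv d [^] (2 * t * q) \<in> S"
        using \<open>2 * t > 0\<close> d unfolding V_def by blast
      have *: "w [^] (2 * p * q) \<otimes> (c' \<otimes> d') [^] (t * (2 * p * q)) \<in> S"
        if "c' \<in> C" "d' \<in> C" "w [^] p \<otimes> c' [^] (2 * t * p) \<in> S" "w [^] q \<otimes> d' [^] (2 * t * q) \<in> S" for c' d'
      proof -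
        have "(w [^] p \<otimes> c' [^] (2 * t * p)) [^] q \<otimes> (w [^] q \<otimes> d' [^] (2 * t * q)) [^] p \<in> S"
          using that Spow by simp
        also have "(w [^] p \<otimes> c' [^] (2 * t * p)) [^] q \<otimes> (w [^] q \<otimes> d' [^] (2 * t * q)) [^] p =
          w [^] (p * q) \<otimes> c' [^] (2 * t * p * q) \<otimes> (w [^] (q * p) \<otimes> d' [^] (2 * t * q * p))"
          using that w by (simp add: pw)
        also have "\<dots> = (w [^] (p * q) \<otimes> w [^] (q * p)) \<otimes> (c' [^] (2 * t * p * q) \<otimes> d' [^] (2 * t * q * p))"
          using that w by (simp add: m_assoc lcomm Cpow)
        also have "\<dots> = w [^] (2 * p * q) \<otimes> (c' \<otimes> d') [^] (t * (2 * p * q))"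
        proof -
          have e: "p * q + q * p = 2 * p * q" by simp
          have "2 * t * p * q = t * (2 * p * q)" "2 * t * q * p = t * (2 * p * q)"
            by (auto simp: algebra_simps)
          moreover have "w [^] (p * q) \<otimes> w [^] (q * p) = w [^] (2 * p * q)"
            unfolding e[symmetric] using nat_pow_mult[of w "p * q" "q * p"] w by simp
          ultimately show ?thesis using that w by (simp only: dist CG)
        qed
        finally show ?thesis .
      qed
      have "inv (c \<otimes> d) = inv c \<otimes> inv d" using cC dC cen[of "inv d" "inv c"] by (simp add: inv_mult_group)
      then show ?thesis using *[of c d] *[of "inv c" "inv d"] p q cC dC
        by (intro exI[of _ "2 * p * q"]) simp
    qed
    then show "c \<otimes> d \<in> V w" using cC dC unfolding V_def by auto
  qed
  have Vmono: "V w \<subseteq> V (w \<otimes> w')" if "w \<in> C" "w' \<in> S" "w' \<in> C" for w w'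
  proof
    fix c assume c: "c \<in> V w"
    then have cC: "c \<in> C" by (auto simp: V_def)
    have *: "(w \<otimes> w') [^] p \<otimes> c' [^] (q::nat) \<in> S" if "w [^] p \<otimes> c' [^] q \<in> S" "c' \<in> C" for p q :: nat and c'
    proof -
      have "(w \<otimes> w') [^] p \<otimes> c' [^] q = w' [^] p \<otimes> (w [^] p \<otimes> c' [^] q)"
        using \<open>w \<in> C\<close> \<open>w' \<in> C\<close> \<open>c' \<in> C\<close> by (simp add: dist Cpow m_assoc lcomm cen)
      then show ?thesis using that Spow[OF \<open>w' \<in> S\<close>, of p] by simp
    qed
    show "c \<in> V (w \<otimes> w')" using c *[of _ c] *[of _ "inv c"] cC unfolding V_def
      by simp blast
  qed
  have approx: "\<exists>n>0::nat. \<exists>z\<in>C. \<exists>z'\<in>C. a [^] n \<otimes> z \<in> S \<and> inv (a [^] n) \<otimes> z' \<in> S"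
    if a: "a \<in> carrier G" for a
  proof -
    obtain n s c where n: "n > 0" "s \<in> S" "c \<in> C" "a [^] (n::nat) = s \<otimes> c"
      using big[OF a] by blast
    obtain m r d where m: "m > 0" "r \<in> S" "d \<in> C" "inv a [^] (m::nat) = r \<otimes> d"
      using big[of "inv a"] a by blast
    have se: "s = a [^] n \<otimes> inv c" unfolding n(4) using n by (simp add: m_assoc)
    have "s [^] m = a [^] (n * m) \<otimes> inv c [^] m"
      by (subst se) (use n(3) a in \<open>simp add: dist nat_pow_pow\<close>)
    moreover have re: "r = inv a [^] m \<otimes> inv d" unfolding m(4) using m by (simp add: m_assoc)
    have "r [^] n = inv a [^] (m * n) \<otimes> inv d [^] n"
      by (subst re) (use m(3) a in \<open>simp add: dist nat_pow_pow\<close>)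
    then have "r [^] n = inv (a [^] (n * m)) \<otimes> inv d [^] n"
      using a by (simp add: nat_pow_inv mult.commute)
    ultimately show ?thesis
      using n m Spow[of s m] Spow[of r n] Cpow[of "inv c" m] Cpow[of "inv d" n]
      by (intro exI[of _ "n * m"]) auto
  qed
  have gens: "\<exists>w. w \<in> S \<and> w \<in> C \<and> c \<in> V w" if c: "c \<in> Y" for c
  proof -
    obtain a b where ab: "a \<in> carrier G" "b \<in> carrier G" "c = comm a b" using Ycomm[OF c] by blast
    have cC: "c \<in> C" unfolding Y(2) using c by (rule generate.incl)
    obtain n z1 z2 where n: "n > 0" "z1 \<in> C" "z2 \<in> C" "a [^] (n::nat) \<otimes> z1 \<in> S" "inv (a [^] n) \<otimes> z2 \<in> S"
      using approx[OF ab(1)] by blast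
    obtain m z3 z4 where m: "m > 0" "z3 \<in> C" "z4 \<in> C" "b [^] (m::nat) \<otimes> z3 \<in> S" "inv (b [^] m) \<otimes> z4 \<in> S"
      using approx[OF ab(2)] by blast
    define x y where "x = a [^] n" and "y = b [^] m"
    have xy: "x \<in> carrier G" "y \<in> carrier G" unfolding x_def y_def using ab by auto
    define w where "w = z1 \<otimes> z2 \<otimes> z3 \<otimes> z4"
    define N where "N = n * m"
    have N: "N > 0" using n m by (simp add: N_def)
    have wC: "w \<in> C" unfolding w_def using n m by simp
    \<comment> \<open>In this order the four factors cancel up to the total error \<open>w\<close>,
      which puts \<open>w\<close> itself into \<open>S\<close>. Below, \<open>k\<close>-th powers of
      the same factors in the order of a commutator leave that commutator with the error
      \<open>w [^] k\<close>.\<close>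
    have "(x \<otimes> z1) \<otimes> (inv x \<otimes> z2) \<otimes> (y \<otimes> z3) \<otimes> (inv y \<otimes> z4) \<in> S"
      using n m unfolding x_def y_def by simp
    also have "(x \<otimes> z1) \<otimes> (inv x \<otimes> z2) \<otimes> (y \<otimes> z3) \<otimes> (inv y \<otimes> z4) = w"
      unfolding w_def using n(2,3) m(2,3) xy
      by (simp add: m_assoc lcomm lcomm[of _ "inv x"] lcomm[of _ y] lcomm[of _ "inv y"] inv_mult_cancel)
    finally have wS: "w \<in> S" .
    have cpow: "comm (x [^] (k::nat)) (y [^] k) = c [^] (N * k * k)" for k
      unfolding x_def y_def nat_pow_pow[OF ab(1)] nat_pow_pow[OF ab(2)] N_def
      using comm_pow[OF ab(1,2), of "n * k" "m * k"] cen[OF cC] by (simp add: ab(3) ac_simps)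
    have inS: "w [^] k \<otimes> c [^] (N * k * k) \<in> S \<and> w [^] k \<otimes> inv c [^] (N * k * k) \<in> S" for k :: nat
    proof
      note mv = lcomm[of _ "x [^] k"] cen[of _ "x [^] k"] lcomm[of _ "inv (x [^] k)"] cen[of _ "inv (x [^] k)"]
        lcomm[of _ "y [^] k"] cen[of _ "y [^] k"] lcomm[of _ "inv (y [^] k)"] cen[of _ "inv (y [^] k)"]
      have "(x \<otimes> z1) [^] k \<otimes> (y \<otimes> z3) [^] k \<otimes> (inv x \<otimes> z2) [^] k \<otimes> (inv y \<otimes> z4) [^] k \<in> S"
        using n m Spow unfolding x_def y_def by simp
      also have "(x \<otimes> z1) [^] k \<otimes> (y \<otimes> z3) [^] k \<otimes> (inv x \<otimes> z2) [^] k \<otimes> (inv y \<otimes> z4) [^] k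
        = w [^] k \<otimes> comm (x [^] k) (y [^] k)"
        unfolding w_def using n(2,3) m(2,3) xy
          by (simp add: dist Cpow m_assoc lcomm cen nat_pow_inv mv)
      finally show "w [^] k \<otimes> c [^] (N * k * k) \<in> S" unfolding cpow .
      have "(y \<otimes> z3) [^] k \<otimes> (x \<otimes> z1) [^] k \<otimes> (inv y \<otimes> z4) [^] k \<otimes> (inv x \<otimes> z2) [^] k \<in> S"
        using n m Spow unfolding x_def y_def by simp
      also have "(y \<otimes> z3) [^] k \<otimes> (x \<otimes> z1) [^] k \<otimes> (inv y \<otimes> z4) [^] k \<otimes> (inv x \<otimes> z2) [^] k
        = w [^] k \<otimes> comm (y [^] k) (x [^] k)"
        unfolding w_def using n(2,3) m(2,3) xy
          by (simp add: dist Cpow m_assoc lcomm cen nat_pow_inv mv)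
      also have "comm (y [^] k) (x [^] k) = inv c [^] (N * k * k)"
        unfolding nat_pow_inv[OF CG[OF cC]] cpow[symmetric] using comm_swap[of "x [^] k" "y [^] k"] xy by simp
      finally show "w [^] k \<otimes> inv c [^] (N * k * k) \<in> S" .
    qed
    \<comment> \<open>At \<open>k = t\<close> the commutator contributes the exponent
      \<open>N * t * t\<close>, which fits \<open>p = N * t\<close>. The missing factor
      \<open>w [^] (N * t - t)\<close> lies in \<open>S\<close> because \<open>w\<close>
      does.\<close>
    have "\<exists>p>0::nat. w [^] p \<otimes> c [^] (t * p) \<in> S \<and> w [^] p \<otimes> inv c [^] (t * p) \<in> S" if "t > 0" for t :: nat
    proof (intro exI conjI)
      show "N * t > 0" using N that by simp
      have e: "w [^] (N * t) \<otimes> d [^] (t * (N * t)) = w [^] (N * t - t) \<otimes> (w [^] t \<otimes> d [^] (N * t * t))"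
        if "d \<in> C" for d
        using wC that N by (simp add: nat_pow_mult ac_simps flip: m_assoc)
      show "w [^] (N * t) \<otimes> c [^] (t * (N * t)) \<in> S" 
        using e[of c] inS[of t] Spow[OF wS, of "N * t - t"] cC by simp
      show "w [^] (N * t) \<otimes> inv c [^] (t * (N * t)) \<in> S" 
        using e[of "inv c"] inS[of t] Spow[OF wS, of "N * t - t"] cC by simp
    qed
    then have "c \<in> V w" unfolding V_def using cC by simp
    then show ?thesis using wS wC by blast
  qed
  have "\<exists>w. w \<in> S \<and> w \<in> C \<and> Z \<subseteq> V w" if "finite Z" "Z \<subseteq> Y" for Z
    using that
  proof (induction Z rule: finite_induct)
    case empty
    then show ?case by (intro exI[of _ \<one>]) auto
  next
    case (insert c Z)
    then obtain w where w: "w \<in> S" "w \<in> C" "Z \<subseteq> V w" by auto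
    obtain w' where w': "w' \<in> S" "w' \<in> C" "c \<in> V w'" using gens insert by blast
    have "V w \<subseteq> V (w \<otimes> w')" "V w' \<subseteq> V (w' \<otimes> w)" using Vmono w w' by auto
    moreover have "w' \<otimes> w = w \<otimes> w'" using cen w w' by auto
    ultimately show ?case using w w' by (intro exI[of _ "w \<otimes> w'"]) auto
  qed
  then obtain w where w: "w \<in> S" "w \<in> C" "Y \<subseteq> V w" using Y by blast
  then have CV: "C \<subseteq> V w" using generate_subgroup_incl[OF w(3) Vsub] Y(2) by simp
  \<comment> \<open>The estimate applies to \<open>w\<close> itself, as \<open>w\<close> lies in
    \<open>C\<close>. At \<open>t = 2\<close> the error \<open>w [^] p\<close> is outweighed by
    \<open>inv w [^] (2 * p)\<close>, so a power of \<open>inv w\<close> lies in \<open>S\<close>;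
    it cancels the errors below.\<close>
  obtain p where p: "p > (0::nat)" "w [^] p \<otimes> inv w [^] (2 * p) \<in> S"
    using CV w(2) unfolding V_def by (auto dest!: subsetD[of _ _ w] spec[of _ "2::nat"])
  have "w [^] p \<otimes> inv w [^] (2 * p) = inv w [^] p"
    using w(2) by (simp add: mult_2 inv_mult_cancel nat_pow_inv flip: nat_pow_mult)
  with p have ip: "inv w [^] p \<in> S" by simp
  have Cbig: "\<exists>q>0::nat. c [^] q \<in> S" if c: "c \<in> C" for c
  proof -
    obtain q where q: "q > (0::nat)" "w [^] q \<otimes> c [^] q \<in> S"
      using CV c unfolding V_def by (auto dest!: subsetD[of _ _ c] spec[of _ "1::nat"])
    have "(inv w [^] p) [^] q \<otimes> (w [^] q \<otimes> c [^] q) [^] p \<in> S" using q ip Spow by simp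
    also have "(inv w [^] p) [^] q \<otimes> (w [^] q \<otimes> c [^] q) [^] p = c [^] (q * p)"
      using w(2) c by (simp add: pw nat_pow_pow mult.commute[of p q] nat_pow_inv inv_mult_cancel)
    finally show ?thesis using p q by (intro exI[of _ "q * p"]) simp
  qed
  obtain n s c where n: "n > 0" "s \<in> S" "c \<in> C" "h [^] (n::nat) = s \<otimes> c"
    using big[OF h] by blast
  obtain q where q: "q > 0" "c [^] (q::nat) \<in> S" using Cbig[OF n(3)] by blast
  have "h [^] (n * q) = s [^] q \<otimes> c [^] q"
    unfolding nat_pow_pow[OF h, symmetric] n(4) using n by (simp add: dist)
  then show ?thesis using n q Spow[of s q] by (intro exI[of _ "n * q"]) simp
qed


section \<open>Finite generation of the lower central factors\<close>

text \<open>Modulo the next term, commutators are multiplicative in each argument, so generators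
  suffice. In the proof, \<open>T\<close> contains \<open>lower_central G (Suc (Suc k))\<close> and
  is therefore closed under conjugation; this makes \<open>comm a b \<in> T\<close> a subgroup
  condition first on \<open>b\<close> and then on \<open>a\<close>.\<close>

lemma lower_central_Suc_generators:
  assumes X: "generate G X = carrier G" "X \<subseteq> carrier G"
    and Y: "Y \<subseteq> lower_central G k" "lower_central G k \<subseteq> generate G (Y \<union> lower_central G (Suc k))"
  shows "lower_central G (Suc k) \<subseteq> generate G ((\<lambda>(a, x). comm a x) ` (Y \<times> X) \<union> lower_central G (Suc (Suc k)))"
    (is "_ \<subseteq> generate G ?Z")
proof -
  note lower_central.simps(2) [simp del]
  define T where "T = generate G ?Z"
  have YG: "Y \<subseteq> carrier G" using Y(1) lower_central_carrier by blast
  have Zsub: "?Z \<subseteq> lower_central G (Suc k)"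
    using lower_central_Suc_subset[of "Suc k"]
    by (auto intro!: comm_in_lower_central subsetD[OF Y(1)] subsetD[OF X(2)])
  then have ZG: "?Z \<subseteq> carrier G" using lower_central_carrier by blast
  have Tsub: "subgroup T G" unfolding T_def by (rule generate_is_subgroup[OF ZG])
  interpret T: subgroup T G by fact
  have Tk: "T \<subseteq> lower_central G (Suc k)"
    unfolding T_def by (rule generate_subgroup_incl[OF Zsub lower_central_subgroup])
  have LT: "lower_central G (Suc (Suc k)) \<subseteq> T" unfolding T_def by (auto intro: generate.incl)
  have conj: "g \<otimes> u \<otimes> inv g \<in> T" if "u \<in> T" "g \<in> carrier G" for u g
  proof -
    have "comm g u \<in> T" using comm_in_lower_central'[of u "Suc k" g] that Tk LT by auto
    then have "comm g u \<otimes> u \<in> T" using that by simp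
    then show ?thesis using that by (simp add: group_word_simps)
  qed
  have 1: "comm a b \<in> T" if a: "a \<in> Y" and b: "b \<in> carrier G" for a b
  proof -
    have aG: "a \<in> carrier G" using a YG by auto
    have "subgroup {b \<in> carrier G. comm a b \<in> T} G"
    proof
      show "\<one> \<in> {b \<in> carrier G. comm a b \<in> T}" using aG by simp
    next
      fix x assume x: "x \<in> {b \<in> carrier G. comm a b \<in> T}"
      then have "inv x \<otimes> inv (comm a x) \<otimes> inv (inv x) \<in> T" by (intro conj T.m_inv_closed) auto
      moreover have "comm a (inv x) = inv x \<otimes> inv (comm a x) \<otimes> inv (inv x)"
        using x aG by (simp add: group_word_simps)
      ultimately show "inv x \<in> {b \<in> carrier G. comm a b \<in> T}" using x by simp
    next
      fix x y assume x: "x \<in> {b \<in> carrier G. comm a b \<in> T}" and y: "y \<in> {b \<in> carrier G. comm a b \<in> T}"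
      have "comm a x \<otimes> (x \<otimes> comm a y \<otimes> inv x) \<in> T" by (rule T.m_closed[OF _ conj]) (use x y in auto)
      moreover have "comm a (x \<otimes> y) = comm a x \<otimes> (x \<otimes> comm a y \<otimes> inv x)"
        using x y aG by (simp add: group_word_simps)
      ultimately show "x \<otimes> y \<in> {b \<in> carrier G. comm a b \<in> T}" using x y by simp
    qed auto
    moreover have "X \<subseteq> {b \<in> carrier G. comm a b \<in> T}"
      using X(2) a unfolding T_def by (auto intro!: generate.incl)
    ultimately have "generate G X \<subseteq> {b \<in> carrier G. comm a b \<in> T}"
      by (rule generate_subgroup_incl[rotated])
    then show ?thesis using b X(1) by auto
  qed
  have 2: "comm a b \<in> T" if a: "a \<in> lower_central G k" and b: "b \<in> carrier G" for a b
  proof -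
    have "subgroup {a \<in> carrier G. comm a b \<in> T} G"
    proof
      show "\<one> \<in> {a \<in> carrier G. comm a b \<in> T}" using b by simp
    next
      fix x assume x: "x \<in> {a \<in> carrier G. comm a b \<in> T}"
      then have "inv x \<otimes> inv (comm x b) \<otimes> inv (inv x) \<in> T" by (intro conj T.m_inv_closed) auto
      moreover have "comm (inv x) b = inv x \<otimes> inv (comm x b) \<otimes> inv (inv x)"
        using x b by (simp add: group_word_simps)
      ultimately show "inv x \<in> {a \<in> carrier G. comm a b \<in> T}" using x by simp
    next
      fix x y assume x: "x \<in> {a \<in> carrier G. comm a b \<in> T}" and y: "y \<in> {a \<in> carrier G. comm a b \<in> T}"
      have "(x \<otimes> comm y b \<otimes> inv x) \<otimes> comm x b \<in> T" by (rule T.m_closed[OF conj]) (use x y in auto)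
      moreover have "comm (x \<otimes> y) b = (x \<otimes> comm y b \<otimes> inv x) \<otimes> comm x b"
        using x y b by (simp add: group_word_simps)
      ultimately show "x \<otimes> y \<in> {a \<in> carrier G. comm a b \<in> T}" using x y by simp
    qed auto
    moreover have "Y \<union> lower_central G (Suc k) \<subseteq> {a \<in> carrier G. comm a b \<in> T}"
      using 1 b YG LT comm_in_lower_central lower_central_carrier by blast
    ultimately have "generate G (Y \<union> lower_central G (Suc k)) \<subseteq> {a \<in> carrier G. comm a b \<in> T}"
      by (rule generate_subgroup_incl[rotated])
    then show ?thesis using a Y(2) by auto
  qed
  have "generate G {comm x y |x y. x \<in> lower_central G k \<and> y \<in> carrier G} \<subseteq> T"
    by (rule generate_subgroup_incl[OF _ Tsub]) (use 2 in blast)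
  then show ?thesis unfolding T_def lower_central.simps(2)[of G k] .
qed

text \<open>The generators are kept as single commutators, the form that
  \<open>powers_reach_submonoid_central\<close> asks for.\<close>

lemma lower_central_finitely_generated:
  assumes X: "generate G X = carrier G" "X \<subseteq> carrier G" "finite X"
  shows "\<exists>Y. finite Y \<and> Y \<subseteq> {comm x y |x y. x \<in> lower_central G k \<and> y \<in> carrier G} \<and>
    lower_central G (Suc k) \<subseteq> generate G (Y \<union> lower_central G (Suc (Suc k)))"
proof (induction k)
  case 0
  have "lower_central G 0 \<subseteq> generate G (X \<union> lower_central G (Suc 0))"
    using mono_generate[of X "X \<union> lower_central G (Suc 0)"] X(1) by (simp del: lower_central.simps(2))
  from lower_central_Suc_generators[OF X(1,2) _ this]
  have "lower_central G (Suc 0) \<subseteq>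
      generate G ((\<lambda>(a, x). comm a x) ` (X \<times> X) \<union> lower_central G (Suc (Suc 0)))"
    using X by (simp del: lower_central.simps(2))
  moreover have "(\<lambda>(a, x). comm a x) ` (X \<times> X) \<subseteq> {comm x y |x y. x \<in> lower_central G 0 \<and> y \<in> carrier G}"
    using X(2) by fastforce
  ultimately show ?case using X(3)
    by (intro exI[of _ "(\<lambda>(a, x). comm a x) ` (X \<times> X)"]) (simp del: lower_central.simps(2))
next
  case (Suc k)
  then obtain Y where Y: "finite Y" "Y \<subseteq> {comm x y |x y. x \<in> lower_central G k \<and> y \<in> carrier G}"
    "lower_central G (Suc k) \<subseteq> generate G (Y \<union> lower_central G (Suc (Suc k)))" by blast
  have Y2: "Y \<subseteq> lower_central G (Suc k)" using Y(2) comm_in_lower_central by blast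
  have "(\<lambda>(a, x). comm a x) ` (Y \<times> X) \<subseteq> {comm x y |x y. x \<in> lower_central G (Suc k) \<and> y \<in> carrier G}"
    using Y2 X(2) by fastforce
  then show ?case using lower_central_Suc_generators[OF X(1,2) Y2 Y(3)] Y(1) X(3)
    by (intro exI[of _ "(\<lambda>(a, x). comm a x) ` (Y \<times> X)"]) simp
qed

section \<open>Descent to the abelianization and total submonoids\<close>

text \<open>Modulo \<open>lower_central G (Suc (Suc k))\<close> the preceding term becomes central
  and is generated by finitely many commutators, so the central case applies in the quotient.
  Pulling back costs an error in the kernel.\<close>

lemma powers_reach_submonoid_lower_central_step:
  assumes X: "generate G X = carrier G" "X \<subseteq> carrier G" "finite X"
    and S: "submonoid S G"
    and big: "\<And>h. h \<in> carrier G \<Longrightarrow> \<exists>n>0::nat. \<exists>s\<in>S. \<exists>c\<in>lower_central G (Suc k). h [^] n = s \<otimes> c"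
    and h: "h \<in> carrier G"
  shows "\<exists>n>0::nat. \<exists>s\<in>S. \<exists>c\<in>lower_central G (Suc (Suc k)). h [^] n = s \<otimes> c"
proof -
  note lower_central.simps(2) [simp del]
  define N where "N = lower_central G (Suc (Suc k))"
  interpret N: normal N G unfolding N_def by (rule lower_central_normal)
  interpret S: submonoid S G by fact
  define Q where "Q = G Mod N"
  define \<pi> where "\<pi> x = N #> x" for x
  interpret Q: group Q unfolding Q_def by (rule N.factorgroup_is_group)
  have hom: "\<pi> \<in> hom G Q" unfolding \<pi>_def[abs_def] Q_def by (rule N.r_coset_hom_Mod)
  interpret \<pi>: group_hom G Q \<pi> by unfold_locales (rule hom)
  have surj: "\<exists>x\<in>carrier G. q = \<pi> x" if "q \<in> carrier Q" for q
    using that unfolding Q_def \<pi>_def FactGroup_def RCOSETS_def by auto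
  have ker: "\<pi> x = \<one>\<^bsub>Q\<^esub> \<longleftrightarrow> x \<in> N" if "x \<in> carrier G" for x
    unfolding \<pi>_def Q_def using that coset_join1[of N x] coset_join2[of x N] N.subset N.subgroup_axioms
    by auto
  obtain Y where Y: "finite Y" "Y \<subseteq> {comm x y |x y. x \<in> lower_central G k \<and> y \<in> carrier G}"
    "lower_central G (Suc k) \<subseteq> generate G (Y \<union> N)"
    using lower_central_finitely_generated[OF X, of k] unfolding N_def by blast
  have YC: "Y \<union> N \<subseteq> lower_central G (Suc k)"
    using Y(2) comm_in_lower_central lower_central_Suc_subset unfolding N_def by blast
  then have YG: "Y \<union> N \<subseteq> carrier G" using lower_central_carrier by blast
  have gamma: "lower_central G (Suc k) = generate G (Y \<union> N)"
    using Y(3) generate_subgroup_incl[OF YC lower_central_subgroup] by auto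
  define C where "C = \<pi> ` lower_central G (Suc k)"
  \<comment> \<open>\<open>N\<close> contributes only the identity to the image of
    \<open>Y \<union> N\<close>. So the image stays finite, and it still consists of
    commutators.\<close>
  have \<pi>N: "\<pi> ` N = {\<one>\<^bsub>Q\<^esub>}" 
  proof
    show "\<pi> ` N \<subseteq> {\<one>\<^bsub>Q\<^esub>}" using ker N.subset by auto
    show "{\<one>\<^bsub>Q\<^esub>} \<subseteq> \<pi> ` N" using imageI[OF N.one_closed, of \<pi>] unfolding \<pi>.hom_one by simp
  qed
  have "\<exists>n>0::nat. \<pi> h [^]\<^bsub>Q\<^esub> n \<in> \<pi> ` S"
  proof (rule Q.powers_reach_submonoid_central[of C "\<pi> ` (Y \<union> N)"])
    show "subgroup C Q" unfolding C_def by (rule \<pi>.subgroup_img_is_subgroup[OF lower_central_subgroup])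
    show "c \<otimes>\<^bsub>Q\<^esub> x = x \<otimes>\<^bsub>Q\<^esub> c" if cC: "c \<in> C" and xQ: "x \<in> carrier Q" for c x
    proof -
      obtain d where d: "d \<in> lower_central G (Suc k)" "c = \<pi> d" using cC unfolding C_def by blast
      obtain y where y: "y \<in> carrier G" "x = \<pi> y" using surj[OF xQ] by blast
      have dG: "d \<in> carrier G" using d lower_central_carrier by auto
      have "comm d y \<in> N" unfolding N_def by (rule comm_in_lower_central[OF d(1) y(1)])
      then have "\<pi> (comm d y) = \<one>\<^bsub>Q\<^esub>" using ker[of "comm d y"] dG y(1) by blast
      then have "\<pi> (comm d y \<otimes> (y \<otimes> d)) = \<pi> (y \<otimes> d)"
        using dG y(1) \<pi>.hom_mult[of "comm d y" "y \<otimes> d"] by (metis Q.l_one \<pi>.hom_closed inv_closed m_closed)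
      moreover have "comm d y \<otimes> (y \<otimes> d) = d \<otimes> y" using dG y by (simp add: group_word_simps)
      ultimately have "\<pi> (d \<otimes> y) = \<pi> (y \<otimes> d)" by simp
      then show ?thesis using d y dG by simp
    qed
    show "finite (\<pi> ` (Y \<union> N))" using Y(1) by (simp add: image_Un \<pi>N)
    show "C = generate Q (\<pi> ` (Y \<union> N))" unfolding C_def gamma by (rule \<pi>.generate_img[OF YG, symmetric])
    show "\<exists>a\<in>carrier Q. \<exists>b\<in>carrier Q. c = Q.comm a b" if "c \<in> \<pi> ` (Y \<union> N)" for c
    proof -
      have "c \<in> \<pi> ` Y \<or> c = \<one>\<^bsub>Q\<^esub>" using that \<pi>N by auto
      then show ?thesis
      proof
        assume "c \<in> \<pi> ` Y"
        then obtain x y where xy: "c = \<pi> (comm x y)" "x \<in> carrier G" "y \<in> carrier G"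
          using Y(2) lower_central_carrier by auto
        then have "c = Q.comm (\<pi> x) (\<pi> y)" by simp
        then show ?thesis using xy by (intro bexI[of _ "\<pi> x"] bexI[of _ "\<pi> y"]) simp_all
      next
        assume "c = \<one>\<^bsub>Q\<^esub>"
        then show ?thesis by (intro bexI[of _ "\<one>\<^bsub>Q\<^esub>"]) auto
      qed
    qed
    show "submonoid (\<pi> ` S) Q"
    proof
      fix x y assume "x \<in> \<pi> ` S" "y \<in> \<pi> ` S"
      then obtain s t where "x = \<pi> s" "y = \<pi> t" "s \<in> S" "t \<in> S" by auto
      then have "x \<otimes>\<^bsub>Q\<^esub> y = \<pi> (s \<otimes> t)" "s \<otimes> t \<in> S" by auto
      then show "x \<otimes>\<^bsub>Q\<^esub> y \<in> \<pi> ` S" by blast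
    next
      show "\<one>\<^bsub>Q\<^esub> \<in> \<pi> ` S" using \<pi>.hom_one S.one_closed by (metis image_eqI)
    qed auto
    show "\<exists>n>0::nat. \<exists>s\<in>\<pi> ` S. \<exists>c\<in>C. q [^]\<^bsub>Q\<^esub> n = s \<otimes>\<^bsub>Q\<^esub> c" if q: "q \<in> carrier Q" for q
    proof -
      obtain x where x: "x \<in> carrier G" "q = \<pi> x" using surj q by auto
      obtain n s c where n: "n > 0" "s \<in> S" "c \<in> lower_central G (Suc k)" "x [^] (n::nat) = s \<otimes> c"
        using big[OF x(1)] by blast
      have "q [^]\<^bsub>Q\<^esub> n = \<pi> s \<otimes>\<^bsub>Q\<^esub> \<pi> c"
        using n x lower_central_carrier[OF n(3)] by (simp flip: \<pi>.hom_nat_pow)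
      then show ?thesis using n unfolding C_def by blast
    qed
    show "\<pi> h \<in> carrier Q" using h by simp
  qed
  then obtain n s where n: "n > 0" "s \<in> S" "\<pi> h [^]\<^bsub>Q\<^esub> (n::nat) = \<pi> s" by auto
  then have "\<pi> (h [^] n) = \<pi> s" using h by (simp add: \<pi>.hom_nat_pow)
  then have "\<pi> (inv s \<otimes> h [^] n) = \<one>\<^bsub>Q\<^esub>" using n h by simp
  then have "inv s \<otimes> h [^] n \<in> N" by (rule iffD1[OF ker, rotated]) (use n h in auto)
  moreover have "h [^] n = s \<otimes> (inv s \<otimes> h [^] n)" using n h by (simp add: inv_mult_cancel)
  ultimately show ?thesis using n unfolding N_def by blast
qed

text \<open>A form of Farkas' lemma: \<open>M\<close> induces a total preorder on the abelianization for which \<open>S\<close> is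
  non-negative.\<close>

lemma total_submonoid_exists:
  assumes X: "generate G X = carrier G" "X \<subseteq> carrier G" "finite X"
    and np: "nilpotent G" and S: "submonoid S G"
    and g0: "g0 \<in> carrier G" "\<And>n::nat. 0 < n \<Longrightarrow> g0 [^] n \<notin> S"
  obtains M where "submonoid M G" "S \<subseteq> M" "M \<noteq> carrier G"
    "\<And>x. x \<in> carrier G \<Longrightarrow> x \<in> M \<or> inv x \<in> M"
    "\<And>x y. x \<in> carrier G \<Longrightarrow> y \<in> carrier G \<Longrightarrow> comm x y \<in> M"
proof -
  note lower_central.simps(2) [simp del]
  interpret S: submonoid S G by fact
  define D where "D = lower_central G (Suc 0)"
  interpret D: normal D G unfolding D_def by (rule lower_central_normal)
  have commD: "comm x y \<in> D" if "x \<in> carrier G" "y \<in> carrier G" for x y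
    unfolding D_def using comm_in_lower_central[of x 0 y] that by simp
  \<comment> \<open>Otherwise the error descends through the lower central series to its trivial
    term, and a power of \<open>g0\<close> itself lies in \<open>S\<close>.\<close>
  have "\<exists>g\<in>carrier G. \<forall>n>0::nat. \<forall>s\<in>S. \<forall>c\<in>D. g [^] n \<noteq> s \<otimes> c"
  proof (rule ccontr)
    assume "\<not> ?thesis"
    then have 0: "\<exists>n>0::nat. \<exists>s\<in>S. \<exists>c\<in>lower_central G (Suc 0). h [^] n = s \<otimes> c" if "h \<in> carrier G" for h
      using that unfolding D_def by blast
    have k: "\<exists>n>0::nat. \<exists>s\<in>S. \<exists>c\<in>lower_central G (Suc k). h [^] n = s \<otimes> c" if "h \<in> carrier G" for h k
      using that
    proof (induction k arbitrary: h)
      case (Suc k)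
      show ?case by (rule powers_reach_submonoid_lower_central_step[OF X S Suc.IH Suc.prems])
    qed (rule 0)
    obtain m where m: "lower_central G m = {\<one>}" using np unfolding nilpotent_def by auto
    obtain n s c where n: "n > 0" "s \<in> S" "c \<in> lower_central G (Suc m)" "g0 [^] (n::nat) = s \<otimes> c"
      using k[OF g0(1), of m] by blast
    have "c = \<one>" using n(3) lower_central_Suc_subset[of m] m by auto
    then show False using g0(2)[OF n(1)] n by auto
  qed
  then obtain g where g: "g \<in> carrier G" "\<And>n s c. 0 < (n::nat) \<Longrightarrow> s \<in> S \<Longrightarrow> c \<in> D \<Longrightarrow> g [^] n \<noteq> s \<otimes> c"
    by blast
  define \<A> where "\<A> = {M. submonoid M G \<and> S \<subseteq> M \<and> D \<subseteq> M \<and> (\<forall>n>0::nat. g [^] n \<notin> M)}"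
  define SD where "SD = {s \<otimes> c | s c. s \<in> S \<and> c \<in> D}"
  have "submonoid SD G"
  proof
    show "SD \<subseteq> carrier G" unfolding SD_def by auto
    show "\<one> \<in> SD" unfolding SD_def using S.one_closed D.one_closed
      by (auto intro!: exI[of _ \<one>])
    fix x y assume "x \<in> SD" "y \<in> SD"
    then obtain s c t d where x: "x = s \<otimes> c" "s \<in> S" "c \<in> D" and y: "y = t \<otimes> d" "t \<in> S" "d \<in> D"
      unfolding SD_def by blast
    have "inv t \<otimes> c \<otimes> t \<in> D" using D.inv_op_closed1[of t c] x y by auto
    then have "(inv t \<otimes> c \<otimes> t) \<otimes> d \<in> D" using y by simp
    moreover have "x \<otimes> y = (s \<otimes> t) \<otimes> ((inv t \<otimes> c \<otimes> t) \<otimes> d)" using x y by (simp add: group_word_simps)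
    ultimately show "x \<otimes> y \<in> SD" unfolding SD_def using x y by blast
  qed
  moreover have "S \<subseteq> SD" unfolding SD_def by clarify (metis D.one_closed S.mem_carrier r_one)
  moreover have "D \<subseteq> SD" unfolding SD_def by clarify (metis S.one_closed D.mem_carrier l_one)
  moreover have "g [^] n \<notin> SD" if "0 < n" for n :: nat using g(2)[OF that] unfolding SD_def by auto
  ultimately have "SD \<in> \<A>" unfolding \<A>_def by simp
  then have ne: "\<A> \<noteq> {}" by blast
  have chain: "\<Union>\<C> \<in> \<A>" if C: "\<C> \<noteq> {}" "subset.chain \<A> \<C>" for \<C>
  proof -
    have sub: "M \<in> \<A>" if "M \<in> \<C>" for M using C that unfolding subset.chain_def by auto
    have m: "submonoid M G" if "M \<in> \<C>" for M using sub[OF that] unfolding \<A>_def by auto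
    have "submonoid (\<Union>\<C>) G"
    proof
      show "\<Union>\<C> \<subseteq> carrier G" using m submonoid.subset by blast
      show "\<one> \<in> \<Union>\<C>" using m submonoid.one_closed C(1) by blast
      fix x y assume "x \<in> \<Union>\<C>" "y \<in> \<Union>\<C>"
      then obtain A B where AB: "x \<in> A" "A \<in> \<C>" "y \<in> B" "B \<in> \<C>" by blast
      then have "A \<subseteq> B \<or> B \<subseteq> A" using C(2) unfolding subset.chain_def by blast
      then obtain M where "M \<in> \<C>" "x \<in> M" "y \<in> M" using AB by blast
      then show "x \<otimes> y \<in> \<Union>\<C>" using submonoid.m_closed[OF m] by blast
    qed
    moreover obtain M0 where "M0 \<in> \<C>" using C(1) by blast
    then have "S \<subseteq> \<Union>\<C>" "D \<subseteq> \<Union>\<C>" using sub[of M0] unfolding \<A>_def by auto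
    moreover have "g [^] n \<notin> \<Union>\<C>" if "0 < n" for n :: nat using sub that unfolding \<A>_def by auto
    ultimately show ?thesis unfolding \<A>_def by simp
  qed
  obtain M where M: "M \<in> \<A>" "\<And>M'. M' \<in> \<A> \<Longrightarrow> M \<subseteq> M' \<Longrightarrow> M' = M"
    using subset_Zorn_nonempty[OF ne chain] by auto
  have MS: "submonoid M G" "S \<subseteq> M" "D \<subseteq> M" and gM: "\<And>n::nat. 0 < n \<Longrightarrow> g [^] n \<notin> M"
    using M(1) unfolding \<A>_def by auto
  interpret M: submonoid M G by fact
  \<comment> \<open>Because \<open>M\<close> contains the commutators, an element of
    \<open>M\<close> can be moved past any \<open>y\<close> at the cost of changing it within
    \<open>M\<close>.\<close>
  have swap: "\<exists>m'\<in>M. y \<otimes> m = m' \<otimes> y" if "m \<in> M" "y \<in> carrier G" for m y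
  proof
    show "m \<otimes> comm (inv m) y \<in> M" using commD[of "inv m" y] that MS(3) by auto
    show "y \<otimes> m = m \<otimes> comm (inv m) y \<otimes> y" using that by (simp add: group_word_simps)
  qed
  have powM: "\<exists>m'\<in>M. (m \<otimes> y) [^] (i::nat) = m' \<otimes> y [^] i" if m: "m \<in> M" and y: "y \<in> carrier G" for m y i
  proof (induction i)
    case (Suc i)
    then obtain m' where m': "m' \<in> M" "(m \<otimes> y) [^] i = m' \<otimes> y [^] i" by blast
    obtain m'' where m'': "m'' \<in> M" "y [^] i \<otimes> m = m'' \<otimes> y [^] i" using swap[OF m nat_pow_closed[OF y]] by blast
    have "(m \<otimes> y) [^] Suc i = m' \<otimes> (y [^] i \<otimes> m) \<otimes> y" using m' m y by (simp add: m_assoc)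
    also have "\<dots> = (m' \<otimes> m'') \<otimes> y [^] Suc i" unfolding m'' using m' m'' m y by (simp add: m_assoc)
    finally show ?case using m' m'' by blast
  qed (use m y in auto)
  \<comment> \<open>Maximality: the submonoid obtained by adjoining \<open>x\<close> to
    \<open>M\<close> must contain a positive power of \<open>g\<close>.\<close>
  have adj: "\<exists>n>0::nat. \<exists>m\<in>M. \<exists>j. g [^] n = m \<otimes> x [^] (j::nat)" if x: "x \<in> carrier G" "x \<notin> M" for x
  proof (rule ccontr)
    assume no: "\<not> ?thesis"
    define M' where "M' = {m \<otimes> x [^] (j::nat) | m j. m \<in> M}"
    have "submonoid M' G"
    proof
      show "M' \<subseteq> carrier G" unfolding M'_def using x by auto
      show "\<one> \<in> M'" unfolding M'_def using M.one_closed x by (auto intro!: exI[of _ \<one>] exI[of _ "0::nat"])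
      fix u v assume "u \<in> M'" "v \<in> M'"
      then obtain m n :: 'a and i j :: nat where u: "u = m \<otimes> x [^] i" "m \<in> M" and v: "v = n \<otimes> x [^] j" "n \<in> M"
        unfolding M'_def by blast
      obtain n' where n': "n' \<in> M" "x [^] i \<otimes> n = n' \<otimes> x [^] i" using swap[of n "x [^] i"] v x by auto
      have "u \<otimes> v = m \<otimes> (x [^] i \<otimes> n) \<otimes> x [^] j" using u v x by (simp add: m_assoc)
      also have "\<dots> = (m \<otimes> n') \<otimes> x [^] (i + j)" unfolding n'(2) using u n' x by (simp add: m_assoc nat_pow_mult)
      finally show "u \<otimes> v \<in> M'" unfolding M'_def using u n' by blast
    qed
    moreover have "m \<otimes> x [^] (0::nat) \<in> M'" if "m \<in> M" for m unfolding M'_def using that by blast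
    then have "M \<subseteq> M'" by auto
    moreover have "g [^] n \<notin> M'" if "n > 0" for n :: nat using no that unfolding M'_def by blast
    ultimately have "M' \<in> \<A>" unfolding \<A>_def using MS by auto
    then have "M' = M" using M(2) \<open>M \<subseteq> M'\<close> by auto
    moreover have "\<one> \<otimes> x [^] (1::nat) \<in> M'" unfolding M'_def using M.one_closed by blast
    ultimately show False using x by simp
  qed
  have total: "x \<in> M \<or> inv x \<in> M" if x: "x \<in> carrier G" for x
  proof (rule ccontr)
    assume "\<not> ?thesis"
    then obtain n m j n' m' j' where 1: "n > 0" "m \<in> M" "g [^] (n::nat) = m \<otimes> x [^] (j::nat)"
      and 2: "n' > 0" "m' \<in> M" "g [^] (n'::nat) = m' \<otimes> inv x [^] (j'::nat)"
      using adj[of x] adj[of "inv x"] x by blast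
    \<comment> \<open>Raising the two equations to the powers \<open>j'\<close> and \<open>j\<close>
      equalises the exponents of \<open>x\<close> and \<open>inv x\<close>, which then cancel. That
      \<open>j > 0\<close> keeps the resulting exponent \<open>n * j' + n' * j\<close> of
      \<open>g\<close> positive.\<close>
    have "j > 0" using 1 gM[of n] x by (cases j) auto
    obtain a where a: "a \<in> M" "g [^] (n * j') = a \<otimes> x [^] (j * j')"
      using powM[OF 1(2), of "x [^] j" j'] g x by (auto simp: 1(3)[symmetric] nat_pow_pow)
    obtain b where b: "b \<in> M" "g [^] (n' * j) = b \<otimes> inv x [^] (j' * j)"
      using powM[OF 2(2), of "inv x [^] j'" j] g x by (auto simp: 2(3)[symmetric] nat_pow_pow)
    obtain b' where b': "b' \<in> M" "x [^] (j * j') \<otimes> b = b' \<otimes> x [^] (j * j')"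
      using swap[of b "x [^] (j * j')"] b x by auto
    have "g [^] (n * j' + n' * j) = a \<otimes> (x [^] (j * j') \<otimes> b) \<otimes> inv x [^] (j' * j)"
      using a b x g by (simp add: m_assoc flip: nat_pow_mult)
    also have "\<dots> = a \<otimes> b'" unfolding b' using a b' x by (simp add: m_assoc nat_pow_inv mult.commute[of j'])
    also have "\<dots> \<in> M" using a b' by simp
    finally show False using gM[of "n * j' + n' * j"] \<open>j > 0\<close> 2(1) by simp
  qed
  show ?thesis
  proof
    show "M \<noteq> carrier G" using gM[of 1] g by auto
    show "comm x y \<in> M" if "x \<in> carrier G" "y \<in> carrier G" for x y using commD that MS(3) by auto
  qed (use MS total in auto)
qed

end

subsection \<open>Extending finite sets to positive cones\<close>

lemma semigroup_generated_mono:
  "A \<subseteq> B \<Longrightarrow> semigroup_generated G A \<subseteq> semigroup_generated G B"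
proof
  fix x assume "A \<subseteq> B" "x \<in> semigroup_generated G A"
  then show "x \<in> semigroup_generated G B"
    by (induction rule: semigroup_generated.induct[OF \<open>x \<in> _\<close>])
      (auto intro: semigroup_generated.intros)
qed

lemma semigroup_generated_least:
  assumes "A \<subseteq> M" "\<And>x y. x \<in> M \<Longrightarrow> y \<in> M \<Longrightarrow> x \<otimes>\<^bsub>G\<^esub> y \<in> M"
  shows "semigroup_generated G A \<subseteq> M"
proof
  fix x assume "x \<in> semigroup_generated G A"
  then show "x \<in> M" by induction (use assms in auto)
qed

lemma semigroup_generated_finite:
  assumes "x \<in> semigroup_generated G A"
  shows "\<exists>B. finite B \<and> B \<subseteq> A \<and> x \<in> semigroup_generated G B"
  using assms
proof induction
  case (incl x)
  then show ?case by (intro exI[of _ "{x}"]) (auto intro: semigroup_generated.incl)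
next
  case (mult x y)
  then obtain B C where BC: "finite B" "B \<subseteq> A" "x \<in> semigroup_generated G B"
    "finite C" "C \<subseteq> A" "y \<in> semigroup_generated G C" by blast
  then have "x \<in> semigroup_generated G (B \<union> C)" "y \<in> semigroup_generated G (B \<union> C)"
    using semigroup_generated_mono[of B "B \<union> C" G] semigroup_generated_mono[of C "B \<union> C" G] by auto
  then show ?case using BC by (intro exI[of _ "B \<union> C"]) (auto intro: semigroup_generated.mult)
qed

text \<open>\<open>P\<close> is disjoint from the set of its inverses, for otherwise closure under
  products would put the identity into \<open>P\<close>. So every nontrivial element has exactly one
  sign.\<close>

definition is_positive_cone :: "('a, 'b) monoid_scheme \<Rightarrow> 'a set \<Rightarrow> bool" where
  "is_positive_cone G P \<longleftrightarrow> P \<subseteq> carrier G \<and> \<one>\<^bsub>G\<^esub> \<notin> P \<and>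
     (\<forall>x\<in>P. \<forall>y\<in>P. x \<otimes>\<^bsub>G\<^esub> y \<in> P) \<and>
     (\<forall>x\<in>carrier G. x \<noteq> \<one>\<^bsub>G\<^esub> \<longrightarrow> x \<in> P \<or> inv\<^bsub>G\<^esub> x \<in> P)"

lemma is_positive_coneD:
  assumes "is_positive_cone G P"
  shows "P \<subseteq> carrier G" "\<one>\<^bsub>G\<^esub> \<notin> P" "\<And>x y. x \<in> P \<Longrightarrow> y \<in> P \<Longrightarrow> x \<otimes>\<^bsub>G\<^esub> y \<in> P"
    "\<And>x. x \<in> carrier G \<Longrightarrow> x \<noteq> \<one>\<^bsub>G\<^esub> \<Longrightarrow> x \<in> P \<or> inv\<^bsub>G\<^esub> x \<in> P"
  using assms unfolding is_positive_cone_def by auto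

context group
begin

lemma semigroup_generated_carrier:
  "A \<subseteq> carrier G \<Longrightarrow> semigroup_generated G A \<subseteq> carrier G"
  by (rule semigroup_generated_least) auto

lemma semigroup_generated_pow:
  assumes "A \<subseteq> carrier G" "x \<in> semigroup_generated G A" "0 < (n::nat)"
  shows "x [^] n \<in> semigroup_generated G A"
proof -
  have "x [^] Suc k \<in> semigroup_generated G A" for k
    by (induction k)
      (use assms(2) subsetD[OF semigroup_generated_carrier[OF assms(1)] assms(2)] in
        \<open>auto intro: semigroup_generated.mult\<close>)
  then show ?thesis using assms(3) by (cases n) auto
qed

lemma semigroup_generated_in_generate:
  assumes "A \<subseteq> carrier G"
  shows "semigroup_generated G A \<subseteq> generate G A"
  by (rule semigroup_generated_least) (auto intro: generate.incl generate.eng)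

lemma submonoid_insert_semigroup_generated:
  assumes "A \<subseteq> carrier G"
  shows "submonoid (insert \<one> (semigroup_generated G A)) G"
  using semigroup_generated_carrier[OF assms]
  by unfold_locales (auto intro: semigroup_generated.mult)

text \<open>If a product in a submonoid is a unit, so are its factors:
  \<open>inv x = y \<otimes> inv (x \<otimes> y)\<close>. For a product equal to
  \<open>\<one>\<close> this discards all generators that are not units of \<open>M\<close>.\<close>

lemma semigroup_generated_factor:
  assumes M: "submonoid M G" and A: "A \<subseteq> M"
    and x: "x \<in> semigroup_generated G A" and "inv x \<in> M"
  shows "x \<in> semigroup_generated G (A \<inter> {y. inv y \<in> M})"
  using x \<open>inv x \<in> M\<close>
proof induction
  case (incl x)
  then show ?case by (auto intro: semigroup_generated.incl)
next
  case (mult x y)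
  interpret submonoid M G by fact
  have "semigroup_generated G A \<subseteq> M" by (rule semigroup_generated_least[OF A]) auto
  then have xy: "x \<in> M" "y \<in> M" using mult.hyps by auto
  have "inv x = y \<otimes> inv (x \<otimes> y)" "inv y = inv (x \<otimes> y) \<otimes> x"
    using xy by (simp_all add: group_word_simps)
  then have "inv x \<in> M" "inv y \<in> M" using xy mult.prems by auto
  then show ?case using mult.IH by (auto intro: semigroup_generated.mult)
qed

text \<open>The ambient group need not be finitely generated, so the total submonoid is built in
  \<open>generate G X\<close>; here it is expressed by the operations of \<open>G\<close>.\<close>

lemma total_submonoid_of_generate:
  assumes X: "X \<subseteq> carrier G" "finite X" and np: "nilpotent G"
    and S: "submonoid S G" "S \<subseteq> generate G X"
    and g0: "g0 \<in> generate G X" "\<And>n::nat. 0 < n \<Longrightarrow> g0 [^] n \<notin> S"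
  obtains M where "submonoid M G" "S \<subseteq> M" "M \<subseteq> generate G X" "M \<noteq> generate G X"
    "\<And>x. x \<in> generate G X \<Longrightarrow> x \<in> M \<or> inv x \<in> M"
    "\<And>x y. x \<in> generate G X \<Longrightarrow> y \<in> generate G X \<Longrightarrow> comm x y \<in> M"
proof -
  define H where "H = generate G X"
  have HG: "subgroup H G" unfolding H_def by (rule generate_is_subgroup[OF X(1)])
  interpret H: group "G\<lparr>carrier := H\<rparr>" using HG subgroup_imp_group by blast
  interpret S: submonoid S G by fact
  have XH: "X \<subseteq> H" unfolding H_def by (auto intro: generate.incl)
  have gen: "generate (G\<lparr>carrier := H\<rparr>) X = carrier (G\<lparr>carrier := H\<rparr>)"
    using generate_consistent[OF XH HG] by (simp add: H_def)
  have SH: "submonoid S (G\<lparr>carrier := H\<rparr>)"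
    using S(2) unfolding H_def by unfold_locales auto
  obtain M where M: "submonoid M (G\<lparr>carrier := H\<rparr>)" "S \<subseteq> M" "M \<noteq> carrier (G\<lparr>carrier := H\<rparr>)"
    "\<And>x. x \<in> carrier (G\<lparr>carrier := H\<rparr>) \<Longrightarrow> x \<in> M \<or> inv\<^bsub>G\<lparr>carrier := H\<rparr>\<^esub> x \<in> M"
    "\<And>x y. x \<in> carrier (G\<lparr>carrier := H\<rparr>) \<Longrightarrow> y \<in> carrier (G\<lparr>carrier := H\<rparr>) \<Longrightarrow> H.comm x y \<in> M"
  proof (rule H.total_submonoid_exists[OF gen _ X(2) nilpotent_subgroup[OF np HG] SH])
    show "X \<subseteq> carrier (G\<lparr>carrier := H\<rparr>)" using XH by simp
    show "g0 \<in> carrier (G\<lparr>carrier := H\<rparr>)" using g0 H_def by simp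
    show "g0 [^]\<^bsub>G\<lparr>carrier := H\<rparr>\<^esub> n \<notin> S" if "0 < n" for n :: nat
      using g0(2)[OF that] nat_pow_consistent by metis
  qed blast
  interpret M: submonoid M "G\<lparr>carrier := H\<rparr>" by fact
  have MH: "M \<subseteq> H" using M.subset by simp
  have MG: "submonoid M G"
    using MH subgroup.subset[OF HG] M.m_closed M.one_closed by unfold_locales auto
  have e: "inv\<^bsub>G\<lparr>carrier := H\<rparr>\<^esub> x = inv x" if "x \<in> H" for x using m_inv_consistent[OF HG that] .
  show ?thesis
  proof
    show "x \<in> M \<or> inv x \<in> M" if "x \<in> generate G X" for x
      using M(4)[of x] e[of x] that unfolding H_def by auto
    show "comm x y \<in> M" if "x \<in> generate G X" "y \<in> generate G X" for x y
      using M(5)[of x y] e[of x] e[of y] that unfolding H_def by auto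
  qed (use MG M(2,3) MH in \<open>auto simp: H_def\<close>)
qed

lemma semigroup_generated_extend:
  assumes tf: "torsion_free G" and np: "nilpotent G"
    and g: "g \<in> carrier G" "g \<noteq> \<one>"
    and F: "finite F" "F \<subseteq> carrier G" "\<one> \<notin> semigroup_generated G F"
  shows "\<one> \<notin> semigroup_generated G (insert g F) \<or> \<one> \<notin> semigroup_generated G (insert (inv g) F)"
  using F
proof (induction "card F" arbitrary: F rule: less_induct)
  case less
  note F = less.prems
  define X where "X = insert g F"
  have X: "X \<subseteq> carrier G" "finite X" unfolding X_def using F g by auto
  define S where "S = insert \<one> (semigroup_generated G F)"
  have Ssub: "submonoid S G" unfolding S_def by (rule submonoid_insert_semigroup_generated[OF F(2)])
  interpret H: subgroup "generate G X" G by (rule generate_is_subgroup[OF X(1)])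
  have "semigroup_generated G F \<subseteq> generate G X"
    using semigroup_generated_mono[of F X G] semigroup_generated_in_generate[OF X(1)] unfolding X_def by blast
  then have SH: "S \<subseteq> generate G X" unfolding S_def by simp
  have gX: "g \<in> generate G X" unfolding X_def by (auto intro: generate.incl)
  \<comment> \<open>If both signs had positive powers in \<open>S\<close>, suitable powers of these
    would multiply to the identity. Torsion-freeness ensures that the powers are not just the
    \<open>\<one>\<close> adjoined in \<open>S\<close>.\<close>
  have "\<exists>g0\<in>{g, inv g}. \<forall>n>0::nat. g0 [^] n \<notin> S"
  proof (rule ccontr)
    assume "\<not> ?thesis"
    then obtain n m where n: "0 < (n::nat)" "g [^] n \<in> S" and m: "0 < (m::nat)" "inv g [^] m \<in> S" by blast
    have "g [^] n \<noteq> \<one>" "inv g [^] m \<noteq> \<one>"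
      using tf g n m unfolding torsion_free_def by auto
    then have "g [^] n \<in> semigroup_generated G F" "inv g [^] m \<in> semigroup_generated G F"
      using n m unfolding S_def by auto
    then have "(g [^] n) [^] m \<otimes> (inv g [^] m) [^] n \<in> semigroup_generated G F"
      using n m by (intro semigroup_generated.mult) (simp_all add: semigroup_generated_pow[OF F(2)])
    moreover have "(g [^] n) [^] m \<otimes> (inv g [^] m) [^] n = \<one>"
      using g by (simp add: nat_pow_pow nat_pow_inv mult.commute[of m])
    ultimately show False using F(3) by simp
  qed
  then obtain g0 where g0: "g0 \<in> {g, inv g}" "\<And>n::nat. 0 < n \<Longrightarrow> g0 [^] n \<notin> S" by blast
  have g0X: "g0 \<in> generate G X" using g0(1) gX H.m_inv_closed by auto
  obtain M where M: "submonoid M G" "S \<subseteq> M" "M \<subseteq> generate G X" "M \<noteq> generate G X"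
    "\<And>x. x \<in> generate G X \<Longrightarrow> x \<in> M \<or> inv x \<in> M"
    using total_submonoid_of_generate[OF X np Ssub SH g0X g0(2)] by metis
  interpret M: submonoid M G by fact
  define K where "K = {y. inv y \<in> M}"
  have FM: "F \<subseteq> M" using M(2) unfolding S_def by (auto intro: semigroup_generated.incl)
  have factor: "\<one> \<in> semigroup_generated G (insert x F \<inter> K)"
    if "\<one> \<in> semigroup_generated G (insert x F)" "x \<in> M" for x
    using semigroup_generated_factor[OF M(1), of "insert x F" \<one>] that FM unfolding K_def by simp
  have F': "\<one> \<notin> semigroup_generated G (F \<inter> K)"
    using F(3) semigroup_generated_mono[of "F \<inter> K" F G] by blast
  \<comment> \<open>If \<open>g\<close> is not a unit of \<open>M\<close>, the sign of
    \<open>g\<close> lying in \<open>M\<close> drops out of every relation. If it is a unit, then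
    not all of \<open>F\<close> are units, and relations live on the smaller set
    \<open>F \<inter> K\<close>.\<close>
  consider "g \<notin> K" | "inv g \<notin> K" | "g \<in> K" "inv g \<in> K" by blast
  then show ?case
  proof cases
    case 1
    then have "g \<in> M" using M(5)[OF gX] unfolding K_def by auto
    then show ?thesis using factor[of g] 1 F' by auto
  next
    case 2
    then have "inv g \<in> M" using M(5)[OF gX] g unfolding K_def by auto
    then show ?thesis using factor[of "inv g"] 2 F' by auto
  next
    case 3
    have gM: "g \<in> M" "inv g \<in> M" using 3 g unfolding K_def by auto
    have "F \<inter> K \<noteq> F"
    proof
      assume "F \<inter> K = F"
      then have "X \<subseteq> M \<inter> K" using FM 3 gM unfolding X_def by auto
      moreover have "subgroup (M \<inter> K) G"
        by unfold_locales (auto simp: K_def inv_mult_group)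
      ultimately have "generate G X \<subseteq> M \<inter> K" by (rule generate_subgroup_incl)
      then show False using M(3,4) by blast
    qed
    then have "card (F \<inter> K) < card F" using F(1) by (intro psubset_card_mono) auto
    then have "\<one> \<notin> semigroup_generated G (insert g (F \<inter> K)) \<or>
        \<one> \<notin> semigroup_generated G (insert (inv g) (F \<inter> K))"
      using less.hyps[of "F \<inter> K"] F F' by auto
    then show ?thesis using factor[OF _ gM(1)] factor[OF _ gM(2)] 3 by auto
  qed
qed

text \<open>A maximal good set \<open>P\<close> is a cone: if neither sign of \<open>x\<close> could
  be added, two finite relations would show this, contradicting
  \<open>semigroup_generated_extend\<close> for the finite part of \<open>P\<close> that they
  involve.\<close>

lemma positive_cone_extending:
  assumes tf: "torsion_free G" and np: "nilpotent G"
    and A: "A \<subseteq> carrier G" "\<one> \<notin> semigroup_generated G A"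
  obtains P where "is_positive_cone G P" "A \<subseteq> P"
proof -
  define \<A> where "\<A> = {B. A \<subseteq> B \<and> B \<subseteq> carrier G \<and> \<one> \<notin> semigroup_generated G B}"
  have ne: "\<A> \<noteq> {}" unfolding \<A>_def using A by blast
  have chain: "\<Union>\<C> \<in> \<A>" if C: "\<C> \<noteq> {}" "subset.chain \<A> \<C>" for \<C>
  proof -
    have sub: "\<C> \<subseteq> \<A>" using C unfolding subset.chain_def by auto
    have "\<one> \<notin> semigroup_generated G (\<Union>\<C>)"
    proof
      assume "\<one> \<in> semigroup_generated G (\<Union>\<C>)"
      then obtain B where B: "finite B" "B \<subseteq> \<Union>\<C>" "\<one> \<in> semigroup_generated G B"
        using semigroup_generated_finite by metis
      obtain D where "D \<in> \<C>" "B \<subseteq> D" using finite_subset_Union_chain[OF B(1,2) C] by blast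
      then show False using B(3) sub semigroup_generated_mono[of B D G] unfolding \<A>_def by blast
    qed
    moreover obtain D where "D \<in> \<C>" using C(1) by blast
    ultimately show ?thesis using sub unfolding \<A>_def by blast
  qed
  obtain P where P: "P \<in> \<A>" "\<And>B. B \<in> \<A> \<Longrightarrow> P \<subseteq> B \<Longrightarrow> B = P"
    using subset_Zorn_nonempty[OF ne chain] by auto
  have AP: "A \<subseteq> P" and PG: "P \<subseteq> carrier G" and good: "\<one> \<notin> semigroup_generated G P"
    using P(1) unfolding \<A>_def by auto
  have max: "x \<in> P" if "x \<in> carrier G" "\<one> \<notin> semigroup_generated G (insert x P)" for x
    using P(2)[of "insert x P"] that AP PG unfolding \<A>_def by auto
  have "is_positive_cone G P" unfolding is_positive_cone_def
  proof (intro conjI ballI impI)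
    show "P \<subseteq> carrier G" by fact
    show "\<one> \<notin> P" using good by (auto intro: semigroup_generated.incl)
    show "x \<otimes> y \<in> P" if "x \<in> P" "y \<in> P" for x y
    proof (rule max)
      have "semigroup_generated G (insert (x \<otimes> y) P) \<subseteq> semigroup_generated G P"
        using that by (intro semigroup_generated_least) (auto intro: semigroup_generated.intros)
      then show "\<one> \<notin> semigroup_generated G (insert (x \<otimes> y) P)" using good by blast
    qed (use that PG in auto)
    show "x \<in> P \<or> inv x \<in> P" if x: "x \<in> carrier G" "x \<noteq> \<one>" for x
    proof (rule ccontr)
      assume "\<not> ?thesis"
      then have "\<one> \<in> semigroup_generated G (insert x P)" "\<one> \<in> semigroup_generated G (insert (inv x) P)"
        using max x by auto
      then obtain B C where B: "finite B" "B \<subseteq> insert x P" "\<one> \<in> semigroup_generated G B"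
        and C: "finite C" "C \<subseteq> insert (inv x) P" "\<one> \<in> semigroup_generated G C"
        using semigroup_generated_finite by metis
      define F where "F = (B \<union> C) \<inter> P"
      have F: "finite F" "F \<subseteq> carrier G" "\<one> \<notin> semigroup_generated G F"
        using B C PG good semigroup_generated_mono[of F P G] unfolding F_def by auto
      have "B \<subseteq> insert x F" "C \<subseteq> insert (inv x) F" using B C unfolding F_def by auto
      then show False using semigroup_generated_extend[OF tf np x F] B(3) C(3)
          semigroup_generated_mono[of B "insert x F" G] semigroup_generated_mono[of C "insert (inv x) F" G]
        by blast
    qed
  qed
  with AP show ?thesis by (rule that[rotated])
qed

end

subsection \<open>Isolated positive cones\<close>

lemma semigroup_generated_carrier_update [simp]:
  "semigroup_generated (G\<lparr>carrier := H\<rparr>) A = semigroup_generated G A"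
proof (rule antisym)
  show "semigroup_generated (G\<lparr>carrier := H\<rparr>) A \<subseteq> semigroup_generated G A"
    by (rule semigroup_generated_least)
      (use semigroup_generated.mult[of _ G A] in \<open>auto intro: semigroup_generated.incl\<close>)
  show "semigroup_generated G A \<subseteq> semigroup_generated (G\<lparr>carrier := H\<rparr>) A"
    by (rule semigroup_generated_least)
      (use semigroup_generated.mult[of _ "G\<lparr>carrier := H\<rparr>" A] in \<open>auto intro: semigroup_generated.incl\<close>)
qed

text \<open>For a torsion-free abelian group this is rank at most one: \<open>x\<close> is the
  rational multiple \<open>n / m\<close> of \<open>y\<close>. In the torsion-free case
  \<open>n = 0\<close> occurs exactly for trivial \<open>x\<close>.\<close>

definition commensurable :: "('a, 'b) monoid_scheme \<Rightarrow> 'a set \<Rightarrow> bool" where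
  "commensurable G L \<longleftrightarrow>
     (\<forall>x\<in>L. \<forall>y\<in>L. y \<noteq> \<one>\<^bsub>G\<^esub> \<longrightarrow> (\<exists>m>0::nat. \<exists>n::int. x [^]\<^bsub>G\<^esub> m = y [^]\<^bsub>G\<^esub> n))"

lemma commensurableD:
  assumes "commensurable G L" "x \<in> L" "y \<in> L" "y \<noteq> \<one>\<^bsub>G\<^esub>"
  obtains m :: nat and n :: int where "0 < m" "x [^]\<^bsub>G\<^esub> m = y [^]\<^bsub>G\<^esub> n"
  using assms unfolding commensurable_def by blast

lemma (in group) positive_cone_pow:
  assumes "is_positive_cone G P" "x \<in> P" "0 < (n::nat)"
  shows "x [^] n \<in> P"
proof -
  have "x [^] Suc k \<in> P" for k
    by (induction k) (use assms is_positive_coneD[OF assms(1)] in auto)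
  then show ?thesis using assms(3) by (cases n) auto
qed

text \<open>Powers of a positive element stay positive. This supplies torsion-freeness where only a
  cone is at hand, as for the quotient in \<open>commensurable_if_isolated\<close>.\<close>

lemma (in group) positive_cone_torsion_free:
  assumes P: "is_positive_cone G P" and x: "x \<in> carrier G" "x \<noteq> \<one>" "0 < (n::nat)"
  shows "x [^] n \<noteq> \<one>"
  using is_positive_coneD(2,4)[OF P] positive_cone_pow[OF P, of x n] positive_cone_pow[OF P, of "inv x" n] x
  by (metis inv_one nat_pow_inv)

lemma (in group) nat_pow_eq_int_pow_mult:
  assumes "x \<in> carrier G" "y \<in> carrier G" "x [^] (m::nat) = y [^] (n::int)"
  shows "x [^] (m * k) = y [^] (n * int k)"
proof -
  have "x [^] (m * k) = (y [^] n) [^] int k"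
    using assms by (simp add: int_pow_int flip: nat_pow_pow)
  then show ?thesis using assms(2) by (simp add: int_pow_pow)
qed

section \<open>Finitely generated cones of abelian groups\<close>

context comm_group
begin

text \<open>Of two distinct generators the larger one is redundant: some power of \<open>f\<^sub>1 f\<^sub>2\<^sup>-\<^sup>1 > 1\<close> is a
  product of generators, and solving for \<open>f\<^sub>1\<close> leaves it with a positive exponent.\<close>

lemma redundant_generator:
  assumes P: "is_positive_cone G P" and F: "F \<subseteq> P"
    and gen: "\<And>x. x \<in> P \<Longrightarrow> \<exists>n>0::nat. x [^] n \<in> semigroup_generated G F"
    and f: "f1 \<in> F" "f2 \<in> F" "f1 \<noteq> f2" "f1 \<otimes> inv f2 \<in> P"
    and x: "x \<in> P"
  shows "\<exists>n>0::nat. x [^] n \<in> semigroup_generated G (F - {f1})"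
proof -
  note PD = is_positive_coneD[OF P]
  define T where "T = semigroup_generated G (F - {f1})"
  have FG: "F - {f1} \<subseteq> carrier G" using F PD(1) by auto
  have TG: "T \<subseteq> carrier G" unfolding T_def by (rule semigroup_generated_carrier[OF FG])
  have TP: "T \<subseteq> P" unfolding T_def by (rule semigroup_generated_least) (use F PD in auto)
  have fG: "f1 \<in> carrier G" "f2 \<in> carrier G" "x \<in> carrier G" using f F x PD(1) by auto
  interpret T1: submonoid "insert \<one> T" G unfolding T_def by (rule submonoid_insert_semigroup_generated[OF FG])
  have split: "\<exists>q::nat. \<exists>s\<in>insert \<one> T. u = f1 [^] q \<otimes> s" if "u \<in> semigroup_generated G F" for u
    using that
  proof induction
    case (incl u)
    show ?case
    proof (cases "u = f1")
      case True
      then show ?thesis using fG by (intro exI[of _ 1] bexI[of _ \<one>]) auto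
    next
      case False
      then have "u \<in> T" unfolding T_def using incl by (auto intro: semigroup_generated.incl)
      then show ?thesis using TG by (intro exI[of _ 0] bexI[of _ u]) auto
    qed
  next
    case (mult u v)
    then obtain p q :: nat and s t where st: "s \<in> insert \<one> T" "u = f1 [^] p \<otimes> s" "t \<in> insert \<one> T" "v = f1 [^] q \<otimes> t"
      by blast
    have "u \<otimes> v = f1 [^] (p + q) \<otimes> (s \<otimes> t)"
      using st fG T1.subset by (auto simp: m_ac simp flip: nat_pow_mult)
    then show ?case using st T1.m_closed by blast
  qed
  obtain n where n: "0 < (n::nat)" "(f1 \<otimes> inv f2) [^] n \<in> semigroup_generated G F" using gen[OF f(4)] by blast
  obtain q :: nat and s where s: "s \<in> insert \<one> T" "(f1 \<otimes> inv f2) [^] n = f1 [^] q \<otimes> s" using split[OF n(2)] by blast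
  have sG: "s \<in> carrier G" using s T1.subset by auto
  have f2T: "f2 [^] n \<in> T" unfolding T_def
    by (rule semigroup_generated_pow[OF FG _ n(1)]) (use f in \<open>auto intro: semigroup_generated.incl\<close>)
  define t where "t = s \<otimes> f2 [^] n"
  have t: "t \<in> T" unfolding t_def using s f2T TG unfolding T_def by (auto intro: semigroup_generated.mult)
  have f1n: "f1 [^] n = f1 [^] q \<otimes> t"
  proof -
    have "f1 [^] n = (f1 \<otimes> inv f2) [^] n \<otimes> f2 [^] n"
      using fG by (simp add: nat_pow_distrib nat_pow_inv m_assoc)
    then show ?thesis unfolding s t_def using fG sG by (simp add: m_assoc)
  qed
  \<comment> \<open>For \<open>q \<ge> n\<close>, cancelling \<open>f1 [^] n\<close> would write the
    identity as a product of positive elements.\<close>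
  have nq: "q < n"
  proof (rule ccontr)
    assume "\<not> q < n"
    then have fq: "f1 [^] q = f1 [^] n \<otimes> f1 [^] (q - n)" using fG by (simp add: nat_pow_mult)
    have tG: "t \<in> carrier G" using t TG by auto
    have "f1 [^] n = f1 [^] n \<otimes> (f1 [^] (q - n) \<otimes> t)"
      using f1n fG tG unfolding fq by (simp only: m_assoc nat_pow_closed)
    then have e: "f1 [^] (q - n) \<otimes> t = \<one>"
      using l_cancel_one'[of "f1 [^] n" "f1 [^] (q - n) \<otimes> t"] fG tG by simp
    show False
    proof (cases "q = n")
      case True
      then show False using e t TP TG PD(2) by auto
    next
      case False
      then have "f1 [^] (q - n) \<in> P" using \<open>\<not> q < n\<close> f(1) F by (intro positive_cone_pow[OF P]) auto
      then show False using e PD(2) PD(3)[of "f1 [^] (q - n)" t] t TP by auto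
    qed
  qed
  define d where "d = n - q"
  have d: "d > 0" using nq d_def by simp
  have "f1 [^] n = f1 [^] q \<otimes> f1 [^] d" using fG nq by (simp add: nat_pow_mult d_def)
  then have f1d: "f1 [^] d = t" using f1n fG subsetD[OF TG t] by simp
  obtain N where N: "0 < (N::nat)" "x [^] N \<in> semigroup_generated G F" using gen[OF x] by blast
  obtain p :: nat and r where r: "r \<in> insert \<one> T" "x [^] N = f1 [^] p \<otimes> r" using split[OF N(2)] by blast
  have rG: "r \<in> carrier G" using r T1.subset by auto
  \<comment> \<open>The exponent \<open>d\<close> turns \<open>f1 [^] p\<close> into
    \<open>t [^] p\<close>, a product of the remaining generators.\<close>
  have "x [^] (N * d) = (f1 [^] p \<otimes> r) [^] d" using fG by (simp add: nat_pow_pow flip: r(2))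
  also have "\<dots> = t [^] p \<otimes> r [^] d"
    using fG rG by (simp add: nat_pow_distrib nat_pow_pow mult.commute[of p] flip: f1d)
  also have "\<dots> \<in> insert \<one> T"
    using submonoid_pow[OF T1.submonoid_axioms] t r by (intro T1.m_closed) auto
  finally have "x [^] (N * d) \<in> insert \<one> T" .
  moreover have "x [^] (N * d) \<noteq> \<one>" using positive_cone_pow[OF P x, of "N * d"] N d PD(2) by auto
  ultimately show ?thesis using N d unfolding T_def by (intro exI[of _ "N * d"]) auto
qed

text \<open>Redundant generators are dropped until at most one, \<open>f\<close>, is left; then
  every element is a rational multiple of \<open>f\<close>. The hypothesis is about powers because
  dropping a generator preserves generation only in this weaker form.\<close>

lemma commensurable_if_finitely_generated_cone:
  assumes P: "is_positive_cone G P" and F: "finite F" "F \<subseteq> P"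
    and gen: "\<And>x. x \<in> P \<Longrightarrow> \<exists>n>0::nat. x [^] n \<in> semigroup_generated G F"
  shows "commensurable G (carrier G)"
  using F gen
proof (induction "card F" arbitrary: F rule: less_induct)
  case less
  note PD = is_positive_coneD[OF P]
  show ?case
  proof (cases "\<exists>f1\<in>F. \<exists>f2\<in>F. f1 \<noteq> f2")
    case True
    then obtain f1 f2 where f: "f1 \<in> F" "f2 \<in> F" "f1 \<noteq> f2" by blast
    have fG: "f1 \<in> carrier G" "f2 \<in> carrier G" using f less.prems(2) PD(1) by auto
    have "f1 \<otimes> inv f2 \<noteq> \<one>" using f(3) fG by (metis inv_equality inv_inv inv_closed)
    then have "f1 \<otimes> inv f2 \<in> P \<or> f2 \<otimes> inv f1 \<in> P"
      using PD(4)[of "f1 \<otimes> inv f2"] fG by (auto simp: inv_mult_group)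
    then obtain g where g: "g \<in> F" "\<And>x. x \<in> P \<Longrightarrow> \<exists>n>0::nat. x [^] n \<in> semigroup_generated G (F - {g})"
      using redundant_generator[OF P less.prems(2,3)] f by metis
    have "card (F - {g}) < card F" using g(1) less.prems(1) by (intro psubset_card_mono) auto
    then show ?thesis using less.hyps[of "F - {g}"] less.prems g(2) by auto
  next
    case False
    obtain f where Ff: "F \<subseteq> {f}" and fG: "f \<in> carrier G"
    proof (cases "F = {}")
      case True
      \<comment> \<open>Without generators nothing is positive and the group is trivial, so
        \<open>\<one>\<close> can serve as \<open>f\<close>.\<close>
      then show ?thesis using that[of \<one>] by simp
    next
      case F: False
      then obtain f where "f \<in> F" by blast
      then have "F \<subseteq> {f}" "f \<in> carrier G" using False less.prems(2) PD(1) by auto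
      then show ?thesis by (rule that)
    qed
    have "semigroup_generated G F \<subseteq> {f [^] (k::nat) | k. True}"
    proof (rule semigroup_generated_least)
      show "F \<subseteq> {f [^] (k::nat) | k. True}" using Ff fG by (auto intro!: exI[of _ "1::nat"])
    qed (use fG in \<open>auto simp: nat_pow_mult\<close>)
    then have P1: "\<exists>m>0::nat. \<exists>n::nat. x [^] m = f [^] n" if "x \<in> P" for x
      using less.prems(3)[OF that] by blast
    have *: "\<exists>m>0::nat. \<exists>n::int. x [^] m = f [^] n" if x: "x \<in> carrier G" for x
    proof -
      consider "x = \<one>" | "x \<in> P" | "inv x \<in> P" using PD(4) x by blast
      then show ?thesis
      proof cases
        case 1
        then show ?thesis by (intro exI[of _ 1] exI[of _ 0] conjI) auto
      next
        case 2
        then show ?thesis using P1[OF 2] int_pow_int by metis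
      next
        case 3
        then obtain m n where m: "0 < (m::nat)" "inv x [^] m = f [^] (n::nat)" using P1 by blast
        then have "x [^] m = inv (f [^] n)" using x by (metis inv_inv nat_pow_closed nat_pow_inv)
        then have "x [^] m = f [^] (- int n)" using fG by (simp add: int_pow_neg_int)
        then show ?thesis using m by blast
      qed
    qed
    show ?thesis unfolding commensurable_def
    proof (intro ballI impI)
      fix x y assume x: "x \<in> carrier G" and y: "y \<in> carrier G" "y \<noteq> \<one>"
      obtain m n where m: "0 < (m::nat)" "x [^] m = f [^] (n::int)" using *[OF x] by blast
      obtain m' n' where m': "0 < (m'::nat)" "y [^] m' = f [^] (n'::int)" using *[OF y(1)] by blast
      have "n' \<noteq> 0" using m' positive_cone_torsion_free[OF P y m'(1)] by auto
      \<comment> \<open>Multiplying by the absolute value of \<open>n'\<close> keeps the exponent of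
        \<open>x\<close> positive; the sign moves to the side of \<open>y\<close>.\<close>
      have "x [^] (m * nat \<bar>n'\<bar>) = f [^] (n * \<bar>n'\<bar>)"
        using nat_pow_eq_int_pow_mult[OF x fG m(2), of "nat \<bar>n'\<bar>"] by simp
      also have "n * \<bar>n'\<bar> = n' * (sgn n' * n)" by (simp add: abs_sgn)
      also have "f [^] (n' * (sgn n' * n)) = y [^] (int m' * (sgn n' * n))"
        using y fG m'(2) by (metis int_pow_int int_pow_pow)
      finally show "\<exists>m>0::nat. \<exists>n::int. x [^] m = y [^] n"
        using m(1) \<open>n' \<noteq> 0\<close> by (intro exI[of _ "m * nat \<bar>n'\<bar>"]) auto
    qed
  qed
qed

end

section \<open>Commensurable groups are abelian of rank one\<close>

lemma (in group) commensurable_roots: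
  assumes L: "L \<subseteq> carrier G" and H: "subgroup H G" "commensurable G H"
    and tf: "torsion_free G"
    and roots: "\<And>x. x \<in> L \<Longrightarrow> \<exists>n>0::nat. x [^] n \<in> H"
  shows "commensurable G L"
  unfolding commensurable_def
proof (intro ballI impI)
  fix x y assume x: "x \<in> L" and y: "y \<in> L" "y \<noteq> \<one>"
  have G: "x \<in> carrier G" "y \<in> carrier G" using x y L by auto
  obtain a where a: "0 < (a::nat)" "x [^] a \<in> H" using roots[OF x] by blast
  obtain b where b: "0 < (b::nat)" "y [^] b \<in> H" using roots[OF y(1)] by blast
  have "y [^] b \<noteq> \<one>" using tf y b G unfolding torsion_free_def by auto
  then obtain m :: nat and n :: int where m: "0 < m" "(x [^] a) [^] m = (y [^] b) [^] n"
    using commensurableD[OF H(2) a(2) b(2)] by blast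
  then have "x [^] (a * m) = y [^] (int b * n)"
    using G by (metis nat_pow_pow int_pow_pow int_pow_int)
  then show "\<exists>m>0::nat. \<exists>n::int. x [^] m = y [^] n" using a m by (intro exI[of _ "a * m"]) auto
qed

text \<open>Some positive power of \<open>x\<close> is a power of \<open>y\<close> and so commutes
  with \<open>y\<close>; \<open>commute_if_power_commute\<close> removes the exponent.\<close>

lemma (in group) comm_group_if_commensurable:
  assumes "torsion_free G" "nilpotent G" "commensurable G (carrier G)"
  shows "comm_group G"
proof (rule group_comm_groupI)
  fix x y assume x: "x \<in> carrier G" and y: "y \<in> carrier G"
  show "x \<otimes> y = y \<otimes> x"
  proof (cases "y = \<one>")
    case False
    then obtain m :: nat and n :: int where m: "0 < m" "x [^] m = y [^] n"
      using commensurableD[OF assms(3) x y] by blast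
    have "y [^] n \<otimes> y = y \<otimes> y [^] n"
      using y int_pow_mult[of y n 1] int_pow_mult[of y 1 n] by (simp add: add.commute)
    then show ?thesis
      using commute_if_power_commute[OF assms(1,2) x y m(1)] m(2) by simp
  qed (use x in simp)
qed

text \<open>Relative to a fixed \<open>z \<noteq> \<one>\<close>, every \<open>x\<close> has a slope
  \<open>q x = n / m\<close> with \<open>x [^] m = z [^] n\<close>, and the slope embeds the group
  in a rational line. It is well defined because \<open>z\<close> has infinite order, and injective
  because roots are unique in a torsion-free abelian group.\<close>

lemma (in group) abelian_rank_eq_1_if_commensurable:
  assumes tf: "torsion_free G" and com: "comm_group G" and C: "commensurable G (carrier G)"
    and nt: "carrier G \<noteq> {\<one>}"
  shows "abelian_rank G = 1"
proof -
  interpret comm_group G by fact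
  obtain z where z: "z \<in> carrier G" "z \<noteq> \<one>" using nt one_closed by auto
  have zinf: "z [^] (n::int) = z [^] (k::int) \<longleftrightarrow> n = k" for n k
  proof
    assume e: "z [^] n = z [^] k"
    have zero: "i = 0" if "z [^] (i::int) = \<one>" for i
    proof -
      have "z [^] nat \<bar>i\<bar> = \<one>"
        using that z by (cases "i \<ge> 0") (auto simp: int_pow_neg simp flip: int_pow_int)
      then show ?thesis using tf z unfolding torsion_free_def by (metis nat_0_iff neq0_conv abs_le_zero_iff)
    qed
    have "z [^] (n - k) = \<one>" using z e int_pow_diff[of z n k] by simp
    then show "n = k" using zero[of "n - k"] by simp
  qed simp
  define q :: "'a \<Rightarrow> rat" where
    "q x = (SOME r. \<exists>m n. 0 < (m::nat) \<and> x [^] m = z [^] (n::int) \<and> r = of_int n / of_nat m)" for x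
  have q: "q x = of_int n / of_nat m" if x: "x \<in> carrier G" "0 < m" "x [^] m = z [^] n" for x and m :: nat and n :: int
  proof -
    have "\<exists>m n. 0 < (m::nat) \<and> x [^] m = z [^] (n::int) \<and> q x = of_int n / of_nat m"
      unfolding q_def by (rule someI_ex) (use x in blast)
    then obtain m' n' where m': "0 < (m'::nat)" "x [^] m' = z [^] (n'::int)" "q x = of_int n' / of_nat m'" by blast
    have "x [^] (m * m') = z [^] (n * int m')" using nat_pow_eq_int_pow_mult[OF x(1) z(1) x(3)] .
    moreover have "x [^] (m' * m) = z [^] (n' * int m)" using nat_pow_eq_int_pow_mult[OF x(1) z(1) m'(2)] .
    ultimately have "n * int m' = n' * int m" using zinf by (simp add: mult.commute)
    then have "of_int (n * int m') = (of_int (n' * int m) :: rat)" by simp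
    then show ?thesis unfolding m'(3) using m'(1) x(2) by (simp add: frac_eq_eq)
  qed
  define b :: "nat \<Rightarrow> rat" where "b = (\<lambda>_. 1)"
  define h where "h x = rat_scale (q x) b" for x
  have b0: "b \<noteq> 0" by (simp add: b_def fun_eq_iff)
  have heq: "h x = h y \<longleftrightarrow> q x = q y" for x y by (simp add: h_def rat_scale_def b_def fun_eq_iff)
  have "embeds_in_dim G 1" unfolding embeds_in_dim_def
  proof (intro exI conjI)
    show "finite {b}" "card {b} = 1" by auto
    show "rat_fun.independent {b}" using b0 by simp
    show "rat_fun.span {b} = rat_fun.span {b}" ..
    show "h \<in> mon G \<lparr>carrier = rat_fun.span {b}, monoid.mult = (+), one = 0\<rparr>"
      unfolding mon_def
    proof (intro CollectI conjI homI)
      show "h x \<in> carrier \<lparr>carrier = rat_fun.span {b}, monoid.mult = (+), one = 0\<rparr>" for x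
        unfolding h_def by (simp add: rat_fun.span_base rat_fun.span_scale)
      fix x y assume x: "x \<in> carrier G" and y: "y \<in> carrier G"
      obtain m :: nat and n :: int where m: "0 < m" "x [^] m = z [^] n"
        using commensurableD[OF C x z] by blast
      obtain m' :: nat and n' :: int where m': "0 < m'" "y [^] m' = z [^] n'"
        using commensurableD[OF C y z] by blast
      have e: "x [^] (m * m') = z [^] (n * int m')" using nat_pow_eq_int_pow_mult[OF x z(1) m(2)] .
      have e': "y [^] (m * m') = z [^] (n' * int m)"
        using nat_pow_eq_int_pow_mult[OF y z(1) m'(2), of m] by (simp add: mult.commute)
      have "(x \<otimes> y) [^] (m * m') = z [^] (n * int m' + n' * int m)"
        using x y z e e' by (simp add: nat_pow_distrib int_pow_mult)
      then have "q (x \<otimes> y) = of_int (n * int m' + n' * int m) / of_nat (m * m')"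
        using q[of "x \<otimes> y" "m * m'"] x y m m' by simp
      also have "\<dots> = q x + q y" using q[OF x m] q[OF y m'] m m' by (simp add: field_simps)
      finally have "q (x \<otimes> y) = q x + q y" .
      then show "h (x \<otimes> y) = h x \<otimes>\<^bsub>\<lparr>carrier = rat_fun.span {b}, monoid.mult = (+), one = 0\<rparr>\<^esub> h y"
        by (simp add: h_def rat_fun.scale_left_distrib)
    next
      show "inj_on h (carrier G)"
      proof (rule inj_onI)
        fix x y assume x: "x \<in> carrier G" and y: "y \<in> carrier G" and "h x = h y"
        then have qe: "q x = q y" using heq by simp
        obtain m :: nat and n :: int where m: "0 < m" "x [^] m = z [^] n"
          using commensurableD[OF C x z] by blast
        obtain m' :: nat and n' :: int where m': "0 < m'" "y [^] m' = z [^] n'"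
          using commensurableD[OF C y z] by blast
        have "of_int n / of_nat m = (of_int n' / of_nat m' :: rat)" using q[OF x m] q[OF y m'] qe by simp
        then have "of_int (n * int m') = (of_int (n' * int m) :: rat)" using m m' by (simp add: frac_eq_eq)
        then have nm: "n * int m' = n' * int m" by (simp only: of_int_eq_iff)
        have e: "x [^] (m * m') = z [^] (n * int m')" using nat_pow_eq_int_pow_mult[OF x z(1) m(2)] .
        have e': "y [^] (m * m') = z [^] (n' * int m)"
          using nat_pow_eq_int_pow_mult[OF y z(1) m'(2), of m] by (simp add: mult.commute)
        have "(x \<otimes> inv y) [^] (m * m') = \<one>"
          using x y z e e' nm by (simp add: nat_pow_distrib nat_pow_inv)
        then have "x \<otimes> inv y = \<one>" using tf x y m m' unfolding torsion_free_def by (metis inv_closed m_closed nat_0_less_mult_iff)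
        then show "x = y" using x y by (metis inv_closed inv_equality inv_inv)
      qed
    qed
  qed
  moreover have "\<not> embeds_in_dim G 0"
  proof
    assume "embeds_in_dim G 0"
    then obtain h where h: "h \<in> mon G \<lparr>carrier = {0::nat \<Rightarrow> rat}, monoid.mult = (+), one = 0\<rparr>"
      unfolding embeds_in_dim_def by auto
    then have "h z = 0" "h \<one> = 0" unfolding mon_def hom_def using z by auto
    then show False using h z unfolding mon_def inj_on_def by (metis (mono_tags, lifting) mem_Collect_eq one_closed)
  qed
  then have "enat 1 \<le> enat n" if "embeds_in_dim G n" for n using that by (cases n) auto
  ultimately have "(INF n \<in> {n. embeds_in_dim G n}. enat n) = enat 1"
    by (intro antisym INF_greatest INF_lower) auto
  then show ?thesis unfolding abelian_rank_def by (simp add: one_enat_def)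
qed

section \<open>Cones isolated by a finite set\<close>

context group
begin

text \<open>A relation among \<open>F\<close> and \<open>inv x\<close> must contain the factor
  \<open>inv x\<close>, as \<open>F\<close> alone gives none. In the abelian group \<open>A\<close>
  these factors can be collected on the other side, leaving a power of \<open>h x\<close> as a
  product of images of \<open>F\<close>, from which trivial images drop out.\<close>

lemma decided_power:
  assumes A: "comm_group A" and hom: "h \<in> hom (G\<lparr>carrier := H\<rparr>) A" and H: "subgroup H G"
    and F: "F \<subseteq> H" and x: "x \<in> H"
    and dec: "\<one> \<in> semigroup_generated G (insert (inv x) F)" and good: "\<one> \<notin> semigroup_generated G F"
  shows "\<exists>n>0::nat. h x [^]\<^bsub>A\<^esub> n \<in> insert \<one>\<^bsub>A\<^esub> (semigroup_generated A (h ` F - {\<one>\<^bsub>A\<^esub>}))"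
proof -
  interpret A: comm_group A by fact
  interpret H: subgroup H G by fact
  interpret HG: group "G\<lparr>carrier := H\<rparr>" using H subgroup_imp_group by blast
  interpret h: group_hom "G\<lparr>carrier := H\<rparr>" A h by unfold_locales (rule hom)
  have hH: "h y \<in> carrier A" if "y \<in> H" for y using h.hom_closed that by simp
  have hm: "h (y \<otimes> z) = h y \<otimes>\<^bsub>A\<^esub> h z" if "y \<in> H" "z \<in> H" for y z using h.hom_mult that by simp
  have h1: "h \<one> = \<one>\<^bsub>A\<^esub>" using h.hom_one by simp
  have hi: "h (inv x) \<otimes>\<^bsub>A\<^esub> h x = \<one>\<^bsub>A\<^esub>" using hm[of "inv x" x] x h1 by simp
  define B where "B = h ` F - {\<one>\<^bsub>A\<^esub>}"
  have BA: "B \<subseteq> carrier A" unfolding B_def using F hH by auto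
  interpret B: submonoid "insert \<one>\<^bsub>A\<^esub> (semigroup_generated A B)" A
    by (rule A.submonoid_insert_semigroup_generated[OF BA])
  have sH: "semigroup_generated G (insert (inv x) F) \<subseteq> H"
    by (rule semigroup_generated_least) (use F x in auto)
  \<comment> \<open>\<open>n\<close> counts the factors of \<open>u\<close> taken to be
    \<open>inv x\<close>; the second clause records that without such factors \<open>u\<close> comes
    from \<open>F\<close> alone.\<close>
  have "\<exists>n::nat. h u \<otimes>\<^bsub>A\<^esub> h x [^]\<^bsub>A\<^esub> n \<in> insert \<one>\<^bsub>A\<^esub> (semigroup_generated A B) \<and>
      (n = 0 \<longrightarrow> u \<in> semigroup_generated G F)" if "u \<in> semigroup_generated G (insert (inv x) F)" for u
    using that
  proof induction
    case (incl u)
    show ?case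
    proof (cases "u \<in> F")
      case True
      then have "h u \<in> insert \<one>\<^bsub>A\<^esub> (semigroup_generated A B)"
        unfolding B_def by (auto intro: semigroup_generated.incl)
      then show ?thesis using True F hH by (intro exI[of _ 0]) (auto intro: semigroup_generated.incl)
    next
      case False
      then have "u = inv x" using incl by auto
      then show ?thesis using hi hH x by (intro exI[of _ 1]) auto
    qed
  next
    case (mult u v)
    then obtain m n :: nat
      where m: "h u \<otimes>\<^bsub>A\<^esub> h x [^]\<^bsub>A\<^esub> m \<in> insert \<one>\<^bsub>A\<^esub> (semigroup_generated A B)" "m = 0 \<longrightarrow> u \<in> semigroup_generated G F"
        and n: "h v \<otimes>\<^bsub>A\<^esub> h x [^]\<^bsub>A\<^esub> n \<in> insert \<one>\<^bsub>A\<^esub> (semigroup_generated A B)" "n = 0 \<longrightarrow> v \<in> semigroup_generated G F"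
      by blast
    have uv: "u \<in> H" "v \<in> H" using mult.hyps sH by auto
    have "h (u \<otimes> v) \<otimes>\<^bsub>A\<^esub> h x [^]\<^bsub>A\<^esub> (m + n) = (h u \<otimes>\<^bsub>A\<^esub> h x [^]\<^bsub>A\<^esub> m) \<otimes>\<^bsub>A\<^esub> (h v \<otimes>\<^bsub>A\<^esub> h x [^]\<^bsub>A\<^esub> n)"
      using hH[OF uv(1)] hH[OF uv(2)] hH[OF x] by (simp add: hm[OF uv] A.m_ac flip: A.nat_pow_mult)
    then have "h (u \<otimes> v) \<otimes>\<^bsub>A\<^esub> h x [^]\<^bsub>A\<^esub> (m + n) \<in> insert \<one>\<^bsub>A\<^esub> (semigroup_generated A B)"
      using B.m_closed[OF m(1) n(1)] by simp
    then show ?case using m(2) n(2) by (intro exI[of _ "m + n"]) (auto intro: semigroup_generated.mult)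
  qed
  from this[OF dec] obtain n :: nat
    where n: "h \<one> \<otimes>\<^bsub>A\<^esub> h x [^]\<^bsub>A\<^esub> n \<in> insert \<one>\<^bsub>A\<^esub> (semigroup_generated A B)" "n \<noteq> 0"
    using good by blast
  then show ?thesis using hH[OF x] unfolding B_def h1 by (intro exI[of _ n]) auto
qed

text \<open>If no power of \<open>g\<close> lies in the subgroup generated by \<open>F\<close>, a total submonoid has that subgroup
  among its units but not \<open>g\<close>, so that neither sign of \<open>g\<close> conflicts with \<open>F\<close>.\<close>

lemma decided_root:
  assumes np: "nilpotent G" and P: "is_positive_cone G P"
    and F: "finite F" "F \<subseteq> P"
    and g: "g \<in> P" and dec: "\<one> \<in> semigroup_generated G (insert (inv g) F)"
  shows "\<exists>n>0::nat. g [^] n \<in> generate G F"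
proof (rule ccontr)
  assume no: "\<not> ?thesis"
  note PD = is_positive_coneD[OF P]
  have FG: "F \<subseteq> carrier G" using F PD(1) by auto
  have gG: "g \<in> carrier G" using g PD(1) by auto
  interpret H: subgroup "generate G F" G by (rule generate_is_subgroup[OF FG])
  define X where "X = insert g F"
  have X: "X \<subseteq> carrier G" "finite X" unfolding X_def using F FG gG by auto
  have S: "submonoid (generate G F) G" "generate G F \<subseteq> generate G X"
    using H.subgroup_axioms subgroup_is_submonoid mono_generate[of F X] unfolding X_def by auto
  have gX: "g \<in> generate G X" unfolding X_def by (auto intro: generate.incl)
  obtain M where M: "submonoid M G" "generate G F \<subseteq> M" "M \<subseteq> generate G X" "M \<noteq> generate G X"
    "\<And>x. x \<in> generate G X \<Longrightarrow> x \<in> M \<or> inv x \<in> M"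
    using total_submonoid_of_generate[OF X np S gX] no by metis
  interpret M: submonoid M G by fact
  \<comment> \<open>\<open>K\<close> is the submonoid of inverses of elements of \<open>M\<close>.
    One of \<open>M\<close> and \<open>K\<close> contains \<open>inv g\<close> as a non-unit, so
    \<open>inv g\<close> drops out of the relation, while \<open>F\<close> consists of units of
    both.\<close>
  define K where "K = {y \<in> carrier G. inv y \<in> M}"
  have Ksub: "submonoid K G"
    by unfold_locales (auto simp: K_def inv_mult_group)
  have FM: "F \<subseteq> M" "F \<subseteq> K"
    using M(2) FG H.m_inv_closed by (auto simp: K_def intro: generate.incl)
  have good: "\<one> \<notin> semigroup_generated G F"
    using semigroup_generated_least[OF F(2) PD(3)] PD(2) by blast
  have "\<not> (g \<in> M \<and> inv g \<in> M)"
  proof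
    assume "g \<in> M \<and> inv g \<in> M"
    then have "X \<subseteq> M \<inter> K" using FM gG unfolding X_def K_def by auto
    moreover have "subgroup (M \<inter> K) G"
      by unfold_locales (auto simp: K_def inv_mult_group)
    ultimately have "generate G X \<subseteq> M \<inter> K" by (rule generate_subgroup_incl)
    then show False using M(3,4) by blast
  qed
  then consider "inv g \<in> M" "g \<notin> M" | "g \<in> M" "inv g \<notin> M" using M(5)[OF gX] by blast
  then show False
  proof cases
    case 1
    have "\<one> \<in> semigroup_generated G (insert (inv g) F \<inter> {y. inv y \<in> M})"
      by (rule semigroup_generated_factor[OF M(1) _ dec]) (use FM 1 in auto)
    moreover have "insert (inv g) F \<inter> {y. inv y \<in> M} \<subseteq> F" using 1 gG by auto
    ultimately show False using good semigroup_generated_mono by blast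
  next
    case 2
    have "\<one> \<in> semigroup_generated G (insert (inv g) F \<inter> {y. inv y \<in> K})"
      by (rule semigroup_generated_factor[OF Ksub _ dec]) (use FM 2 gG in \<open>auto simp: K_def\<close>)
    moreover have "insert (inv g) F \<inter> {y. inv y \<in> K} \<subseteq> F" using 2 gG by (auto simp: K_def)
    ultimately show False using good semigroup_generated_mono by blast
  qed
qed

text \<open>The total submonoid \<open>M\<close> splits the
  group generated by \<open>F\<close> into the part \<open>K\<close> of units, where fewer elements of \<open>F\<close> decide, and an
  ordered abelian quotient. A commensurable normal subgroup meeting the center is central, so the
  group is abelian.\<close>

lemma commensurable_if_isolated:
  assumes tf: "torsion_free G" and np: "nilpotent G" and P: "is_positive_cone G P"
    and F: "finite F" "F \<subseteq> P \<inter> L" and L: "subgroup L G"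
    and dec: "\<And>x. x \<in> P \<inter> L \<Longrightarrow> \<one> \<in> semigroup_generated G (insert (inv x) F)"
  shows "commensurable G L"
  using F L dec
proof (induction "card F" arbitrary: F L rule: less_induct)
  case less
  note F = less.prems(1,2) and L = less.prems(3) and dec = less.prems(4)
  note PD = is_positive_coneD[OF P]
  interpret L: subgroup L G by fact
  have FG: "F \<subseteq> carrier G" and FP: "F \<subseteq> P" using F PD(1) by auto
  have good: "\<one> \<notin> semigroup_generated G F"
    using semigroup_generated_least[OF FP PD(3)] PD(2) by blast
  define H where "H = generate G F"
  have Hsub: "subgroup H G" unfolding H_def by (rule generate_is_subgroup[OF FG])
  interpret H: subgroup H G by fact
  have HL: "H \<subseteq> L" unfolding H_def by (rule generate_subgroup_incl[OF _ L]) (use F in auto)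
  have FH: "F \<subseteq> H" unfolding H_def by (auto intro: generate.incl)
  interpret HG: group "G\<lparr>carrier := H\<rparr>" using Hsub subgroup_imp_group by blast
  have invH: "inv\<^bsub>G\<lparr>carrier := H\<rparr>\<^esub> x = inv x" if "x \<in> H" for x using m_inv_consistent[OF Hsub that] .
  \<comment> \<open>\<open>L\<close> need not be finitely generated, so the argument takes place in
    \<open>H\<close>; roots lead back to \<open>L\<close> at the end.\<close>
  have "commensurable G H"
  proof (cases "F = {}")
    case True
    then have "H = {\<one>}" unfolding H_def using generate_empty by simp
    then show ?thesis unfolding commensurable_def by auto
  next
    case False
    then obtain f where f: "f \<in> F" by blast
    have fG: "f \<in> carrier G" using f FG by auto
    define S where "S = insert \<one> (semigroup_generated G F)"
    have Ssub: "submonoid S G" unfolding S_def by (rule submonoid_insert_semigroup_generated[OF FG])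
    have SH: "S \<subseteq> generate G F"
      unfolding S_def using semigroup_generated_in_generate[OF FG] by (auto intro: generate.one)
    \<comment> \<open>A power of \<open>inv f\<close> that is a product of elements of
      \<open>F\<close> would cancel against the same power of \<open>f\<close>. So
      \<open>inv f\<close> can serve as the element whose powers avoid \<open>S\<close>, which
      yields a proper \<open>M\<close>.\<close>
    have fS: "inv f [^] n \<notin> S" if n: "0 < n" for n :: nat
    proof
      assume "inv f [^] n \<in> S"
      moreover have "f \<noteq> \<one>" using f FP PD(2) by auto
      then have "inv f [^] n \<noteq> \<one>" using tf n fG unfolding torsion_free_def by auto
      ultimately have "inv f [^] n \<in> semigroup_generated G F" unfolding S_def by simp
      moreover have "f [^] n \<in> semigroup_generated G F"
        using f n by (intro semigroup_generated_pow[OF FG]) (auto intro: semigroup_generated.incl)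
      ultimately have "f [^] n \<otimes> inv f [^] n \<in> semigroup_generated G F" by (intro semigroup_generated.mult)
      then show False using good fG by (simp add: nat_pow_inv)
    qed
    have ifH: "inv f \<in> generate G F" using H.m_inv_closed f FH unfolding H_def by auto
    obtain M where M: "submonoid M G" "S \<subseteq> M" "M \<subseteq> H" "M \<noteq> H"
      "\<And>x. x \<in> H \<Longrightarrow> x \<in> M \<or> inv x \<in> M" "\<And>x y. x \<in> H \<Longrightarrow> y \<in> H \<Longrightarrow> comm x y \<in> M"
      using total_submonoid_of_generate[OF FG F(1) np Ssub SH ifH fS] unfolding H_def by metis
    interpret M: submonoid M G by fact
    define K where "K = {x \<in> M. inv x \<in> M}"
    have KM: "K \<subseteq> M" unfolding K_def by auto
    have Ksub: "subgroup K G" unfolding K_def by unfold_locales (auto simp: inv_mult_group)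
    interpret K: subgroup K G by fact
    have KH: "K \<subseteq> H" using KM M(3) by auto
    have FM: "F \<subseteq> M" using M(2) unfolding S_def by (auto intro: semigroup_generated.incl)
    \<comment> \<open>The inverse of a commutator is a commutator, so commutators are units of
      \<open>M\<close>.\<close>
    have commK: "comm x y \<in> K" if "x \<in> H" "y \<in> H" for x y
      using M(6)[OF that] M(6)[OF that(2,1)] comm_swap[of x y] that unfolding K_def by auto
    have FK: "F \<inter> K \<noteq> F"
    proof
      assume "F \<inter> K = F"
      then have "generate G F \<subseteq> K" by (intro generate_subgroup_incl[OF _ Ksub]) auto
      then show False using M(3,4) KM unfolding H_def by blast
    qed
    have comK: "commensurable G K"
    proof (rule less.hyps[OF _ _ _ Ksub])
      show "card (F \<inter> K) < card F" using F(1) FK by (intro psubset_card_mono) auto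
      show "finite (F \<inter> K)" "F \<inter> K \<subseteq> P \<inter> K" using F FP by auto
      fix x assume x: "x \<in> P \<inter> K"
      \<comment> \<open>The relation that decides \<open>x\<close> involves only units of
        \<open>M\<close>, so \<open>F \<inter> K\<close> decides all positive elements of
        \<open>K\<close>.\<close>
      then have "\<one> \<in> semigroup_generated G (insert (inv x) F)" using dec KH HL by auto
      then have "\<one> \<in> semigroup_generated G (insert (inv x) F \<inter> {y. inv y \<in> M})"
        by (intro semigroup_generated_factor[OF M(1)]) (use FM x KM K.m_inv_closed in auto)
      moreover have "insert (inv x) F \<inter> {y. inv y \<in> M} \<subseteq> insert (inv x) (F \<inter> K)"
        using FM unfolding K_def by auto
      ultimately show "\<one> \<in> semigroup_generated G (insert (inv x) (F \<inter> K))"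
        using semigroup_generated_mono by blast
    qed
    have Knormal: "K \<lhd> G\<lparr>carrier := H\<rparr>"
    proof (rule HG.normal_invI)
      show "subgroup K (G\<lparr>carrier := H\<rparr>)" using Ksub KH Hsub by (simp add: subgroup_incl)
      show "x \<otimes>\<^bsub>G\<lparr>carrier := H\<rparr>\<^esub> k \<otimes>\<^bsub>G\<lparr>carrier := H\<rparr>\<^esub> inv\<^bsub>G\<lparr>carrier := H\<rparr>\<^esub> x \<in> K"
        if "x \<in> carrier (G\<lparr>carrier := H\<rparr>)" "k \<in> K" for x k
      proof -
        have xk: "x \<in> H" "k \<in> H" using that KH by auto
        have "comm x k \<otimes> k \<in> K" using commK[OF xk] that by simp
        then show ?thesis using xk by (simp add: invH group_word_simps)
      qed
    qed
    interpret K: normal K "G\<lparr>carrier := H\<rparr>" by fact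
    define Q where "Q = G\<lparr>carrier := H\<rparr> Mod K"
    define \<pi> where "\<pi> x = K #>\<^bsub>G\<lparr>carrier := H\<rparr>\<^esub> x" for x
    interpret Q0: group Q unfolding Q_def by (rule K.factorgroup_is_group)
    have hom: "\<pi> \<in> hom (G\<lparr>carrier := H\<rparr>) Q" unfolding \<pi>_def[abs_def] Q_def by (rule K.r_coset_hom_Mod)
    interpret \<pi>: group_hom "G\<lparr>carrier := H\<rparr>" Q \<pi> by unfold_locales (rule hom)
    have surj: "\<exists>x\<in>H. q = \<pi> x" if "q \<in> carrier Q" for q
      using that unfolding Q_def \<pi>_def FactGroup_def RCOSETS_def by auto
    have ker: "\<pi> x = \<one>\<^bsub>Q\<^esub> \<longleftrightarrow> x \<in> K" if "x \<in> H" for x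
      unfolding \<pi>_def Q_def
      using that HG.coset_join1[of K x] HG.coset_join2[of x K] K.subset K.subgroup_axioms by auto
    have \<pi>Q: "\<pi> x \<in> carrier Q" if "x \<in> H" for x using \<pi>.hom_closed that by simp
    have \<pi>m: "\<pi> (x \<otimes> y) = \<pi> x \<otimes>\<^bsub>Q\<^esub> \<pi> y" if "x \<in> H" "y \<in> H" for x y using \<pi>.hom_mult that by simp
    have \<pi>i: "\<pi> (inv x) = inv\<^bsub>Q\<^esub> \<pi> x" if "x \<in> H" for x using \<pi>.hom_inv[of x] that by (simp add: invH)
    have \<pi>p: "\<pi> (x [^] n) = \<pi> x [^]\<^bsub>Q\<^esub> n" if "x \<in> H" for x and n :: nat
      using \<pi>.hom_nat_pow[of x n] that nat_pow_consistent[of x n H] by simp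
    have \<pi>ip: "\<pi> (x [^] n) = \<pi> x [^]\<^bsub>Q\<^esub> n" if "x \<in> H" for x and n :: int
      using \<pi>.hom_int_pow[of x n] that int_pow_consistent[OF Hsub that, of n] by simp
    interpret Q: comm_group Q
    proof (rule Q0.group_comm_groupI)
      fix p q assume "p \<in> carrier Q" "q \<in> carrier Q"
      then obtain x y where xy: "x \<in> H" "y \<in> H" "p = \<pi> x" "q = \<pi> y" using surj by metis
      have c: "comm x y \<in> H" using commK[OF xy(1,2)] KH by blast
      have "\<pi> (comm x y) = \<one>\<^bsub>Q\<^esub>" using ker[OF c] commK[OF xy(1,2)] by blast
      then have "\<pi> (comm x y \<otimes> (y \<otimes> x)) = \<pi> (y \<otimes> x)"
        using \<pi>m[OF c, of "y \<otimes> x"] \<pi>Q[of "y \<otimes> x"] xy by simp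
      moreover have "comm x y \<otimes> (y \<otimes> x) = x \<otimes> y" using xy by (simp add: group_word_simps)
      ultimately show "p \<otimes>\<^bsub>Q\<^esub> q = q \<otimes>\<^bsub>Q\<^esub> p" using xy \<pi>m by simp
    qed
    \<comment> \<open>Non-units of \<open>M\<close> are positive: were \<open>inv x\<close>
      positive, the relation deciding it would lose its non-unit factor \<open>x\<close> and become
      a relation in \<open>F\<close> alone. So the image of \<open>F\<close> decides the positive
      elements of the quotient.\<close>
    have MP: "x \<in> P \<and> x \<in> L" if x: "x \<in> M" "x \<notin> K" for x
    proof -
      have xH: "x \<in> H" and xG: "x \<in> carrier G" and xL: "x \<in> L" using x M(3) HL by auto
      have "x \<noteq> \<one>" using x by auto
      moreover have "inv x \<notin> P"
      proof
        assume "inv x \<in> P"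
        then have "\<one> \<in> semigroup_generated G (insert x F)" using dec[of "inv x"] xL xG by simp
        then have "\<one> \<in> semigroup_generated G (insert x F \<inter> {y. inv y \<in> M})"
          by (intro semigroup_generated_factor[OF M(1)]) (use FM x in auto)
        moreover have "insert x F \<inter> {y. inv y \<in> M} \<subseteq> F" using x unfolding K_def by auto
        ultimately show False using good semigroup_generated_mono by blast
      qed
      ultimately show ?thesis using PD(4)[OF xG] xL by auto
    qed
    define PQ where "PQ = \<pi> ` (M - K)"
    have PQ: "is_positive_cone Q PQ" unfolding is_positive_cone_def
    proof (intro conjI ballI impI)
      show "PQ \<subseteq> carrier Q" unfolding PQ_def using M(3) \<pi>Q by auto
      show "\<one>\<^bsub>Q\<^esub> \<notin> PQ"
      proof
        assume "\<one>\<^bsub>Q\<^esub> \<in> PQ"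
        then obtain x where "x \<in> M" "x \<notin> K" "\<pi> x = \<one>\<^bsub>Q\<^esub>" unfolding PQ_def by force
        then show False using ker M(3) by auto
      qed
    next
      fix p q assume "p \<in> PQ" "q \<in> PQ"
      then obtain x y where xy: "x \<in> M" "x \<notin> K" "p = \<pi> x" "y \<in> M" "y \<notin> K" "q = \<pi> y"
        unfolding PQ_def by blast
      have "x \<otimes> y \<notin> K"
      proof
        assume "x \<otimes> y \<in> K"
        then have "y \<otimes> inv (x \<otimes> y) \<in> M" using xy unfolding K_def by auto
        moreover have "y \<otimes> inv (x \<otimes> y) = inv x" using xy by (simp add: group_word_simps)
        ultimately show False using xy unfolding K_def by auto
      qed
      then have "x \<otimes> y \<in> M - K" using xy by auto
      moreover have "p \<otimes>\<^bsub>Q\<^esub> q = \<pi> (x \<otimes> y)" using \<pi>m xy M(3) by auto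
      ultimately show "p \<otimes>\<^bsub>Q\<^esub> q \<in> PQ" unfolding PQ_def by blast
    next
      fix q assume "q \<in> carrier Q" "q \<noteq> \<one>\<^bsub>Q\<^esub>"
      then obtain x where x: "x \<in> H" "q = \<pi> x" "x \<notin> K" using surj ker by metis
      have "inv x \<notin> K" using x K.m_inv_closed[of "inv x"] Ksub subgroup.m_inv_closed[OF Ksub, of "inv x"] by auto
      then have "x \<in> M - K \<or> inv x \<in> M - K" using M(5)[OF x(1)] x(3) by auto
      then show "q \<in> PQ \<or> inv\<^bsub>Q\<^esub> q \<in> PQ" unfolding PQ_def x(2) \<pi>i[OF x(1), symmetric] by blast
    qed
    have comQ: "commensurable Q (carrier Q)"
    proof (rule Q.commensurable_if_finitely_generated_cone[OF PQ, of "\<pi> ` F - {\<one>\<^bsub>Q\<^esub>}"])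
      show "finite (\<pi> ` F - {\<one>\<^bsub>Q\<^esub>})" using F(1) by simp
      show "\<pi> ` F - {\<one>\<^bsub>Q\<^esub>} \<subseteq> PQ" unfolding PQ_def using FM FH ker by auto
      fix q assume q: "q \<in> PQ"
      then obtain x where x: "x \<in> M" "x \<notin> K" "q = \<pi> x" unfolding PQ_def by blast
      have xH: "x \<in> H" using x M(3) by auto
      have "\<exists>n>0::nat. \<pi> x [^]\<^bsub>Q\<^esub> n \<in> insert \<one>\<^bsub>Q\<^esub> (semigroup_generated Q (\<pi> ` F - {\<one>\<^bsub>Q\<^esub>}))"
        using decided_power[OF Q.comm_group_axioms hom Hsub FH xH _ good] dec[of x] MP[OF x(1,2)] by blast
      then obtain n :: nat where n: "0 < n"
        "\<pi> x [^]\<^bsub>Q\<^esub> n \<in> insert \<one>\<^bsub>Q\<^esub> (semigroup_generated Q (\<pi> ` F - {\<one>\<^bsub>Q\<^esub>}))" by blast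
      then show "\<exists>n>0::nat. q [^]\<^bsub>Q\<^esub> n \<in> semigroup_generated Q (\<pi> ` F - {\<one>\<^bsub>Q\<^esub>})"
        using Q0.positive_cone_pow[OF PQ q n(1)] is_positive_coneD(2)[OF PQ] x(3) by (intro exI[of _ n]) auto
    qed
    have abelian: "x \<otimes> y = y \<otimes> x" if x: "x \<in> H" and y: "y \<in> H" for x y
    proof (rule ccontr)
      assume nc: "x \<otimes> y \<noteq> y \<otimes> x"
      note lower_central.simps(2) [simp del]
      \<comment> \<open>The last nontrivial term of the lower central series of \<open>H\<close> is
        central. As \<open>H\<close> is assumed non-abelian, this term lies in the commutator
        subgroup, hence in \<open>K\<close>, and supplies the central element \<open>z\<close> of
        \<open>K\<close>.\<close>
      obtain n where n: "lower_central (G\<lparr>carrier := H\<rparr>) n = {\<one>}" "\<And>m. m < n \<Longrightarrow> lower_central (G\<lparr>carrier := H\<rparr>) m \<noteq> {\<one>}"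
        using nilpotent_subgroup[OF np Hsub] exists_least_iff[of "\<lambda>n. lower_central (G\<lparr>carrier := H\<rparr>) n = {\<one>}"]
        unfolding nilpotent_def by auto
      have comm1: "comm u v \<in> lower_central (G\<lparr>carrier := H\<rparr>) (Suc m)"
        if "u \<in> lower_central (G\<lparr>carrier := H\<rparr>) m" "v \<in> H" for u v m
        using HG.comm_in_lower_central[OF that(1), of v] HG.lower_central_carrier[OF that(1)] that(2) invH by simp
      have L1K: "lower_central (G\<lparr>carrier := H\<rparr>) (Suc 0) \<subseteq> K"
      proof -
        have "x \<otimes>\<^bsub>G\<lparr>carrier := H\<rparr>\<^esub> y \<otimes>\<^bsub>G\<lparr>carrier := H\<rparr>\<^esub> inv\<^bsub>G\<lparr>carrier := H\<rparr>\<^esub> x \<otimes>\<^bsub>G\<lparr>carrier := H\<rparr>\<^esub> inv\<^bsub>G\<lparr>carrier := H\<rparr>\<^esub> y \<in> K"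
          if "x \<in> H" "y \<in> H" for x y
          using commK[OF that] invH that by simp
        then show ?thesis unfolding lower_central.simps(2)
          by (intro HG.generate_subgroup_incl[OF _ K.subgroup_axioms]) auto
      qed
      have "comm x y \<noteq> \<one>"
      proof
        assume "comm x y = \<one>"
        then have "comm x y \<otimes> (y \<otimes> x) = y \<otimes> x" using x y by simp
        then show False using nc x y by (simp add: group_word_simps)
      qed
      moreover have "comm x y \<in> lower_central (G\<lparr>carrier := H\<rparr>) (Suc 0)" using comm1[of x 0 y] x y by simp
      ultimately have "n \<noteq> Suc 0" using n(1) by auto
      moreover have "n \<noteq> 0" using n(1) x y nc by (cases n) auto
      ultimately obtain k where k: "n = Suc (Suc k)" by (metis not0_implies_Suc)
      have "\<one> \<in> lower_central (G\<lparr>carrier := H\<rparr>) (Suc k)"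
        using subgroup.one_closed[OF HG.lower_central_subgroup[of "Suc k"]] by simp
      then obtain z where z: "z \<in> lower_central (G\<lparr>carrier := H\<rparr>) (Suc k)" "z \<noteq> \<one>"
        using n(2)[of "Suc k"] k by blast
      have zK: "z \<in> K" using z(1) L1K HG.lower_central_antimono[of "Suc 0" "Suc k"] by auto
      have zcen: "z \<otimes> h = h \<otimes> z" if h: "h \<in> H" for h
      proof -
        have "comm z h = \<one>" using comm1[OF z(1) h] n(1) k by auto
        then have "comm z h \<otimes> (h \<otimes> z) = h \<otimes> z" using h zK KH by auto
        moreover have "comm z h \<otimes> (h \<otimes> z) = z \<otimes> h" using h zK KH by (auto simp: group_word_simps)
        ultimately show ?thesis by simp
      qed
      \<comment> \<open>A power of \<open>k\<close> is a power of the central element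
        \<open>z\<close>, so \<open>k\<close> commutes with all of \<open>H\<close> by
        \<open>commute_if_power_commute\<close>.\<close>
      have Kcen: "k \<otimes> h = h \<otimes> k" if k: "k \<in> K" and h: "h \<in> H" for k h
      proof -
        have G: "k \<in> carrier G" "h \<in> carrier G" "z \<in> carrier G" using k h KH zK by auto
        obtain m :: nat and n :: int where m: "0 < m" "k [^] m = z [^] n"
          using commensurableD[OF comK k zK z(2)] by blast
        have zi: "z [^] (i::nat) \<otimes> h = h \<otimes> z [^] i" for i using group_commutes_pow[OF zcen[OF h] G(3,2)] .
        have "z [^] n \<otimes> h = h \<otimes> z [^] n"
        proof (cases "n \<ge> 0")
          case True
          then show ?thesis using zi[of "nat n"] by (simp flip: int_pow_int)
        next
          case False
          define w where "w = z [^] nat (- n)"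
          have "z [^] n = inv w"
            unfolding w_def using G False int_pow_neg[of z "- n"] by (simp flip: int_pow_int)
          then have w: "w \<in> carrier G" "w \<otimes> h = h \<otimes> w" "z [^] n = inv w"
            unfolding w_def using G zi by auto
          have "inv w \<otimes> h = inv w \<otimes> (h \<otimes> w) \<otimes> inv w" using w(1) G by (simp add: group_word_simps)
          also have "\<dots> = inv w \<otimes> (w \<otimes> h) \<otimes> inv w" using w(2) by simp
          also have "\<dots> = h \<otimes> inv w" using w(1) G by (simp add: group_word_simps)
          finally show ?thesis unfolding w(3) .
        qed
        then show ?thesis using commute_if_power_commute[OF tf np G(1,2) m(1)] m(2) by simp
      qed
      \<comment> \<open>By commensurability in the quotient, \<open>x [^] m\<close> is a power of
        \<open>y\<close> up to a factor in the central subgroup \<open>K\<close>. So it commutes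
        with \<open>y\<close>, and then so does \<open>x\<close>.\<close>
      have "y \<notin> K" using Kcen[of y x] x nc by auto
      then have "\<pi> y \<noteq> \<one>\<^bsub>Q\<^esub>" using ker[OF y] by simp
      then obtain m :: nat and n :: int where m: "0 < m" "\<pi> x [^]\<^bsub>Q\<^esub> m = \<pi> y [^]\<^bsub>Q\<^esub> n"
        using commensurableD[OF comQ \<pi>Q[OF x] \<pi>Q[OF y]] by blast
      have pw: "x [^] m \<in> H" "y [^] n \<in> H"
        using x y by (auto simp: subgroup_int_pow_closed[OF Hsub] submonoid_pow[OF H.subgroup_is_submonoid])
      define k where "k = x [^] m \<otimes> inv (y [^] n)"
      have "\<pi> k = \<one>\<^bsub>Q\<^esub>"
        unfolding k_def using \<pi>m[OF pw(1) H.m_inv_closed[OF pw(2)]] \<pi>i[OF pw(2)] \<pi>p[OF x, of m] \<pi>ip[OF y, of n] m(2) \<pi>Q[OF y]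
        by simp
      moreover have kH: "k \<in> H" unfolding k_def using pw by simp
      ultimately have kK: "k \<in> K" using ker by simp
      have xk: "x [^] m = k \<otimes> y [^] n" unfolding k_def using pw x y by (simp add: m_assoc)
      have yy: "y [^] n \<otimes> y = y \<otimes> y [^] n"
        using y int_pow_mult[of y n 1] int_pow_mult[of y 1 n] by (simp add: add.commute)
      have "x [^] m \<otimes> y = k \<otimes> (y [^] n \<otimes> y)" unfolding xk using kH pw y by (simp add: m_assoc)
      also have "\<dots> = (k \<otimes> y) \<otimes> y [^] n" unfolding yy using kH pw y by (simp add: m_assoc)
      also have "\<dots> = y \<otimes> x [^] m" unfolding Kcen[OF kK y] xk using kH pw y by (simp add: m_assoc)
      finally have "x \<otimes> y = y \<otimes> x"
        by (rule commute_if_power_commute[OF tf np H.mem_carrier[OF x] H.mem_carrier[OF y] m(1)])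
      then show False using nc by simp
    qed
    interpret HC: comm_group "G\<lparr>carrier := H\<rparr>"
      by (rule HG.group_comm_groupI) (use abelian in auto)
    have "commensurable (G\<lparr>carrier := H\<rparr>) (carrier (G\<lparr>carrier := H\<rparr>))"
    proof (rule HC.commensurable_if_finitely_generated_cone)
      show "is_positive_cone (G\<lparr>carrier := H\<rparr>) (P \<inter> H)"
        unfolding is_positive_cone_def using PD invH by auto
      show "finite F" "F \<subseteq> P \<inter> H" using F FP FH by auto
      fix x assume x: "x \<in> P \<inter> H"
      \<comment> \<open>As \<open>H\<close> is now abelian, \<open>decided_power\<close> applies to
        the identity map.\<close>
      have id: "(\<lambda>x. x) \<in> hom (G\<lparr>carrier := H\<rparr>) (G\<lparr>carrier := H\<rparr>)" by (simp add: hom_def)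
      obtain n :: nat where n: "0 < n" "x [^]\<^bsub>G\<lparr>carrier := H\<rparr>\<^esub> n \<in> insert \<one> (semigroup_generated G (F - {\<one>}))"
        using decided_power[OF HC.comm_group_axioms id Hsub FH _ _ good, of x] dec[of x] x HL by auto
      have "x [^] n \<noteq> \<one>" using positive_cone_pow[OF P _ n(1), of x] x PD(2) by auto
      then have "x [^] n \<in> semigroup_generated G F"
        using n(2) semigroup_generated_mono[of "F - {\<one>}" F G] by (auto simp flip: nat_pow_consistent)
      then show "\<exists>n>0::nat. x [^]\<^bsub>G\<lparr>carrier := H\<rparr>\<^esub> n \<in> semigroup_generated (G\<lparr>carrier := H\<rparr>) F"
        using n(1) by (auto simp flip: nat_pow_consistent)
    qed
    then show ?thesis
      unfolding commensurable_def using int_pow_consistent[OF Hsub]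
      by (simp flip: nat_pow_consistent)
  qed
  then show ?case
  proof (rule commensurable_roots[OF L.subset Hsub _ tf])
    fix x assume x: "x \<in> L"
    consider "x = \<one>" | "x \<in> P" | "inv x \<in> P" using PD(4)[of x] L.mem_carrier[OF x] by auto
    then show "\<exists>n>0::nat. x [^] n \<in> H"
    proof cases
      case 1
      then show ?thesis by (intro exI[of _ 1]) simp
    next
      case 2
      then show ?thesis using decided_root[OF np P F(1) FP 2] dec[of x] x unfolding H_def by auto
    next
      case 3
      then obtain n where "0 < (n::nat)" "inv x [^] n \<in> H"
        using decided_root[OF np P F(1) FP 3] dec[of "inv x"] x unfolding H_def by auto
      then show ?thesis using x H.m_inv_closed[of "inv x [^] n"] by (auto simp: nat_pow_inv)
    qed
  qed
qed

lemma positive_cone_not_isolated: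
  assumes tf: "torsion_free G" and np: "nilpotent G" and nt: "carrier G \<noteq> {\<one>}"
    and rank: "\<not> (comm_group G \<and> abelian_rank G = 1)"
    and P: "is_positive_cone G P" and F: "finite F" "F \<subseteq> P"
  obtains P' where "is_positive_cone G P'" "F \<subseteq> P'" "P' \<noteq> P"
proof -
  note PD = is_positive_coneD[OF P]
  have "\<not> commensurable G (carrier G)"
    using rank comm_group_if_commensurable[OF tf np] abelian_rank_eq_1_if_commensurable[OF tf _ _ nt] by blast
  then obtain x where x: "x \<in> P" "\<one> \<notin> semigroup_generated G (insert (inv x) F)"
    using commensurable_if_isolated[OF tf np P F(1) _ subgroup_self] F(2) PD(1) by blast
  have "insert (inv x) F \<subseteq> carrier G" using x F PD(1) by auto
  then obtain P' where P': "is_positive_cone G P'" "insert (inv x) F \<subseteq> P'"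
    using positive_cone_extending[OF tf np _ x(2)] by blast
  have "x \<notin> P'"
  proof
    assume "x \<in> P'"
    then have "x \<otimes> inv x \<in> P'" using P' is_positive_coneD(3)[OF P'(1)] by auto
    then show False using x(1) PD(1) is_positive_coneD(2)[OF P'(1)] by auto
  qed
  then show ?thesis using P' x(1) by (intro that) auto
qed

end

subsection \<open>The Cantor set\<close>

definition ternary :: "(nat \<Rightarrow> bool) \<Rightarrow> real" where
  "ternary b = (\<Sum>n. 2 * of_bool (b n) * (1/3) ^ Suc n)"

lemma ternary_summable: "summable (\<lambda>n. 2 * of_bool (b n) * (1/3::real) ^ Suc n)"
proof (rule summable_comparison_test)
  show "summable (\<lambda>n. 2 * (1/3::real) ^ n)" by (intro summable_mult summable_geometric) simp
  show "\<exists>N. \<forall>n\<ge>N. norm (2 * of_bool (b n) * (1/3::real) ^ Suc n) \<le> 2 * (1/3) ^ n" by auto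
qed

lemma ternary_Suc: "ternary b = (2 * of_bool (b 0) + ternary (\<lambda>n. b (Suc n))) / 3"
proof -
  have "ternary (\<lambda>n. b (Suc n)) = 3 * (\<Sum>n. 2 * of_bool (b (Suc n)) * (1/3) ^ Suc (Suc n))"
    unfolding ternary_def
    using suminf_mult[OF summable_ignore_initial_segment[OF ternary_summable[of b], of 1], of 3]
    by (simp add: mult_ac)
  also have "(\<Sum>n. 2 * of_bool (b (Suc n)) * (1/3::real) ^ Suc (Suc n)) = ternary b - 2 * of_bool (b 0) / 3"
    unfolding ternary_def using suminf_split_head[OF ternary_summable[of b]] by simp
  finally show ?thesis by simp
qed

lemma ternary_bounds: "0 \<le> ternary b" "ternary b \<le> 1"
proof -
  show "0 \<le> ternary b" unfolding ternary_def by (intro suminf_nonneg ternary_summable) auto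
  have g: "(\<lambda>n. (2/3) * (1/3::real) ^ n) sums ((2/3) * (1 / (1 - 1/3)))"
    by (intro sums_mult geometric_sums) simp
  have "ternary b \<le> (\<Sum>n. (2/3) * (1/3::real) ^ n)"
    unfolding ternary_def by (intro suminf_le ternary_summable) (use g in \<open>auto simp: sums_iff\<close>)
  then show "ternary b \<le> 1" using g by (simp add: sums_iff)
qed

lemma ternary_close:
  "(\<And>i. i < n \<Longrightarrow> b i = c i) \<Longrightarrow> \<bar>ternary b - ternary c\<bar> \<le> (1/3) ^ n"
proof (induction n arbitrary: b c)
  case 0
  then show ?case using ternary_bounds[of b] ternary_bounds[of c] by auto
next
  case (Suc n)
  then have "\<bar>ternary (\<lambda>n. b (Suc n)) - ternary (\<lambda>n. c (Suc n))\<bar> \<le> (1/3) ^ n" by auto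
  moreover have "b 0 = c 0" using Suc.prems[of 0] by simp
  ultimately show ?case unfolding ternary_Suc[of b] ternary_Suc[of c] by (simp add: field_simps abs_le_iff)
qed

text \<open>The tail contributes at most \<open>1/3\<close> and a leading digit 2 contributes
  \<open>2/3\<close>, so the leading digit can be read off.\<close>

lemma ternary_inj: "ternary b = ternary c \<Longrightarrow> b = c"
proof
  fix n assume "ternary b = ternary c"
  then show "b n = c n"
  proof (induction n arbitrary: b c)
    case 0
    then show ?case
      using ternary_Suc[of b] ternary_Suc[of c] ternary_bounds[of "\<lambda>n. b (Suc n)"] ternary_bounds[of "\<lambda>n. c (Suc n)"]
      by (cases "b 0"; cases "c 0") auto
  next
    case (Suc n)
    have "b 0 = c 0"
      using Suc.prems ternary_Suc[of b] ternary_Suc[of c] ternary_bounds[of "\<lambda>n. b (Suc n)"] ternary_bounds[of "\<lambda>n. c (Suc n)"]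
      by (cases "b 0"; cases "c 0") auto
    then have "ternary (\<lambda>n. b (Suc n)) = ternary (\<lambda>n. c (Suc n))"
      using Suc.prems ternary_Suc[of b] ternary_Suc[of c] by simp
    then show ?case by (rule Suc.IH)
  qed
qed

lemma cantor_stage_bounds: "x \<in> cantor_stage n \<Longrightarrow> 0 \<le> x \<and> x \<le> 1"
  by (induction n arbitrary: x) force+

lemma ternary_in_cantor_stage: "ternary b \<in> cantor_stage n"
proof (induction n arbitrary: b)
  case 0
  then show ?case using ternary_bounds by simp
next
  case (Suc n)
  show ?case
    using Suc[of "\<lambda>n. b (Suc n)"] ternary_Suc[of b] by (cases "b 0") (auto simp: add.commute)
qed

lemma cantor_set_eq_range_ternary: "cantor_set = range ternary"
proof
  show "range ternary \<subseteq> cantor_set" unfolding cantor_set_def using ternary_in_cantor_stage by auto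
  \<comment> \<open>\<open>T\<close> inverts the two contractions of \<open>cantor_stage\<close>;
    the threshold \<open>1/2\<close> lies in the removed middle third. The digits of
    \<open>x\<close> are read off its orbit under \<open>T\<close>.\<close>
  define T :: "real \<Rightarrow> real" where "T x = (if x \<le> 1/2 then 3 * x else 3 * x - 2)" for x
  have T: "T x \<in> cantor_set" if "x \<in> cantor_set" for x unfolding cantor_set_def
  proof
    fix n
    have "x \<in> cantor_stage (Suc n)" using that unfolding cantor_set_def by blast
    then obtain y where "y \<in> cantor_stage n" "x = y / 3 \<or> x = (y + 2) / 3" by auto
    moreover from this have "T x = y" unfolding T_def using cantor_stage_bounds[of y n] by auto
    ultimately show "T x \<in> cantor_stage n" by simp
  qed
  show "cantor_set \<subseteq> range ternary"
  proof
    fix x assume x: "x \<in> cantor_set"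
    define b where "b x n = (1/2 < (T ^^ n) x)" for x n
    \<comment> \<open>The leading digits of \<open>x\<close> and \<open>b x\<close> agree, so the
      difference is a third of the one for \<open>T x\<close>.\<close>
    have b: "\<bar>x - ternary (b x)\<bar> \<le> (1/3) ^ n" if "x \<in> cantor_set" for x n
      using that
    proof (induction n arbitrary: x)
      case 0
      then have "x \<in> cantor_stage 0" unfolding cantor_set_def by blast
      then show ?case using ternary_bounds[of "b x"] by auto
    next
      case (Suc n)
      have "(\<lambda>n. b x (Suc n)) = b (T x)" unfolding b_def by (simp add: funpow_swap1)
      then have "ternary (b x) = (2 * of_bool (1/2 < x) + ternary (b (T x))) / 3"
        using ternary_Suc[of "b x"] by (simp add: b_def)
      moreover have "x = (2 * of_bool (1/2 < x) + T x) / 3" unfolding T_def by auto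
      ultimately have eq: "x - ternary (b x) = (T x - ternary (b (T x))) / 3" by (simp add: field_simps)
      show ?case unfolding eq abs_divide using Suc.IH[OF T[OF Suc.prems]] by simp
    qed
    have "x = ternary (b x)"
    proof (rule ccontr)
      assume "x \<noteq> ternary (b x)"
      then have "0 < \<bar>x - ternary (b x)\<bar>" by simp
      then obtain n where "(1/3::real) ^ n < \<bar>x - ternary (b x)\<bar>"
        using real_arch_pow_inv[of "\<bar>x - ternary (b x)\<bar>" "1/3"] by auto
      then show False using b[OF x, of n] by simp
    qed
    then show "x \<in> range ternary" by blast
  qed
qed

section \<open>Compact spaces homeomorphic to the Cantor set\<close>

text \<open>A nonempty clopen set is cut by the first \<open>U n\<close> that splits it. Along a branch of the resulting
  binary tree the cutting indices increase, so a branch cannot contain two points separated by some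
  \<open>U m\<close>.\<close>

lemma homeomorphic_cantor_set:
  fixes X :: "'a topology" and U :: "nat \<Rightarrow> 'a set"
  assumes compact: "compact_space X" and ne: "topspace X \<noteq> {}"
    and Uo: "\<And>n. openin X (U n)" and Uc: "\<And>n. closedin X (U n)"
    and sep: "\<And>x y. x \<in> topspace X \<Longrightarrow> y \<in> topspace X \<Longrightarrow> x \<noteq> y \<Longrightarrow> \<exists>n. (x \<in> U n) \<noteq> (y \<in> U n)"
    and iso: "\<And>x. x \<in> topspace X \<Longrightarrow> \<not> openin X {x}"
  shows "X homeomorphic_space top_of_set cantor_set"
proof -
  define cuts where "cuts A n \<longleftrightarrow> A \<inter> U n \<noteq> {} \<and> A - U n \<noteq> {}" for A n
  define idx where "idx A = (LEAST n. cuts A n)" for A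
  define part where "part c A = (if c then A \<inter> U (idx A) else A - U (idx A))" for c A
  \<comment> \<open>\<open>B b\<close> follows the prescribed branch \<open>b\<close> of the tree,
    \<open>A x\<close> the branch of the point \<open>x\<close>, whose turns are recorded by
    \<open>d x\<close>.\<close>
  define B where "B b = rec_nat (topspace X) (\<lambda>n. part (b n))" for b
  define A where "A x = rec_nat (topspace X) (\<lambda>n C. part (x \<in> U (idx C)) C)" for x
  define d where "d x n = (x \<in> U (idx (A x n)))" for x n
  have B0: "B b 0 = topspace X" and BS: "B b (Suc n) = part (b n) (B b n)" for b n
    unfolding B_def by simp_all
  have A0: "A x 0 = topspace X" and AS: "A x (Suc n) = part (d x n) (A x n)" for x n
    unfolding A_def d_def by simp_all
  have AB: "A x n = B (d x) n" for x n by (induction n) (simp_all add: A0 AS B0 BS)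
  \<comment> \<open>A nonempty open set has two points because no point is isolated, and some
    \<open>U n\<close> separates them.\<close>
  have cut: "cuts C (idx C)" if C: "openin X C" "C \<noteq> {}" for C
  proof -
    obtain x where x: "x \<in> C" using C by blast
    have xX: "C \<subseteq> topspace X" using C openin_subset by blast
    then have "C \<noteq> {x}" using iso[of x] C x by auto
    then obtain y where y: "y \<in> C" "y \<noteq> x" using x by blast
    then obtain n where "(x \<in> U n) \<noteq> (y \<in> U n)" using sep[of x y] x xX by auto
    then have "cuts C n" unfolding cuts_def using x y by blast
    then show ?thesis unfolding idx_def by (rule LeastI)
  qed
  have Bprops: "openin X (B b n) \<and> closedin X (B b n) \<and> B b n \<noteq> {}" for b n
  proof (induction n)
    case 0
    then show ?case using ne by (simp add: B0)
  next
    case (Suc n)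
    then show ?case using cut[of "B b n"] Uo[of "idx (B b n)"] Uc[of "idx (B b n)"] unfolding BS part_def cuts_def
      by auto
  qed
  have Bdec: "B b (Suc n) \<subseteq> B b n" for b n unfolding BS part_def by auto
  have xA: "x \<in> A x n" if "x \<in> topspace X" for x n
    by (induction n) (use that in \<open>auto simp: A0 AS part_def d_def\<close>)
  have Aeq: "A y n = A x n \<and> (\<forall>i<n. d y i = d x i)" if "y \<in> A x n" for x y n
    using that
  proof (induction n)
    case (Suc n)
    then have "y \<in> A x n" unfolding AS part_def by (auto split: if_splits)
    then have IH: "A y n = A x n" "\<forall>i<n. d y i = d x i" using Suc.IH by auto
    have "d y n = d x n" using Suc.prems unfolding d_def[of y] IH(1) AS part_def by (auto split: if_splits)
    then show ?case using IH by (auto simp: AS less_Suc_eq)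
  qed (simp add: A0)
  define f where "f x = ternary (d x)" for x
  have cont: "continuous_map X euclideanreal f"
    unfolding continuous_map
  proof (intro conjI allI impI)
    show "f ` topspace X \<subseteq> topspace euclideanreal" by simp
    fix S :: "real set" assume S: "openin euclideanreal S"
    show "openin X {x \<in> topspace X. f x \<in> S}"
    proof (subst openin_subopen, intro ballI)
      fix x assume x: "x \<in> {x \<in> topspace X. f x \<in> S}"
      then obtain e where e: "e > 0" "ball (f x) e \<subseteq> S" using S by (auto simp: open_contains_ball)
      obtain n where n: "(1/3::real) ^ n < e" using real_arch_pow_inv[OF e(1), of "1/3"] by auto
      show "\<exists>T. openin X T \<and> x \<in> T \<and> T \<subseteq> {x \<in> topspace X. f x \<in> S}"
      proof (intro exI conjI subsetI)
        show o: "openin X (A x n)" unfolding AB using Bprops by blast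
        show "x \<in> A x n" using x xA by simp
        fix y assume y: "y \<in> A x n"
        have "\<bar>f y - f x\<bar> \<le> (1/3) ^ n" unfolding f_def using Aeq[OF y] by (intro ternary_close) auto
        then have "f y \<in> ball (f x) e" using n by (simp add: dist_real_def abs_minus_commute)
        then show "y \<in> {x \<in> topspace X. f x \<in> S}" using y e(2) openin_subset[OF o] by auto
      qed
    qed
  qed
  have inj: "inj_on f (topspace X)"
  proof (rule inj_onI, rule ccontr)
    fix x y assume x: "x \<in> topspace X" and y: "y \<in> topspace X" and "f x = f y" and "x \<noteq> y"
    then have d: "d x = d y" unfolding f_def using ternary_inj by blast
    define C where "C n = A x n" for n
    have xC: "x \<in> C n" "y \<in> C n" for n using xA[OF x, of n] xA[OF y, of n] d by (simp_all add: C_def AB)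
    have CS: "C (Suc n) = part (d x n) (C n)" for n unfolding C_def AS ..
    have cutC: "cuts (C n) (idx (C n))" for n unfolding C_def AB using cut Bprops by blast
    \<comment> \<open>Whatever cuts a child also cuts its parent, but the index that produced the
      child no longer cuts it. So the least cutting index increases.\<close>
    have "idx (C n) < idx (C (Suc n))" for n
    proof -
      have "cuts (C n) (idx (C (Suc n)))"
        using cutC[of "Suc n"] unfolding CS[of n] part_def cuts_def by (auto split: if_splits)
      then have "idx (C n) \<le> idx (C (Suc n))" unfolding idx_def[of "C n"] by (rule Least_le)
      moreover have "\<not> cuts (C (Suc n)) (idx (C n))" unfolding CS part_def cuts_def by auto
      then have "idx (C n) \<noteq> idx (C (Suc n))" using cutC[of "Suc n"] by auto
      ultimately show ?thesis by simp
    qed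
    then have sm: "strict_mono (\<lambda>n. idx (C n))" by (simp add: strict_mono_Suc_iff)
    obtain m where "(x \<in> U m) \<noteq> (y \<in> U m)" using sep[OF x y \<open>x \<noteq> y\<close>] by blast
    \<comment> \<open>\<open>U m\<close> cuts every set of the branch, so the cutting index at depth
      \<open>Suc m\<close> is at most \<open>m\<close>; by strict monotonicity it is at least
      \<open>Suc m\<close>.\<close>
    then have "cuts (C (Suc m)) m" unfolding cuts_def using xC[of "Suc m"] by blast
    then have "idx (C (Suc m)) \<le> m" unfolding idx_def by (rule Least_le)
    then show False using strict_mono_imp_increasing[OF sm, of "Suc m"] by simp
  qed
  have img: "f ` topspace X = cantor_set"
  proof
    show "f ` topspace X \<subseteq> cantor_set" unfolding cantor_set_eq_range_ternary f_def by auto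
    show "cantor_set \<subseteq> f ` topspace X" unfolding cantor_set_eq_range_ternary
    proof clarify
      fix b
      \<comment> \<open>Compactness puts a point on every branch, which gives surjectivity.\<close>
      have "(\<Inter>n. B b n) \<noteq> {}"
      proof (rule compact_space_imp_nest[OF compact])
        show "decseq (B b)" using Bdec by (simp add: decseq_Suc_iff)
      qed (use Bprops in auto)
      then obtain x where x: "\<And>n. x \<in> B b n" by blast
      have xX: "x \<in> topspace X" using x[of 0] B0 by simp
      have *: "A x n = B b n" for n
      proof (induction n)
        case (Suc n)
        have "d x n = b n" using x[of "Suc n"] unfolding d_def Suc BS part_def by (auto split: if_splits)
        then show ?case by (simp add: AS BS Suc)
      qed (simp add: A0 B0)
      have "d x n = b n" for n using x[of "Suc n"] unfolding d_def * BS part_def by (auto split: if_splits)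
      then have "d x = b" by blast
      then have "ternary b = f x" unfolding f_def by simp
      then show "ternary b \<in> f ` topspace X" using xX by blast
    qed
  qed
  have "embedding_map X euclideanreal f"
    by (rule continuous_imp_embedding_map[OF cont compact _ inj]) simp
  then show ?thesis using embedding_map_imp_homeomorphic_space img by metis
qed

subsection \<open>The space of orderings\<close>

text \<open>\<open>Alexander_subbase\<close> speaks of unions of finite intersections relative to
  the whole space; the work is to identify this topology with the inductively generated one.\<close>

lemma compact_space_topology_generated_by:
  assumes fin: "\<And>C. C \<subseteq> B \<Longrightarrow> \<Union>C = \<Union>B \<Longrightarrow> \<exists>C'. finite C' \<and> C' \<subseteq> C \<and> \<Union>C' = \<Union>B"
  shows "compact_space (topology_generated_by B)"
proof (rule Alexander_subbase)
  let ?P = "arbitrary union_of (finite intersection_of (\<lambda>x. x \<in> B) relative_to \<Union>B)"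
  let ?T = "topology ?P"
  have op: "openin ?T = ?P" by (simp add: openin_subbase fun_eq_iff)
  have 1: "openin ?T S" if "generate_topology_on B S" for S
    using that
  proof induction
    case (Basis s)
    have "(finite intersection_of (\<lambda>x. x \<in> B)) s" using Basis by (intro finite_intersection_of_inc)
    moreover have "\<Union>B \<inter> s = s" using Basis by auto
    ultimately have "(finite intersection_of (\<lambda>x. x \<in> B) relative_to \<Union>B) s"
      unfolding relative_to_def by metis
    then show ?case unfolding op by (rule arbitrary_union_of_inc)
  qed auto
  have 2: "openin (topology_generated_by B) S" if "openin ?T S" for S
    by (rule minimal_topology_subbase[OF _ _ that])
      (use topology_generated_by_Basis openin_topspace[of "topology_generated_by B"] in auto)
  show "?T = topology_generated_by B"
    unfolding topology_eq using 1 2 openin_topology_generated_by by blast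
  show "\<exists>C'. finite C' \<and> C' \<subseteq> C \<and> \<Union>C' = topspace (topology_generated_by B)"
    if "C \<subseteq> B" "\<Union>C = topspace (topology_generated_by B)" for C
    using fin[of C] that by simp
qed

text \<open>Finite intersections of subbasic sets form a base. The factor \<open>\<Union>B\<close>
  takes care of empty \<open>C\<close>, whose intersection is the universal set.\<close>

lemma generate_topology_on_finite_nbhd:
  assumes "generate_topology_on B S" "r \<in> S"
  shows "\<exists>C. finite C \<and> C \<subseteq> B \<and> r \<in> \<Inter>C \<and> \<Union>B \<inter> \<Inter>C \<subseteq> S"
  using assms
proof induction
  case (Int S T)
  then obtain C D where "finite C \<and> C \<subseteq> B \<and> r \<in> \<Inter>C \<and> \<Union>B \<inter> \<Inter>C \<subseteq> S"
    "finite D \<and> D \<subseteq> B \<and> r \<in> \<Inter>D \<and> \<Union>B \<inter> \<Inter>D \<subseteq> T" by blast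
  then have "finite (C \<union> D)" "C \<union> D \<subseteq> B" "r \<in> \<Inter>(C \<union> D)" "\<Union>B \<inter> \<Inter>(C \<union> D) \<subseteq> S \<inter> T"
    by auto
  then show ?case by blast
next
  case (UN K)
  then obtain S where "S \<in> K" "r \<in> S" by blast
  obtain C where "finite C \<and> C \<subseteq> B \<and> r \<in> \<Inter>C \<and> \<Union>B \<inter> \<Inter>C \<subseteq> S"
    using UN.IH[OF \<open>S \<in> K\<close> \<open>r \<in> S\<close>] by (rule exE)
  then show ?case using \<open>S \<in> K\<close> by (intro exI[of _ C]) auto
next
  case (Basis s)
  then show ?case by (intro exI[of _ "{s}"]) auto
qed simp

section \<open>Correspondence between orders and positive cones\<close>

definition order_of_cone :: "('a, 'b) monoid_scheme \<Rightarrow> 'a set \<Rightarrow> ('a \<times> 'a) set" where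
  "order_of_cone G P = {(x, y). x \<in> carrier G \<and> y \<in> carrier G \<and> (x = y \<or> inv\<^bsub>G\<^esub> x \<otimes>\<^bsub>G\<^esub> y \<in> P)}"

context group
begin

lemma orderingsD:
  assumes "r \<in> orderings G"
  shows "r \<subseteq> carrier G \<times> carrier G" "\<And>x. x \<in> carrier G \<Longrightarrow> (x, x) \<in> r" "trans r" "antisym r"
    "\<And>x y. x \<in> carrier G \<Longrightarrow> y \<in> carrier G \<Longrightarrow> x \<noteq> y \<Longrightarrow> (x, y) \<in> r \<or> (y, x) \<in> r"
    "\<And>f x y. f \<in> carrier G \<Longrightarrow> (x, y) \<in> r \<Longrightarrow> (f \<otimes> x, f \<otimes> y) \<in> r"
proof -
  have l: "linear_order_on (carrier G) r"
    and f: "\<forall>f\<in>carrier G. \<forall>g\<in>carrier G. \<forall>h\<in>carrier G. (g, h) \<in> r \<longrightarrow> (f \<otimes> g, f \<otimes> h) \<in> r"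
    using assms unfolding orderings_def by auto
  show sub: "r \<subseteq> carrier G \<times> carrier G" and "\<And>x. x \<in> carrier G \<Longrightarrow> (x, x) \<in> r" "trans r" "antisym r"
    "\<And>x y. x \<in> carrier G \<Longrightarrow> y \<in> carrier G \<Longrightarrow> x \<noteq> y \<Longrightarrow> (x, y) \<in> r \<or> (y, x) \<in> r"
    using l unfolding order_on_defs refl_on_def total_on_def by auto
  show "(g \<otimes> x, g \<otimes> y) \<in> r" if "g \<in> carrier G" "(x, y) \<in> r" for g x y
    using f that sub by auto
qed

lemma ordering_iff_positive_cone:
  assumes r: "r \<in> orderings G" and x: "x \<in> carrier G" and y: "y \<in> carrier G"
  shows "(x, y) \<in> r \<longleftrightarrow> x = y \<or> inv x \<otimes> y \<in> positive_cone G r"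
proof -
  note rD = orderingsD[OF r]
  have "(x, y) \<in> r \<longleftrightarrow> (\<one>, inv x \<otimes> y) \<in> r"
    using rD(6)[of "inv x" x y] rD(6)[of x \<one> "inv x \<otimes> y"] x y by (auto simp: inv_mult_cancel)
  moreover have "inv x \<otimes> y = \<one> \<longleftrightarrow> x = y" using x y by (metis inv_equality inv_closed inv_inv l_inv)
  ultimately show ?thesis unfolding positive_cone_def using x y rD(2) by auto
qed

lemma positive_cone_is_positive_cone:
  assumes r: "r \<in> orderings G"
  shows "is_positive_cone G (positive_cone G r)"
  unfolding is_positive_cone_def
proof (intro conjI ballI impI)
  note rD = orderingsD[OF r]
  show "positive_cone G r \<subseteq> carrier G" "\<one> \<notin> positive_cone G r" unfolding positive_cone_def by auto
  show "x \<otimes> y \<in> positive_cone G r" if "x \<in> positive_cone G r" "y \<in> positive_cone G r" for x y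
  proof -
    have xy: "x \<in> carrier G" "y \<in> carrier G" "(\<one>, x) \<in> r" "(\<one>, y) \<in> r" "x \<noteq> \<one>" "y \<noteq> \<one>"
      using that unfolding positive_cone_def by auto
    then have 1: "(x, x \<otimes> y) \<in> r" using rD(6)[of x \<one> y] by simp
    then have "(\<one>, x \<otimes> y) \<in> r" using xy(3) rD(3) unfolding trans_def by blast
    moreover have "x \<otimes> y \<noteq> \<one>" using 1 xy rD(4) unfolding antisym_def by auto
    ultimately show ?thesis unfolding positive_cone_def using xy by simp
  qed
  show "x \<in> positive_cone G r \<or> inv x \<in> positive_cone G r" if x: "x \<in> carrier G" "x \<noteq> \<one>" for x
    using ordering_iff_positive_cone[OF r one_closed x(1)] ordering_iff_positive_cone[OF r x(1) one_closed]
      rD(5)[OF one_closed x(1)] x by auto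
qed

lemma order_of_cone_in_orderings:
  assumes P: "is_positive_cone G P"
  shows "order_of_cone G P \<in> orderings G"
proof -
  note PD = is_positive_coneD[OF P]
  let ?r = "order_of_cone G P"
  have mult: "inv x \<otimes> z \<in> P" if "inv x \<otimes> y \<in> P" "inv y \<otimes> z \<in> P" "x \<in> carrier G" "y \<in> carrier G" "z \<in> carrier G" for x y z
    using PD(3)[OF that(1,2)] that by (simp add: group_word_simps)
  have "?r \<subseteq> carrier G \<times> carrier G" unfolding order_of_cone_def by auto
  moreover have "refl_on (carrier G) ?r" unfolding refl_on_def order_of_cone_def by auto
  moreover have "trans ?r"
    using mult unfolding trans_def order_of_cone_def by blast
  moreover have "antisym ?r"
    using mult[of _ _ _] PD(2) unfolding antisym_def order_of_cone_def by (auto, metis l_inv)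
  moreover have "total_on (carrier G) ?r"
    unfolding total_on_def
  proof (intro ballI impI)
    fix x y assume xy: "x \<in> carrier G" "y \<in> carrier G" "x \<noteq> y"
    then have "inv x \<otimes> y \<noteq> \<one>" by (metis inv_equality inv_closed inv_inv)
    then show "(x, y) \<in> ?r \<or> (y, x) \<in> ?r"
      using PD(4)[of "inv x \<otimes> y"] xy unfolding order_of_cone_def by (auto simp: inv_mult_group)
  qed
  moreover have "(f \<otimes> g, f \<otimes> h) \<in> ?r" if "f \<in> carrier G" "(g, h) \<in> ?r" for f g h
    using that unfolding order_of_cone_def by (auto simp: group_word_simps)
  ultimately show ?thesis unfolding orderings_def order_on_defs by auto
qed

lemma positive_cone_order_of_cone:
  assumes P: "is_positive_cone G P"
  shows "positive_cone G (order_of_cone G P) = P"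
  using is_positive_coneD[OF P] unfolding positive_cone_def order_of_cone_def by auto

lemma order_eq_if_positive_cone_eq:
  assumes "r \<in> orderings G" "s \<in> orderings G" "positive_cone G r = positive_cone G s"
  shows "r = s"
  using ordering_iff_positive_cone[OF assms(1)] ordering_iff_positive_cone[OF assms(2)]
    orderingsD(1)[OF assms(1)] orderingsD(1)[OF assms(2)] assms(3) by auto

lemma order_subbasic_eq:
  assumes "f \<in> carrier G" "g \<in> carrier G" "f \<noteq> g"
  shows "order_subbasic G f g = {r \<in> orderings G. inv f \<otimes> g \<in> positive_cone G r}"
  using assms ordering_iff_positive_cone[of _ f g] unfolding order_subbasic_def by auto

section \<open>Compactness and absence of isolated orders\<close>

lemma compact_ordering_space:
  assumes tf: "torsion_free G" and np: "nilpotent G"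
  shows "compact_space (ordering_space G)"
  unfolding ordering_space_def
proof (rule compact_space_topology_generated_by)
  let ?S = "{order_subbasic G f g |f g. f \<in> carrier G \<and> g \<in> carrier G \<and> f \<noteq> g}"
  have top: "\<Union>(insert (orderings G) ?S) = orderings G" unfolding order_subbasic_def by auto
  fix C assume C: "C \<subseteq> insert (orderings G) ?S" "\<Union>C = \<Union>(insert (orderings G) ?S)"
  show "\<exists>C'. finite C' \<and> C' \<subseteq> C \<and> \<Union>C' = \<Union>(insert (orderings G) ?S)"
  proof (cases "orderings G \<in> C")
    case True
    then show ?thesis unfolding top by (intro exI[of _ "{orderings G}"]) auto
  next
    case False
    \<comment> \<open>An order lies outside \<open>order_subbasic G f g\<close> exactly if
      \<open>inv g \<otimes> f\<close> is positive. So an order for which all of \<open>A\<close> is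
      positive would be missed by the cover.\<close>
    define A where "A = {inv g \<otimes> f | f g. f \<in> carrier G \<and> g \<in> carrier G \<and> f \<noteq> g \<and> order_subbasic G f g \<in> C}"
    have AG: "A \<subseteq> carrier G" unfolding A_def by auto
    have "\<one> \<in> semigroup_generated G A"
    proof (rule ccontr)
      assume "\<one> \<notin> semigroup_generated G A"
      then obtain P where P: "is_positive_cone G P" "A \<subseteq> P" using positive_cone_extending[OF tf np AG] by blast
      have "order_of_cone G P \<in> \<Union>C" using order_of_cone_in_orderings[OF P(1)] C(2) top by simp
      then obtain f g where fg: "f \<in> carrier G" "g \<in> carrier G" "f \<noteq> g" "order_subbasic G f g \<in> C"
        "order_of_cone G P \<in> order_subbasic G f g" using C(1) False by blast
      then have "inv f \<otimes> g \<in> P" using order_subbasic_eq positive_cone_order_of_cone[OF P(1)] by auto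
      moreover have "inv g \<otimes> f \<in> P" using fg P(2) unfolding A_def by blast
      ultimately have "(inv f \<otimes> g) \<otimes> (inv g \<otimes> f) \<in> P" using is_positive_coneD(3)[OF P(1)] by blast
      then show False using is_positive_coneD(2)[OF P(1)] fg by (simp add: group_word_simps)
    qed
    then obtain B where B: "finite B" "B \<subseteq> A" "\<one> \<in> semigroup_generated G B"
      using semigroup_generated_finite by metis
    have "\<forall>b\<in>B. \<exists>f g. b = inv g \<otimes> f \<and> f \<in> carrier G \<and> g \<in> carrier G \<and> f \<noteq> g \<and> order_subbasic G f g \<in> C"
      using B(2) unfolding A_def by blast
    then obtain f g where fg: "\<And>b. b \<in> B \<Longrightarrow> b = inv (g b) \<otimes> f b \<and> f b \<in> carrier G \<and> g b \<in> carrier G \<and>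
        f b \<noteq> g b \<and> order_subbasic G (f b) (g b) \<in> C" by metis
    define C' where "C' = (\<lambda>b. order_subbasic G (f b) (g b)) ` B"
    \<comment> \<open>For an order missed by \<open>C'\<close> all of \<open>B\<close> would be
      positive, and hence the identity too.\<close>
    have "r \<in> \<Union>C'" if r: "r \<in> orderings G" for r
    proof (rule ccontr)
      assume "r \<notin> \<Union>C'"
      then have n: "inv (f b) \<otimes> g b \<notin> positive_cone G r" if "b \<in> B" for b
        using order_subbasic_eq[of "f b" "g b"] fg[OF that] that r unfolding C'_def by auto
      have Pr: "is_positive_cone G (positive_cone G r)" by (rule positive_cone_is_positive_cone[OF r])
      have "B \<subseteq> positive_cone G r"
      proof
        fix b assume b: "b \<in> B"
        have G: "f b \<in> carrier G" "g b \<in> carrier G" "f b \<noteq> g b" using fg[OF b] by auto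
        have "inv (f b) \<otimes> g b \<noteq> \<one>" using G by (metis inv_equality inv_closed inv_inv)
        then have "inv (inv (f b) \<otimes> g b) \<in> positive_cone G r"
          using is_positive_coneD(4)[OF Pr, of "inv (f b) \<otimes> g b"] n[OF b] G by auto
        then show "b \<in> positive_cone G r" using fg[OF b] by (metis inv_closed inv_inv inv_mult_group)
      qed
      then have "semigroup_generated G B \<subseteq> positive_cone G r"
        by (rule semigroup_generated_least) (rule is_positive_coneD(3)[OF Pr])
      then show False using B(3) is_positive_coneD(2)[OF Pr] by blast
    qed
    then have "\<Union>C' = orderings G" unfolding C'_def order_subbasic_def by auto
    moreover have "finite C'" "C' \<subseteq> C" unfolding C'_def using B(1) fg by auto
    ultimately show ?thesis unfolding top by blast
  qed
qed

lemma ordering_not_isolated: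
  assumes ni: "\<And>F. finite F \<Longrightarrow> F \<subseteq> positive_cone G r \<Longrightarrow>
      \<exists>P. is_positive_cone G P \<and> F \<subseteq> P \<and> P \<noteq> positive_cone G r"
    and r: "r \<in> orderings G"
  shows "\<not> openin (ordering_space G) {r}"
proof
  let ?S = "{order_subbasic G f g |f g. f \<in> carrier G \<and> g \<in> carrier G \<and> f \<noteq> g}"
  have top: "\<Union>(insert (orderings G) ?S) = orderings G" unfolding order_subbasic_def by auto
  assume "openin (ordering_space G) {r}"
  then have gen: "generate_topology_on (insert (orderings G) ?S) {r}"
    unfolding ordering_space_def by (rule openin_topology_generated_by)
  then obtain C where C: "finite C" "C \<subseteq> insert (orderings G) ?S" "r \<in> \<Inter>C" "orderings G \<inter> \<Inter>C \<subseteq> {r}"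
    using generate_topology_on_finite_nbhd[OF gen singletonI] unfolding top by (elim exE conjE) (rule that)
  \<comment> \<open>Membership in each \<open>c\<close> is forced by the positivity of a single
    element. When \<open>c\<close> is the whole space any positive element serves, so the cone has
    to be nonempty.\<close>
  have "\<forall>c\<in>C. \<exists>p\<in>positive_cone G r. \<forall>s\<in>orderings G. p \<in> positive_cone G s \<longrightarrow> s \<in> c" if ne: "positive_cone G r \<noteq> {}"
  proof
    fix c assume c: "c \<in> C"
    show "\<exists>p\<in>positive_cone G r. \<forall>s\<in>orderings G. p \<in> positive_cone G s \<longrightarrow> s \<in> c"
    proof (cases "c = orderings G")
      case True
      then show ?thesis using ne by blast
    next
      case False
      then obtain f g where fg: "f \<in> carrier G" "g \<in> carrier G" "f \<noteq> g" "c = order_subbasic G f g"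
        using c C(2) by blast
      have ceq: "c = {r \<in> orderings G. inv f \<otimes> g \<in> positive_cone G r}" using order_subbasic_eq fg by simp
      moreover have "r \<in> c" using c C(3) by blast
      ultimately show ?thesis by blast
    qed
  qed
  moreover have ne: "positive_cone G r \<noteq> {}"
  proof
    assume e: "positive_cone G r = {}"
    obtain P x where P: "is_positive_cone G P" "x \<in> P" using ni[of "{}"] e by auto
    then have "x \<in> carrier G" "x \<noteq> \<one>" using is_positive_coneD(1,2)[OF P(1)] by auto
    then show False using is_positive_coneD(4)[OF positive_cone_is_positive_cone[OF r], of x] e by auto
  qed
  ultimately obtain p where p: "\<And>c. c \<in> C \<Longrightarrow> p c \<in> positive_cone G r"
    "\<And>c s. c \<in> C \<Longrightarrow> s \<in> orderings G \<Longrightarrow> p c \<in> positive_cone G s \<Longrightarrow> s \<in> c" by metis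
  obtain P where P: "is_positive_cone G P" "p ` C \<subseteq> P" "P \<noteq> positive_cone G r"
    using ni[of "p ` C"] C(1) p(1) by blast
  have "order_of_cone G P \<in> orderings G \<inter> \<Inter>C"
    using p(2)[OF _ order_of_cone_in_orderings[OF P(1)]] P(2) order_of_cone_in_orderings[OF P(1)]
      positive_cone_order_of_cone[OF P(1)] by blast
  then have "order_of_cone G P = r" using C(4) by blast
  then show False using P(3) positive_cone_order_of_cone[OF P(1)] by simp
qed

end

theorem theoremB:
  fixes G :: "('a, 'b) monoid_scheme"
  assumes "group G"
    and "carrier G \<noteq> {\<one>\<^bsub>G\<^esub>}"
    and "countable (carrier G)"
    and "torsion_free G"
    and "nilpotent G"
    and "\<not> (comm_group G \<and> abelian_rank G = 1)"
  shows "ordering_space G homeomorphic_space top_of_set cantor_set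
    \<and> (\<forall>r \<in> orderings G. \<not> finitely_generated_semigroup G (positive_cone G r))"
proof -
  interpret group G by fact
  have ni: "\<exists>P. is_positive_cone G P \<and> F \<subseteq> P \<and> P \<noteq> positive_cone G r"
    if "r \<in> orderings G" "finite F" "F \<subseteq> positive_cone G r" for r F
    using positive_cone_not_isolated[OF assms(4,5,2,6) positive_cone_is_positive_cone[OF that(1)] that(2,3)]
    by metis
  define e where "e = from_nat_into (carrier G)"
  have e: "range e = carrier G" unfolding e_def using assms(3) by (intro range_from_nat_into) auto
  \<comment> \<open>The enumeration hits the identity, for which \<open>U n\<close> is empty; this
    is the separate case below.\<close>
  define U where "U n = {r \<in> orderings G. e n \<in> positive_cone G r}" for n
  have Uo: "openin (ordering_space G) (U n) \<and> closedin (ordering_space G) (U n)" for n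
  proof (cases "e n = \<one>\<^bsub>G\<^esub>")
    case True
    then have "U n = {}" unfolding U_def positive_cone_def by auto
    then show ?thesis by simp
  next
    case False
    have en: "e n \<in> carrier G" using e by auto
    have 1: "U n = order_subbasic G \<one>\<^bsub>G\<^esub> (e n)" using order_subbasic_eq[of "\<one>\<^bsub>G\<^esub>" "e n"] en False unfolding U_def by auto
    \<comment> \<open>By totality, the complement is the subbasic set of the opposite
      inequality.\<close>
    have "orderings G - U n = order_subbasic G (e n) \<one>\<^bsub>G\<^esub>"
      unfolding order_subbasic_eq[OF en one_closed False] U_def
    proof safe
      fix r assume r: "r \<in> orderings G"
      note PD = is_positive_coneD[OF positive_cone_is_positive_cone[OF r]]
      show "inv\<^bsub>G\<^esub> (e n) \<otimes>\<^bsub>G\<^esub> \<one>\<^bsub>G\<^esub> \<in> positive_cone G r" if "e n \<notin> positive_cone G r"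
        using PD(4)[OF en False] that en by simp
      show False if "inv\<^bsub>G\<^esub> (e n) \<otimes>\<^bsub>G\<^esub> \<one>\<^bsub>G\<^esub> \<in> positive_cone G r" "e n \<in> positive_cone G r"
        using PD(3)[OF that] PD(2) en by simp
    qed
    moreover have "openin (ordering_space G) (order_subbasic G f g)"
      if "f \<in> carrier G" "g \<in> carrier G" "f \<noteq> g" for f g
      unfolding ordering_space_def by (rule topology_generated_by_Basis) (use that in auto)
    ultimately show ?thesis using 1 en False
      unfolding closedin_def topspace_ordering_space by (auto simp: U_def)
  qed
  have "ordering_space G homeomorphic_space top_of_set cantor_set"
  proof (rule homeomorphic_cantor_set[where U = U])
    show "compact_space (ordering_space G)" by (rule compact_ordering_space[OF assms(4,5)])
    have "semigroup_generated G {} \<subseteq> {}" by (rule semigroup_generated_least) auto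
    then obtain P where "is_positive_cone G P" using positive_cone_extending[OF assms(4,5), of "{}"] by auto
    then show "topspace (ordering_space G) \<noteq> {}"
      using order_of_cone_in_orderings unfolding topspace_ordering_space by blast
    show "\<exists>n. (r \<in> U n) \<noteq> (s \<in> U n)"
      if rs: "r \<in> topspace (ordering_space G)" "s \<in> topspace (ordering_space G)" "r \<noteq> s" for r s
    proof (rule ccontr)
      assume no: "\<not> ?thesis"
      have r: "r \<in> orderings G" "s \<in> orderings G" using rs unfolding topspace_ordering_space by auto
      have "x \<in> positive_cone G r \<longleftrightarrow> x \<in> positive_cone G s" if x: "x \<in> carrier G" for x
      proof -
        obtain n where "x = e n" using x unfolding e[symmetric] by blast
        then show ?thesis using no r unfolding U_def by blast
      qed
      then have "positive_cone G r = positive_cone G s" unfolding positive_cone_def by blast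
      then show False using order_eq_if_positive_cone_eq[OF r] rs(3) by simp
    qed
    show "\<not> openin (ordering_space G) {r}" if "r \<in> topspace (ordering_space G)" for r
      using that ordering_not_isolated[OF ni] unfolding topspace_ordering_space by blast
  qed (use Uo in auto)
  moreover have "\<not> finitely_generated_semigroup G (positive_cone G r)" if r: "r \<in> orderings G" for r
  proof
    assume "finitely_generated_semigroup G (positive_cone G r)"
    then obtain S where S: "finite S" "S \<subseteq> positive_cone G r" "semigroup_generated G S = positive_cone G r"
      unfolding finitely_generated_semigroup_def by blast
    obtain P where P: "is_positive_cone G P" "S \<subseteq> P" "P \<noteq> positive_cone G r" using ni[OF r S(1,2)] by blast
    note PD = is_positive_coneD[OF P(1)]
    note RD = is_positive_coneD[OF positive_cone_is_positive_cone[OF r]]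
    have sub: "positive_cone G r \<subseteq> P" unfolding S(3)[symmetric] by (rule semigroup_generated_least[OF P(2) PD(3)])
    \<comment> \<open>Nested cones coincide: an \<open>x\<close> of the larger cone outside the
      smaller one would have its inverse in the smaller one, and so both signs in the
      larger.\<close>
    have "P \<subseteq> positive_cone G r"
    proof
      fix x assume x: "x \<in> P"
      then have xG: "x \<in> carrier G" "x \<noteq> \<one>\<^bsub>G\<^esub>" using PD(1,2) by auto
      have "inv\<^bsub>G\<^esub> x \<notin> P" using PD(3)[OF x, of "inv\<^bsub>G\<^esub> x"] PD(2) xG by auto
      then show "x \<in> positive_cone G r" using RD(4)[OF xG] sub by blast
    qed
    then show False using sub P(3) by blast
  qed
  ultimately show ?thesis by blast
qed

end
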